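(* Let $\mathbb{F}$ be a field of characteristic $0$, let $k\ge 2$, let $\vec d=(d_1,\dots,d_k)$ be a sequence of positive integers, and let $S=(S(1),\dots,S(k-1))$ be an arbitrary sequence of matrices with $S(i)\in M_{d_i\times d_{i+1}}(\mathbb{F})$ and $S(i)_{d_i,1}\neq 0$ for all $i$. Let $T=(T(1),\dots,T(k-1))$ be the only normalized sequence such that $E(T)$ is $G(\vec d)$-conjugate to $E(S)$. Then the nilpotency degree of $\mathfrak{n}(S)$ is $k-1$ except when (1) $\vec d=(1,\dots,1)$, in which case $\mathfrak{n}(S)$ is $1$-dimensional abelian; or (2) $k$ is odd, $\vec d$ is odd-symmetric with $d_1=d_k=1$, and $T$ is $\phi$-invariant, in which case, if $\vec d\neq(1,\dots,1)$, the nilpotency degree of $\mathfrak{n}(S)$ is $k-2$. (That is: if neither (1) nor (2) holds, the nilpotency degree is $k-1$; and in cases (1), (2) the algebra is as described.)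
   Context: Put $d=d_1+\cdots+d_k$ and regard matrices in $\mathfrak{gl}(d)=\mathfrak{gl}(d,\mathbb{F})$ as partitioned into blocks according to $\vec d$. $J^p(0)$ is the upper triangular nilpotent Jordan block of size $p$ ($1$'s on the first superdiagonal). $D(0,0)=J^{d_1}(0)\oplus\cdots\oplus J^{d_k}(0)\in\mathfrak{gl}(d)$. For a sequence $S=(S(1),\dots,S(k-1))$ with $S(i)\in M_{d_i\times d_{i+1}}$ and $S(i)_{d_i,1}\ne0$, $E(S)\in\mathfrak{gl}(d)$ is the block matrix whose $(i,i+1)$ block is $S(i)$, $1\le i\le k-1$, and all of whose other blocks are $0$. $\mathfrak{n}(S)$ is the Lie subalgebra of $\mathfrak{gl}(d)$ generated by all $(\mathrm{ad}\,D(0,0))^l E(S)$, $l\ge 0$. $G(\vec d)$ is the group of invertible matrices $P_1\oplus\cdots\oplus P_k$ where each $P_i$ is a polynomial in $J^{d_i}(0)$ with non-zero constant term; $E(T)$ is $G(\vec d)$-conjugate to $E(S)$ if $E(T)=PE(S)P^{-1}$ for some $P\in G(\vec d)$. The sequence $S$ is normalized if: (i) $S(i)_{d_i,1}=1$ for $1\le i\le k-1$; (ii) $S(i)_{d_i,j}=S(i+1)_{d_{i+1}+1-j,1}$ for $1\le j\le d_{i+1}$ and $1\le i\le k-2$; (iii) $S(1)_{j,1}=0$ for $1\le j<d_1$, and $S(k-1)_{d_{k-1},j}=0$ for $1<j\le d_k$. For every sequence $S=(S(1),\dots,S(k-1))$ of matrices with $S(i)\in M_{d_i\times d_{i+1}}(\mathbb{F})$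 and $S(i)_{d_i,1}\neq 0$ for all $i$, there is exactly one normalized sequence $T$ with $E(T)$ $G(\vec d)$-conjugate to $E(S)$. $\vec d$ is symmetric if $d_i=d_{k+1-i}$ for all $i$; it is odd-symmetric if in addition $k$ is odd and $d_{(k+1)/2}$ is odd. $\phi:\mathfrak{gl}(d)\to\mathfrak{gl}(d)$ is the Lie algebra automorphism $\phi(A)_{i,j}=(-1)^{i-j+1}A_{d+1-j,d+1-i}$. A sequence $S$ is $\phi$-invariant if $\phi(E(S))=E(S)$. Lower central series: $\mathfrak{g}^0=\mathfrak{g}$, $\mathfrak{g}^{i+1}=[\mathfrak{g},\mathfrak{g}^i]$. The nilpotency degree of a nilpotent $\mathfrak{g}$ is the least $m$ with $\mathfrak{g}^m=0$ (a non-zero abelian algebra has degree $1$). *)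

theory Defs
  imports "Jordan_Normal_Form.Jordan_Normal_Form" "Jordan_Normal_Form.VS_Connect"
begin

text \<open>
  Matrices and lists are indexed from 0, so the \<open>(i, j)\<close> entry of the \<open>l\<close>-th member of a
  sequence is here \<open>S ! (l - 1) $$ (i - 1, j - 1)\<close>. The sequence of block sizes is a list \<open>ds\<close>
  of length \<open>k\<close>.
\<close>

abbreviation gl :: "'a :: field itself \<Rightarrow> nat \<Rightarrow> ('a, 'a mat) module" where
  "gl ty d \<equiv> module_mat ty d d"

lemma vectorspace_module_mat:
  "vectorspace class_ring (module_mat TYPE('a :: field) nr nc)"
proof -
  interpret abelian_group "module_mat TYPE('a) nr nc" by (rule abelian_group_mat)
  interpret field "class_ring :: 'a ring" by (rule class_field)
  show ?thesis
    by unfold_locales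
      (auto simp: module_mat_simps add_smult_distrib_left_mat add_smult_distrib_right_mat)
qed

definition lie_bracket :: "'a :: field mat \<Rightarrow> 'a mat \<Rightarrow> 'a mat" where
  "lie_bracket A B = A * B - B * A"

definition lie_subalgebra :: "nat \<Rightarrow> 'a :: field mat set \<Rightarrow> bool" where
  "lie_subalgebra d L \<longleftrightarrow>
     VectorSpace.subspace class_ring L (gl TYPE('a) d) \<and>
     (\<forall>A\<in>L. \<forall>B\<in>L. lie_bracket A B \<in> L)"

definition lie_generated :: "nat \<Rightarrow> 'a :: field mat set \<Rightarrow> 'a mat set" where
  "lie_generated d X = \<Inter>{L. lie_subalgebra d L \<and> X \<subseteq> L}"

primrec lower_central :: "nat \<Rightarrow> 'a :: field mat set \<Rightarrow> nat \<Rightarrow> 'a mat set" where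
  "lower_central d L 0 = L"
| "lower_central d L (Suc i) =
     LinearCombinations.module.span class_ring (gl TYPE('a) d)
       {lie_bracket A B | A B. A \<in> L \<and> B \<in> lower_central d L i}"

definition has_nilpotency_degree :: "nat \<Rightarrow> 'a :: field mat set \<Rightarrow> nat \<Rightarrow> bool" where
  "has_nilpotency_degree d L m \<longleftrightarrow>
     lower_central d L m = {0\<^sub>m d d} \<and> (\<forall>i<m. lower_central d L i \<noteq> {0\<^sub>m d d})"

definition lie_abelian :: "nat \<Rightarrow> 'a :: field mat set \<Rightarrow> bool" where
  "lie_abelian d L \<longleftrightarrow> (\<forall>A\<in>L. \<forall>B\<in>L. lie_bracket A B = 0\<^sub>m d d)"

definition lie_dim :: "nat \<Rightarrow> 'a :: field mat set \<Rightarrow> nat" where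
  "lie_dim d L = vectorspace.dim class_ring ((gl TYPE('a) d)\<lparr>carrier := L\<rparr>)"

definition block_seq :: "nat list \<Rightarrow> 'a :: field mat list \<Rightarrow> bool" where
  "block_seq ds S \<longleftrightarrow> Suc (length S) = length ds \<and>
     (\<forall>i<length S. S ! i \<in> carrier_mat (ds ! i) (ds ! Suc i) \<and>
                   S ! i $$ (ds ! i - 1, 0) \<noteq> 0)"

definition D_mat :: "nat list \<Rightarrow> 'a :: field mat" where
  "D_mat ds = jordan_matrix (map (\<lambda>n. (n, 0)) ds)"

text \<open>Row (and column) index at which the \<open>i\<close>-th diagonal block starts.\<close>

definition block_start :: "nat list \<Rightarrow> nat \<Rightarrow> nat" where
  "block_start ds i = sum_list (take i ds)"

text \<open>At most one summand is non-zero: the one whose block \<open>(i, i + 1)\<close> contains \<open>(r, c)\<close>.\<close>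

definition E_mat :: "nat list \<Rightarrow> 'a :: field mat list \<Rightarrow> 'a mat" where
  "E_mat ds S = mat (sum_list ds) (sum_list ds) (\<lambda>(r, c).
     \<Sum>i<length S.
       if block_start ds i \<le> r \<and> r < block_start ds (Suc i) \<and>
          block_start ds (Suc i) \<le> c \<and> c < block_start ds (Suc (Suc i))
       then S ! i $$ (r - block_start ds i, c - block_start ds (Suc i)) else 0)"

definition n_alg :: "nat list \<Rightarrow> 'a :: field mat list \<Rightarrow> 'a mat set" where
  "n_alg ds S = lie_generated (sum_list ds)
     (range (\<lambda>l. (lie_bracket (D_mat ds) ^^ l) (E_mat ds S)))"

text \<open>\<open>p(A)\<close> for an \<open>n \<times> n\<close> matrix \<open>A\<close>, computed entrywise.\<close>

definition mat_poly_eval :: "'a :: field poly \<Rightarrow> nat \<Rightarrow> 'a mat \<Rightarrow> 'a mat" where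
  "mat_poly_eval p n A =
     mat n n (\<lambda>(i, j). \<Sum>m\<le>degree p. coeff p m * (A ^\<^sub>m m) $$ (i, j))"

definition G_group :: "nat list \<Rightarrow> 'a :: field mat set" where
  "G_group ds = {diag_block_mat Ps | Ps.
     invertible_mat (diag_block_mat Ps) \<and> length Ps = length ds \<and>
     (\<forall>i<length ds. \<exists>p. coeff p 0 \<noteq> 0 \<and>
        Ps ! i = mat_poly_eval p (ds ! i) (jordan_block (ds ! i) 0))}"

text \<open>In \<open>similar_mat_wit A B P Q\<close> the matrix \<open>Q\<close> is the inverse of \<open>P\<close> and \<open>A = P * B * Q\<close>.\<close>

definition G_conjugate :: "nat list \<Rightarrow> 'a :: field mat \<Rightarrow> 'a mat \<Rightarrow> bool" where
  "G_conjugate ds A B \<longleftrightarrow> (\<exists>P\<in>G_group ds. \<exists>Q. similar_mat_wit A B P Q)"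

definition normalized :: "nat list \<Rightarrow> 'a :: field mat list \<Rightarrow> bool" where
  "normalized ds S \<longleftrightarrow> (let k = length ds in
     (\<forall>i. i + 1 < k \<longrightarrow> S ! i $$ (ds ! i - 1, 0) = 1) \<and>
     (\<forall>i. i + 2 < k \<longrightarrow> (\<forall>j<ds ! (i + 1).
        S ! i $$ (ds ! i - 1, j) = S ! (i + 1) $$ (ds ! (i + 1) - 1 - j, 0))) \<and>
     (\<forall>j. j < ds ! 0 - 1 \<longrightarrow> S ! 0 $$ (j, 0) = 0) \<and>
     (\<forall>j. 0 < j \<and> j < ds ! (k - 1) \<longrightarrow> S ! (k - 2) $$ (ds ! (k - 2) - 1, j) = 0))"

definition symmetric_dims :: "nat list \<Rightarrow> bool" where
  "symmetric_dims ds \<longleftrightarrow> (\<forall>i<length ds. ds ! i = ds ! (length ds - 1 - i))"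

definition odd_symmetric_dims :: "nat list \<Rightarrow> bool" where
  "odd_symmetric_dims ds \<longleftrightarrow>
     symmetric_dims ds \<and> odd (length ds) \<and> odd (ds ! ((length ds - 1) div 2))"

text \<open>Shifting the indices turns \<open>d + 1 - j\<close> into \<open>d - 1 - j\<close> and leaves the sign unchanged.\<close>

definition phi :: "nat \<Rightarrow> 'a :: field mat \<Rightarrow> 'a mat" where
  "phi d A = mat d d (\<lambda>(i, j). (-1) powi (int i - int j + 1) * A $$ (d - 1 - j, d - 1 - i))"

definition phi_invariant :: "nat list \<Rightarrow> 'a :: field mat list \<Rightarrow> bool" where
  "phi_invariant ds S \<longleftrightarrow> phi (sum_list ds) (E_mat ds S) = E_mat ds S"

definition all_ones_dims :: "nat list \<Rightarrow> bool" where
  "all_ones_dims ds \<longleftrightarrow> (\<forall>i<length ds. ds ! i = 1)"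

definition phi_exception :: "nat list \<Rightarrow> 'a :: field mat list \<Rightarrow> bool" where
  "phi_exception ds T \<longleftrightarrow>
     odd (length ds) \<and> odd_symmetric_dims ds \<and>
     ds ! 0 = 1 \<and> ds ! (length ds - 1) = 1 \<and> phi_invariant ds T"

end

theory Submission
  imports Defs "HOL-Library.Multiset"
begin

text \<open>Grading rows by blocks, \<open>D(0,0)\<close> has degree 0 and \<open>E(S)\<close> degree 1, so the nilpotency degree is at
  most \<open>k - 1\<close>. On the first superdiagonal the entries of \<open>D(0,0)\<close> and \<open>E(S)\<close> have complementary
  supports; hence the entry of a product of these matrices at distance from the diagonal equal to the
  number of factors is non-zero for exactly one word \<open>w\<close>, read off the superdiagonal. An entry of a
  right-normed bracket is thus a non-zero multiple of the coefficient of \<open>w\<close>, and over a field of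
  characteristic 0 a word occurs in some bracket unless it is a power of a letter or a palindrome of
  even length. This gives degree \<open>k - 1\<close> unless the superdiagonal word is of this form (words that
  extend a shorter one beyond the first or last block settle \<open>d\<^sub>1 > 1\<close> and \<open>d\<^sub>k > 1\<close>).

  If it is a palindrome of even length, the dimensions are odd-symmetric and \<open>\<phi>\<close> fixes \<open>D(0,0)\<close>. If
  \<open>T\<close> is \<open>\<phi>\<close>-invariant, everything in \<open>\<nn>(T)\<close> is fixed by \<open>\<phi>\<close>, which acts as \<open>-1\<close> on the corner entry,
  the only one of degree \<open>k - 1\<close>. Otherwise the first diagonal on which \<open>E(T)\<close> and its image under
  \<open>\<phi>\<close> differ yields a function on words that would be a non-trivial relation among all brackets if
  these vanished in the corner; a combinatorial induction on palindromes shows that there is none.\<close>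


subsection \<open>Coefficients of words in brackets\<close>

text \<open>D(0,0) need not lie in n(S), but it acts on n(S) by a derivation; words in both letters
  may therefore be used, and only the letters E count towards the lower central series.

  The obstacle is the palindromic case: the superdiagonal word has coefficient 0 in every bracket,
  and the corner entry of a shorter word is a sum over many paths. Subtracting the corner entry of
  the same word in phi(E) leaves only paths with a single long step, on the first diagonal where E
  and phi(E) differ. Such a path reads the superdiagonal word with one stretch contracted to a
  letter True, whence \<open>shortened\<close>. Replacing E by phi(E) amounts to reversing words up
  to sign, so it keeps the vanishing of all brackets.

  Two difficulties remain. Contracting at different places may give the same word, and the
  contributions could cancel; condition (ii) of the normalization makes them equal. And a bracket
  may meet many contracted words; so outer runs are peeled off the palindrome, using brackets that
  meet only one word of the support up to reversal.\<close>

text \<open>A function \<open>f\<close> on words is a linear functional on the free associative algebra, and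
  \<open>bracket_eval z f\<close> is its value at the right-normed bracket of the letters of \<open>z\<close>. In the
  application \<open>False\<close> stands for \<open>D(0,0)\<close> and \<open>True\<close> for \<open>E(S)\<close>.\<close>

primrec bracket_eval :: "'l list \<Rightarrow> ('l list \<Rightarrow> 'a) \<Rightarrow> 'a :: comm_ring_1" where
  "bracket_eval [] f = 0"
| "bracket_eval (x # z) f = (if z = [] then f [x]
     else bracket_eval z (\<lambda>u. f (x # u)) - bracket_eval z (\<lambda>u. f (u @ [x])))"

text \<open>Expanding a bracket only rearranges its letters, so only the values of \<open>f\<close>
  on rearrangements of \<open>z\<close> matter. Degrees and letter counts enter later arguments
  through this fact.\<close>

lemma bracket_eval_cong:
  assumes "\<And>u. mset u = mset z \<Longrightarrow> f u = g u"
  shows "bracket_eval z f = bracket_eval z g"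
  using assms
proof (induction z arbitrary: f g)
  case (Cons x z)
  show ?case
  proof (cases "z = []")
    case False
    have "bracket_eval z (\<lambda>u. f (x # u)) = bracket_eval z (\<lambda>u. g (x # u))"
      by (rule Cons.IH) (simp add: Cons.prems)
    moreover have "bracket_eval z (\<lambda>u. f (u @ [x])) = bracket_eval z (\<lambda>u. g (u @ [x]))"
      by (rule Cons.IH) (simp add: Cons.prems)
    ultimately show ?thesis using False by simp
  qed (simp add: Cons.prems)
qed simp

lemma bracket_eval_zero [simp]: "bracket_eval z (\<lambda>u. 0) = 0"
  by (induction z) auto

lemma bracket_eval_add:
  "bracket_eval z (\<lambda>u. f u + g u) = bracket_eval z f + bracket_eval z g"
  by (induction z arbitrary: f g) auto

lemma bracket_eval_diff:
  "bracket_eval z (\<lambda>u. f u - g u) = bracket_eval z f - bracket_eval z g"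
  by (induction z arbitrary: f g) auto

lemma bracket_eval_scale: "bracket_eval z (\<lambda>u. c * f u) = c * bracket_eval z f"
  by (induction z arbitrary: f) (auto simp: right_diff_distrib)

lemma bracket_eval_sum:
  "bracket_eval z (\<lambda>u. \<Sum>i\<in>I. f i u) = (\<Sum>i\<in>I. bracket_eval z (f i))"
  by (induction I rule: infinite_finite_induct) (auto simp: bracket_eval_add)

text \<open>Reversal of words is an anti-automorphism, so each of the \<open>length z - 1\<close>
  nested commutators changes sign. The exponent \<open>Suc (length z)\<close> has the same parity
  and avoids truncated subtraction.\<close>

lemma bracket_eval_rev:
  "bracket_eval z (\<lambda>u. f (rev u)) = (-1) ^ Suc (length z) * bracket_eval z f"
proof (induction z arbitrary: f)
  case (Cons x z)
  show ?case
  proof (cases "z = []")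
    case False
    have "bracket_eval z (\<lambda>u. f (rev (x # u))) = (-1) ^ Suc (length z) * bracket_eval z (\<lambda>u. f (u @ [x]))"
      using Cons.IH[of "\<lambda>u. f (u @ [x])"] by simp
    moreover have "bracket_eval z (\<lambda>u. f (rev (u @ [x]))) = (-1) ^ Suc (length z) * bracket_eval z (\<lambda>u. f (x # u))"
      using Cons.IH[of "\<lambda>u. f (x # u)"] by simp
    ultimately show ?thesis using False by (simp add: algebra_simps)
  qed simp
qed simp

text \<open>The indicator of \<open>u\<close> is dual to the basis of words, so this is the
  coefficient of \<open>u\<close> in the expanded bracket of \<open>z\<close>.\<close>

definition coef :: "'l list \<Rightarrow> 'l list \<Rightarrow> 'a :: comm_ring_1" where
  "coef z u = bracket_eval z (\<lambda>v. if v = u then 1 else 0)"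

lemma coef_mset: "coef z u \<noteq> (0 :: 'a :: comm_ring_1) \<Longrightarrow> mset u = mset z"
proof (rule ccontr)
  assume a: "coef z u \<noteq> (0 :: 'a)" and b: "mset u \<noteq> mset z"
  have "coef z u = bracket_eval z (\<lambda>v. (0 :: 'a))"
    unfolding coef_def by (rule bracket_eval_cong) (use b in auto)
  with a show False by simp
qed

lemma coef_rev: "coef z (rev u) = (-1) ^ Suc (length z) * coef z u"
proof -
  have "coef z (rev u) = bracket_eval z (\<lambda>v. if rev v = u then 1 else 0)"
    unfolding coef_def by (rule bracket_eval_cong) (metis rev_rev_ident)
  also have "\<dots> = (-1) ^ Suc (length z) * coef z u"
    unfolding coef_def using bracket_eval_rev[of z "\<lambda>v. if v = u then 1 else 0"] by simp
  finally show ?thesis .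
qed

lemma bracket_eval_conv_coef:
  fixes f :: "bool list \<Rightarrow> 'a :: comm_ring_1"
  shows "bracket_eval z f = (\<Sum>u | mset u = mset z. f u * coef z u)"
proof -
  have fin: "finite {u. mset u = mset z}"
    by (rule finite_subset[OF _ finite_lists_length_eq[of UNIV "length z"]])
       (auto dest: mset_eq_length)
  have "bracket_eval z f = bracket_eval z (\<lambda>v. \<Sum>u | mset u = mset z. f u * (if v = u then 1 else 0))"
    by (rule bracket_eval_cong) (auto simp: fin if_distrib[of "\<lambda>x. _ * x"] sum.delta cong: if_cong)
  also have "\<dots> = (\<Sum>u | mset u = mset z. f u * coef z u)"
    by (simp add: bracket_eval_sum bracket_eval_scale coef_def)
  finally show ?thesis .
qed

lemma bracket_eval_single:
  fixes f :: "bool list \<Rightarrow> 'a :: comm_ring_1"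
  assumes "\<And>u. mset u = mset z \<Longrightarrow> f u \<noteq> 0 \<Longrightarrow> u = w"
  shows "bracket_eval z f = f w * coef z w"
proof -
  have "bracket_eval z f = bracket_eval z (\<lambda>v. f w * (if v = w then 1 else 0))"
    by (rule bracket_eval_cong) (use assms in auto)
  thus ?thesis by (simp add: bracket_eval_scale coef_def)
qed

text \<open>Left and right multiplication by \<open>x\<close> commute, so the \<open>K\<close>-th
  power of ad \<open>x\<close> expands by the binomial theorem. For \<open>z = []\<close> this would
  fail: the empty bracket counts as 0, but the bracket of a lone \<open>x\<close> does not.\<close>

lemma bracket_eval_replicate:
  assumes "z \<noteq> []"
  shows "bracket_eval (replicate K x @ z) f =
    (\<Sum>j\<le>K. (-1) ^ j * of_nat (K choose j) *
       bracket_eval z (\<lambda>u. f (replicate (K - j) x @ u @ replicate j x)))"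
proof (induction K arbitrary: f)
  case 0
  show ?case by simp
next
  case (Suc K)
  let ?B = "\<lambda>i j. bracket_eval z (\<lambda>u. f (replicate i x @ u @ replicate j x))"
  have r: "replicate n x @ [x] = replicate (Suc n) x" for n
    by (simp add: replicate_append_same)
  have 1: "bracket_eval (replicate K x @ z) (\<lambda>u. f (x # u)) =
     (\<Sum>j\<le>K. (-1) ^ j * of_nat (K choose j) * ?B (Suc K - j) j)"
    unfolding Suc.IH by (rule sum.cong) (auto simp: Suc_diff_le)
  have 2: "bracket_eval (replicate K x @ z) (\<lambda>u. f (u @ [x])) =
     (\<Sum>j\<le>K. (-1) ^ j * of_nat (K choose j) * ?B (K - j) (Suc j))"
    unfolding Suc.IH by (rule sum.cong) (auto simp: r replicate_append_same)
  have "(\<Sum>j\<le>Suc K. (-1) ^ j * of_nat (Suc K choose j) * ?B (Suc K - j) j) =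
     ?B (Suc K) 0 + (\<Sum>j\<le>K. (-1) ^ Suc j * of_nat (Suc K choose Suc j) * ?B (K - j) (Suc j))"
    by (subst sum.atMost_Suc_shift) simp
  also have "(\<Sum>j\<le>K. (-1) ^ Suc j * of_nat (Suc K choose Suc j) * ?B (K - j) (Suc j)) =
     (\<Sum>j\<le>K. (-1) ^ Suc j * of_nat (K choose Suc j) * ?B (K - j) (Suc j)) -
     (\<Sum>j\<le>K. (-1) ^ j * of_nat (K choose j) * ?B (K - j) (Suc j))"
    unfolding sum_subtractf[symmetric]
    by (rule sum.cong) (auto simp: algebra_simps)
  also have "?B (Suc K) 0 + ((\<Sum>j\<le>K. (-1) ^ Suc j * of_nat (K choose Suc j) * ?B (K - j) (Suc j)) -
     (\<Sum>j\<le>K. (-1) ^ j * of_nat (K choose j) * ?B (K - j) (Suc j))) =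
     (\<Sum>j\<le>Suc K. (-1) ^ j * of_nat (K choose j) * ?B (Suc K - j) j) -
     (\<Sum>j\<le>K. (-1) ^ j * of_nat (K choose j) * ?B (K - j) (Suc j))"
    by (subst sum.atMost_Suc_shift) simp
  also have "(\<Sum>j\<le>Suc K. (-1) ^ j * of_nat (K choose j) * ?B (Suc K - j) j) =
      (\<Sum>j\<le>K. (-1) ^ j * of_nat (K choose j) * ?B (Suc K - j) j)"
    by (simp add: binomial_eq_0)
  finally show ?case using assms 1 2 by simp
qed

lemma coef_frame:
  "bracket_eval z (\<lambda>v. if A @ v @ B = A @ u @ B then 1 else 0) = coef z u"
  by (simp add: coef_def)

lemma coef_replicate:
  assumes "z \<noteq> []"
  shows "coef (replicate K x @ z) w =
    (\<Sum>j\<le>K. (-1) ^ j * of_nat (K choose j) *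
       bracket_eval z (\<lambda>u. if replicate (K - j) x @ u @ replicate j x = w then 1 else 0))"
  unfolding coef_def by (rule bracket_eval_replicate[OF assms])

text \<open>The \<open>K\<close> outer letters of the bracket are split between the two ends of any
  word that occurs in it; this is what bounds the outer runs of such words.\<close>

lemma coef_replicate_dest:
  assumes "z \<noteq> []" and "coef (replicate K x @ z) w \<noteq> (0 :: 'a :: comm_ring_1)"
  obtains j u where "j \<le> K" "w = replicate (K - j) x @ u @ replicate j x" "coef z u \<noteq> (0 :: 'a)"
proof -
  from assms(2) obtain j where j: "j \<le> K" and nz: "bracket_eval z
      (\<lambda>u. if replicate (K - j) x @ u @ replicate j x = w then 1 else 0) \<noteq> (0 :: 'a)"
    unfolding coef_replicate[OF assms(1)]
    by (metis (no_types, lifting) atMost_iff mult_zero_right sum.neutral)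
  show thesis
  proof (cases "\<exists>u. w = replicate (K - j) x @ u @ replicate j x")
    case True
    then obtain u where u: "w = replicate (K - j) x @ u @ replicate j x" by blast
    with nz have "coef z u \<noteq> (0 :: 'a)" by (simp add: coef_frame coef_def)
    with that j u show thesis by blast
  next
    case False
    hence "(\<lambda>u. if replicate (K - j) x @ u @ replicate j x = w then 1 else 0) = (\<lambda>u. 0 :: 'a)"
      by (metis (full_types))
    with nz show thesis by simp
  qed
qed

lemma coef_Cons:
  assumes "z \<noteq> []"
  shows "coef (x # z) w = (if w \<noteq> [] \<and> hd w = x then coef z (tl w) else 0) -
    (if w \<noteq> [] \<and> last w = x then coef z (butlast w) else 0)"
proof -
  have a: "(\<lambda>u. if x # u = w then 1 else 0 :: 'b) =
      (if w \<noteq> [] \<and> hd w = x then (\<lambda>u. if u = tl w then 1 else 0) else (\<lambda>u. 0))"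
    by (cases w) (auto simp: fun_eq_iff)
  have b: "(\<lambda>u. if u @ [x] = w then 1 else 0 :: 'b) =
      (if w \<noteq> [] \<and> last w = x then (\<lambda>u. if u = butlast w then 1 else 0) else (\<lambda>u. 0))"
    by (cases w rule: rev_cases) (auto simp: fun_eq_iff)
  show ?thesis using assms by (simp add: coef_def a b)
qed

text \<open>The words that occur in no bracket: reversing words acts as \<open>-1\<close> on brackets of even degree, which
  kills the coefficients of palindromes.\<close>

definition excluded :: "bool list \<Rightarrow> bool" where
  "excluded w \<longleftrightarrow> (\<exists>x n. n \<ge> 2 \<and> w = replicate n x) \<or> (rev w = w \<and> even (length w))"

lemma even_count_palindrome:
  assumes "rev w = w" "even (length w)"
  shows "even (count (mset w) x)"
proof -
  define n where "n = length w div 2"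
  have "drop n w = rev (take n w)"
    using assms by (metis add_diff_cancel_left' dvd_mult_div_cancel mult_2 n_def rev_drop rev_swap)
  hence "mset w = mset (take n w) + mset (take n w)"
    by (metis append_take_drop_id mset_append mset_rev)
  thus ?thesis by simp
qed

section \<open>Outer runs, and the words that occur in some bracket\<close>

lemma run_decomposition:
  assumes "y \<in> set w" "y \<noteq> x"
  obtains p q Y where "w = replicate p x @ Y @ replicate q x" "Y \<noteq> []" "hd Y \<noteq> x" "last Y \<noteq> x"
proof -
  let ?P = "\<lambda>y. y = x"
  define D where "D = dropWhile ?P w"
  define Y where "Y = rev (dropWhile ?P (rev D))"
  have rep: "takeWhile ?P v = replicate (length (takeWhile ?P v)) x" for v
    by (induction v) auto
  have w: "w = takeWhile ?P w @ D" by (simp add: D_def)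
  have D: "D = Y @ rev (takeWhile ?P (rev D))"
    unfolding Y_def by (metis rev_append rev_rev_ident takeWhile_dropWhile_id)
  have Dne: "D \<noteq> []" using assms by (auto simp: D_def)
  hence hdD: "hd D \<noteq> x" unfolding D_def by (rule hd_dropWhile)
  moreover have "hd D \<in> set D" using Dne by simp
  ultimately have ne: "dropWhile ?P (rev D) \<noteq> []" by (auto simp: dropWhile_eq_Nil_conv)
  hence Yne: "Y \<noteq> []" by (simp add: Y_def)
  have "last Y \<noteq> x" using hd_dropWhile[OF ne] ne by (simp add: Y_def last_rev)
  moreover have "hd Y \<noteq> x" using hdD Yne by (subst (asm) D) (simp add: hd_append)
  moreover have "w = replicate (length (takeWhile ?P w)) x @ Y @
      replicate (length (takeWhile ?P (rev D))) x"
    by (subst w, subst D, subst rep, subst (2) rep) simp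
  ultimately show thesis using that Yne by blast
qed

lemma replicate_prefix_le:
  assumes "replicate i x @ s = replicate p x @ t" "t \<noteq> []" "hd t \<noteq> x"
  shows "i \<le> p"
proof (rule ccontr)
  assume "\<not> i \<le> p"
  hence "(replicate i x @ s) ! p = x" by (simp add: nth_append)
  moreover have "(replicate p x @ t) ! p = hd t" using assms by (simp add: nth_append hd_conv_nth)
  ultimately show False using assms by simp
qed

text \<open>\<open>Y\<close> is bounded by letters other than \<open>x\<close>, so \<open>p\<close>
  and \<open>q\<close> are the lengths of the maximal outer runs, and every other frame of letters
  \<open>x\<close> sits inside them.\<close>

lemma frame_le:
  assumes "replicate i x @ u @ replicate j x = replicate p x @ Y @ replicate q x"
    and "Y \<noteq> []" "hd Y \<noteq> x" "last Y \<noteq> x"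
  shows "i \<le> p" "j \<le> q" "u = replicate (p - i) x @ Y @ replicate (q - j) x"
proof -
  show i: "i \<le> p" using replicate_prefix_le[OF assms(1)] assms by simp
  have "replicate j x @ rev u @ replicate i x = replicate q x @ rev Y @ replicate p x"
    using arg_cong[OF assms(1), of rev] by simp
  thus j: "j \<le> q" using assms replicate_prefix_le[of j x _ q "rev Y @ replicate p x"]
    by (simp add: hd_rev)
  have "replicate p x = replicate i x @ replicate (p - i) x"
    using i by (metis le_add_diff_inverse replicate_add)
  moreover have "replicate q x = replicate (q - j) x @ replicate j x"
    using j by (metis le_add_diff_inverse2 replicate_add)
  ultimately show "u = replicate (p - i) x @ Y @ replicate (q - j) x"
    using assms(1) by simp
qed

lemma coef_replicate_framed:
  assumes "z \<noteq> []" "Y \<noteq> []" "hd Y \<noteq> x" "last Y \<noteq> x"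
  shows "coef (replicate K x @ z) (replicate p x @ Y @ replicate q x) =
    (\<Sum>j\<le>K. if K - j \<le> p \<and> j \<le> q then (-1) ^ j * of_nat (K choose j) *
       coef z (replicate (p - (K - j)) x @ Y @ replicate (q - j) x) else (0 :: 'a :: comm_ring_1))"
  unfolding coef_replicate[OF assms(1)]
proof (rule sum.cong)
  fix j assume "j \<in> {..K}"
  let ?w = "replicate p x @ Y @ replicate q x"
  let ?b = "\<lambda>u. replicate (K - j) x @ u @ replicate j x = ?w"
  show "(-1) ^ j * of_nat (K choose j) * bracket_eval z (\<lambda>u. if ?b u then 1 else 0) =
    (if K - j \<le> p \<and> j \<le> q then (-1) ^ j * of_nat (K choose j) *
       coef z (replicate (p - (K - j)) x @ Y @ replicate (q - j) x) else (0 :: 'a))"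
  proof (cases "K - j \<le> p \<and> j \<le> q")
    case True
    have "replicate p x = replicate (K - j) x @ replicate (p - (K - j)) x"
      using True by (metis le_add_diff_inverse replicate_add)
    moreover have "replicate q x = replicate (q - j) x @ replicate j x"
      using True by (metis le_add_diff_inverse2 replicate_add)
    ultimately have "?b u \<longleftrightarrow> u = replicate (p - (K - j)) x @ Y @ replicate (q - j) x" for u
      by simp
    thus ?thesis using True by (simp add: coef_def)
  next
    case False
    hence "\<not> ?b u" for u using frame_le(1,2)[OF _ assms(2-4)] by blast
    thus ?thesis using False by auto
  qed
qed simp

text \<open>With as many letters \<open>x\<close> as the frame contains,
  \<open>p + q - j \<le> p\<close> and \<open>j \<le> q\<close> force \<open>j = q\<close>, and a
  single binomial term survives.\<close>

lemma coef_strip_all: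
  assumes "z \<noteq> []" "Y \<noteq> []" "hd Y \<noteq> x" "last Y \<noteq> x"
  shows "coef (replicate (p + q) x @ z) (replicate p x @ Y @ replicate q x) =
    (-1) ^ q * of_nat ((p + q) choose q) * (coef z Y :: 'a :: comm_ring_1)"
proof -
  have "(if p + q - j \<le> p \<and> j \<le> q then (-1) ^ j * of_nat ((p + q) choose j) *
       coef z (replicate (p - (p + q - j)) x @ Y @ replicate (q - j) x) else (0 :: 'a)) =
       (if j = q then (-1) ^ q * of_nat ((p + q) choose q) * coef z Y else 0)" if "j \<le> p + q" for j
    using that by auto
  thus ?thesis unfolding coef_replicate_framed[OF assms] by (simp add: sum.delta)
qed

text \<open>Stripping all but one of the letters \<open>x\<close> leaves \<open>x Y\<close> or \<open>Y x\<close>, which are equal up to sign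
  if \<open>Y\<close> is a palindrome.\<close>

lemma coef_strip_all_but_one:
  assumes "z \<noteq> []" "Y \<noteq> []" "hd Y \<noteq> x" "last Y \<noteq> x" "rev Y = Y"
    and p: "p > 0" and q: "q > 0"
  shows "coef (replicate (p + q - 1) x @ z) (replicate p x @ Y @ replicate q x) =
    (-1) ^ q * (of_nat ((p + q - 1) choose q) - (-1) ^ length Y * of_nat ((p + q - 1) choose (q - 1))) *
      (coef z (x # Y) :: 'a :: comm_ring_1)"
proof (cases "length z = Suc (length Y)")
  case True
  define t where "t j = (if p + q - 1 - j \<le> p \<and> j \<le> q then (-1) ^ j * of_nat ((p + q - 1) choose j) *
       coef z (replicate (p - (p + q - 1 - j)) x @ Y @ replicate (q - j) x) else (0 :: 'a))" for j
  \<comment> \<open>One letter \<open>x\<close> is left over: \<open>j = q\<close> leaves it in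
    front of \<open>Y\<close>, \<open>j = q - 1\<close> behind it, and no other \<open>j\<close>
    fits into the frame.\<close>
  have "(\<Sum>j\<le>p + q - 1. t j) = (\<Sum>j\<in>{q - 1, q}. t j)"
    by (rule sum.mono_neutral_right) (use p q in \<open>auto simp: t_def\<close>)
  also have "\<dots> = t (q - 1) + t q" using q by simp
  also have "t q = (-1) ^ q * of_nat ((p + q - 1) choose q) * coef z (x # Y)"
  proof -
    have "p - (p + q - 1 - q) = Suc 0" "p + q - 1 - q \<le> p" using p by auto
    thus ?thesis by (simp add: t_def)
  qed
  also have "t (q - 1) = (-1) ^ (q - 1) * of_nat ((p + q - 1) choose (q - 1)) * coef z (Y @ [x])"
  proof -
    have "p + q - 1 - (q - 1) = p" "q - (q - 1) = Suc 0" using q by auto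
    thus ?thesis by (simp add: t_def)
  qed
  also have "coef z (Y @ [x]) = (-1) ^ length Y * coef z (x # Y)"
    using coef_rev[of z "x # Y"] True assms(5) by simp
  also have "(-1 :: 'a) ^ (q - 1) = - ((-1) ^ q)" using q by (cases q) auto
  finally show ?thesis
    unfolding coef_replicate_framed[OF assms(1-4)] t_def[symmetric] by (simp add: algebra_simps)
next
  case False
  have "coef z (x # Y) = (0 :: 'a)"
    using coef_mset[of z "x # Y", where 'a = 'a] False by (metis length_Cons size_mset)
  moreover have "coef (replicate (p + q - 1) x @ z) (replicate p x @ Y @ replicate q x) = (0 :: 'a)"
  proof (rule ccontr)
    assume "\<not> ?thesis"
    from mset_eq_length[OF coef_mset[OF this]] False p q show False by simp
  qed
  ultimately show ?thesis by simp
qed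

text \<open>The first and the last letter differ, which rules out powers and palindromes
  alike.\<close>

lemma excluded_Cons_neq: "hd Y \<noteq> x \<Longrightarrow> Y \<noteq> [] \<Longrightarrow> last Y \<noteq> x \<Longrightarrow> \<not> excluded (x # Y)"
proof
  assume a: "hd Y \<noteq> x" "Y \<noteq> []" "last Y \<noteq> x" and "excluded (x # Y)"
  then consider n y where "x # Y = replicate n y" | "rev (x # Y) = x # Y"
    unfolding excluded_def by blast
  thus False
  proof cases
    case 1
    hence "set (x # Y) = set (replicate n y)" by simp
    hence "set (x # Y) \<subseteq> {y}" by (cases "n = 0") auto
    moreover have "hd Y \<in> set Y" using a(2) by simp
    ultimately have "hd Y = y" "x = y" by auto
    thus ?thesis using a(1) by simp
  next
    case 2
    hence "hd (rev (x # Y)) = x" by simp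
    thus ?thesis using a by (simp add: hd_append hd_rev)
  qed
qed

text \<open>The quotient of the two binomial coefficients is p / q.\<close>

lemma binomial_neq:
  assumes "p > 0" "q > 0" "p \<noteq> q"
  shows "(p + q - 1) choose q \<noteq> (p + q - 1) choose (q - 1)"
proof
  assume eq: "(p + q - 1) choose q = (p + q - 1) choose (q - 1)"
  obtain r where r: "q = Suc r" using assms by (cases q) auto
  have "Suc r * ((p + r) choose Suc r) = p * ((p + r) choose r)"
    using binomial_absorb_comp[of "p + r" r] binomial_absorption[of r "p + r"]
    by simp
  hence "Suc r * ((p + r) choose r) = p * ((p + r) choose r)" using eq r by simp
  moreover have "(p + r) choose r \<noteq> 0" by simp
  ultimately have "Suc r = p" using mult_right_cancel by blast
  thus False using r assms by simp
qed

text \<open>For odd \<open>n\<close> the two terms add up and cannot cancel in characteristic 0; for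
  even \<open>n\<close> they are subtracted and differ because \<open>p\<close> and \<open>q\<close>
  do.\<close>

lemma strip_factor_nonzero:
  assumes "p > 0" "q > 0" "even n \<Longrightarrow> p \<noteq> q"
  shows "of_nat ((p + q - 1) choose q) - (-1) ^ n * of_nat ((p + q - 1) choose (q - 1)) \<noteq>
    (0 :: 'a :: field_char_0)"
proof (cases "even n")
  case True
  thus ?thesis using assms binomial_neq[of p q] by simp
next
  case False
  have "(p + q - 1) choose (q - 1) > 0" by (rule zero_less_binomial) (use assms in simp)
  hence "of_nat (((p + q - 1) choose q) + ((p + q - 1) choose (q - 1))) \<noteq> (0 :: 'a)"
    unfolding of_nat_eq_0_iff by (metis add_is_0 less_numeral_extra(3))
  thus ?thesis using False by simp
qed

text \<open>Induction on the length. If the end letters differ, w = x v = u y, then bracketing with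
  an end letter causes no cancellation, so it suffices that \<open>v\<close> or \<open>u\<close> is
  not excluded. If they agree, \<open>w\<close> consists of a core \<open>Y\<close> between maximal
  runs of \<open>p\<close> and \<open>q\<close> letters \<open>x\<close>: strip all of these if
  \<open>Y\<close> is not excluded, and all but one otherwise. The factor arising in the second case
  vanishes only if \<open>p = q\<close> and \<open>Y\<close> has even length, that is, if
  \<open>w\<close> is an even palindrome.\<close>

lemma exists_coef_nonzero:
  assumes "\<not> excluded w"
  shows "\<exists>z. z \<noteq> [] \<and> coef z w \<noteq> (0 :: 'a :: field_char_0)"
  using assms
proof (induction w rule: length_induct)
  case (1 w)
  have wne: "w \<noteq> []" using 1(2) by (auto simp: excluded_def)
  have IH: "\<exists>z. z \<noteq> [] \<and> coef z v \<noteq> (0 :: 'a)" if "length v < length w" "\<not> excluded v" for v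
    using 1(1) that by blast
  show ?case
  proof (cases "tl w = []")
    case True
    then obtain x where "w = [x]" using wne by (cases w) auto
    thus ?thesis by (intro exI[of _ "[x]"]) (simp add: coef_def)
  next
    case tl: False
    show ?thesis
    proof (cases "hd w = last w")
      case False
      show ?thesis
      proof (cases "excluded (tl w) \<and> excluded (butlast w)")
        case True
        obtain x v where wx: "w = x # v" using wne by (cases w) auto
        obtain u y where wy: "w = u @ [y]" using wne by (cases w rule: rev_cases) auto
        have "hd w = x" "tl w = v" using wx by simp_all
        moreover have "last w = y" "butlast w = u" using wy by simp_all
        ultimately have xy: "x \<noteq> y" and ev: "excluded v" and eu: "excluded u"
          using False True by auto
        have vne: "v \<noteq> []" using wx tl by simp
        have "last w = last v" using wx vne by simp
        hence vy: "last v = y" "v \<noteq> []" using wy vne by auto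
        \<comment> \<open>If \<open>v\<close> were a power of \<open>y\<close>, then
          \<open>u\<close> would be one \<open>x\<close> followed by letters \<open>y\<close>, which
          is neither a power nor a palindrome. The same holds for \<open>u\<close> with the sides
          exchanged.\<close>
        have nv: "v \<noteq> replicate n c" if n2: "n \<ge> 2" for n c
        proof
          assume v: "v = replicate n c"
          with vy n2 have c: "c = y" by (auto simp: last_replicate)
          obtain k where k: "n = Suc (Suc k)" using le_Suc_ex[OF n2] by auto
          have "u @ [y] = (x # replicate (Suc k) y) @ [y]"
            using wx wy v c k by (simp add: replicate_append_same)
          hence u: "u = x # replicate (Suc k) y" by (simp only: append_same_eq)
          from eu consider m d where "u = replicate m d" | "rev u = u" unfolding excluded_def by blast
          thus False
          proof cases
            case 1
            have "x \<in> set u" "y \<in> set u" using u by simp_all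
            thus False using xy unfolding 1 in_set_replicate by blast
          next
            case 2
            have "hd u = x" "hd (rev u) = y" unfolding u by (simp_all add: hd_append)
            thus False using xy 2 by simp
          qed
        qed
        have nu: "u \<noteq> replicate n c" if n2: "n \<ge> 2" for n c
        proof
          assume u: "u = replicate n c"
          obtain k where k: "n = Suc (Suc k)" using le_Suc_ex[OF n2] by auto
          have v: "v = replicate (Suc k) c @ [y]" and c: "c = x" using wx wy u k by auto
          from ev consider m d where "v = replicate m d" | "rev v = v" unfolding excluded_def by blast
          thus False
          proof cases
            case 1
            have "x \<in> set v" "y \<in> set v" using v c by simp_all
            thus False using xy unfolding 1 in_set_replicate by blast
          next
            case 2
            have "hd v = x" "hd (rev v) = y" unfolding v using c by simp_all
            thus False using xy 2 by simp
          qed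
        qed
        have pv: "rev v = v \<and> even (length v)"
          using ev[unfolded excluded_def] by (elim disjE exE conjE) (use nv in simp_all)
        have pu: "rev u = u \<and> even (length u)"
          using eu[unfolded excluded_def] by (elim disjE exE conjE) (use nu in simp_all)
        \<comment> \<open>Even palindromes contain each letter evenly often. But \<open>w\<close>
          has one \<open>x\<close> more than \<open>v\<close> and as many as \<open>u\<close>, so
          the parities contradict each other.\<close>
        have "even (count (mset v) x)" and eu2: "even (count (mset u) x)"
          using pv pu by (simp_all add: even_count_palindrome)
        moreover have "count (mset w) x = Suc (count (mset v) x)" unfolding wx by simp
        ultimately have "odd (count (mset w) x)" by (simp only: even_Suc not_not simp_thms)
        moreover have "count (mset w) x = count (mset u) x" using xy unfolding wy by simp
        ultimately show ?thesis using eu2 by (simp only: simp_thms)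
      next
        case f: False
        show ?thesis
        proof (cases "excluded (tl w)")
          case False
          then obtain z where "z \<noteq> []" "coef z (tl w) \<noteq> (0 :: 'a)"
            using IH[of "tl w"] wne by auto
          thus ?thesis using \<open>hd w \<noteq> last w\<close> wne
            by (intro exI[of _ "hd w # z"]) (simp add: coef_Cons)
        next
          case True
          with f have "\<not> excluded (butlast w)" by blast
          then obtain z where "z \<noteq> []" "coef z (butlast w) \<noteq> (0 :: 'a)"
            using IH[of "butlast w"] wne by auto
          thus ?thesis using \<open>hd w \<noteq> last w\<close> wne
            by (intro exI[of _ "last w # z"]) (simp add: coef_Cons)
        qed
      qed
    next
      case same: True
      define x where "x = hd w"
      obtain y where y: "y \<in> set w" "y \<noteq> x"
      proof (rule ccontr)
        assume "\<not> thesis"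
        with that have "\<forall>y\<in>set w. y = x" by blast
        from replicate_length_same[OF this] have "w = replicate (length w) x" by (rule sym)
        moreover have "length w \<ge> 2" using wne tl by (cases w; cases "tl w") auto
        ultimately show False using 1(2) unfolding excluded_def by blast
      qed
      obtain p q Y where w: "w = replicate p x @ Y @ replicate q x"
        and Y: "Y \<noteq> []" "hd Y \<noteq> x" "last Y \<noteq> x"
        using run_decomposition[OF y] by blast
      have p: "p > 0" using w Y wne x_def by (cases p) auto
      have q: "q > 0" using w Y wne same x_def by (cases q) auto
      show ?thesis
      proof (cases "excluded Y")
        case False
        then obtain z where "z \<noteq> []" "coef z Y \<noteq> (0 :: 'a)"
          using IH[of Y] w p by auto
        thus ?thesis using coef_strip_all[of z Y x p q, where 'a = 'a] Y w
          by (intro exI[of _ "replicate (p + q) x @ z"]) simp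
      next
        case True
        have rY: "rev Y = Y" using True unfolding excluded_def by auto
        have "\<not> excluded (x # Y)" using excluded_Cons_neq Y by blast
        moreover have "length (x # Y) < length w" using w p q by simp
        ultimately obtain z where z: "z \<noteq> []" "coef z (x # Y) \<noteq> (0 :: 'a)" using IH by blast
        have "p \<noteq> q" if "even (length Y)"
        proof
          assume "p = q"
          hence "rev w = w \<and> even (length w)" using w rY that by simp
          thus False using 1(2) unfolding excluded_def by blast
        qed
        from strip_factor_nonzero[OF p q this, where 'a = 'a]
        have "coef (replicate (p + q - 1) x @ z) w \<noteq> (0 :: 'a)"
          unfolding w coef_strip_all_but_one[OF z(1) Y rY p q] using z(2)
          by (simp only: mult_eq_0_iff power_eq_0_iff neg_equal_0_iff_equal one_neq_zero simp_thms)
        thus ?thesis using z(1) by (intro exI[of _ "replicate (p + q - 1) x @ z"]) simp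
      qed
    qed
  qed
qed

text \<open>A non-zero entry of E at distance n + 1 from the diagonal passes over n + 1
  superdiagonal positions, exactly one of which crosses a block boundary. Reading that entry as one
  letter True deletes the \<open>p\<close> letters False before the crossing and the
  \<open>q\<close> after it.\<close>

definition shortened :: "bool list \<Rightarrow> nat \<Rightarrow> bool list set" where
  "shortened w n = {A @ True # B | A B p q.
     w = A @ replicate p False @ True # replicate q False @ B \<and> p + q = n}"

lemma shortened_rev:
  assumes "u \<in> shortened w n"
  shows "rev u \<in> shortened (rev w) n"
proof -
  from assms obtain A B p q where "u = A @ True # B" "p + q = n"
    and w: "w = A @ replicate p False @ True # replicate q False @ B"
    unfolding shortened_def by blast
  moreover have "rev w = rev B @ replicate q False @ True # replicate p False @ rev A"
    by (simp add: w)
  ultimately show ?thesis unfolding shortened_def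
    by (intro CollectI exI[of _ "rev B"] exI[of _ "rev A"] exI[of _ q] exI[of _ p]) simp
qed

section \<open>Outer runs of contracted words\<close>

lemma append_replicate_eq:
  assumes "A @ replicate p x = s @ y # t" "y \<noteq> x"
  obtains A' where "A = s @ y # A'" "t = A' @ replicate p x"
proof -
  from assms(1) consider us where "A = s @ us" "us @ replicate p x = y # t"
    | us where "A @ us = s" "replicate p x = us @ y # t"
    unfolding append_eq_append_conv2 by blast
  thus thesis
  proof cases
    case 1
    show ?thesis
    proof (cases us)
      case Nil
      with 1 have "y \<in> set (replicate p x)" by simp
      thus ?thesis using assms(2) by simp
    next
      case (Cons a us')
      with 1 that[of us'] show ?thesis by simp
    qed
  next
    case 2
    hence "y \<in> set (replicate p x)" by simp
    thus ?thesis using assms(2) by simp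
  qed
qed

lemma replicate_append_eq:
  assumes "replicate p x @ B = s @ y # t" "y \<noteq> x"
  obtains B' where "B = B' @ y # t" "s = replicate p x @ B'"
proof -
  have "rev B @ replicate p x = rev t @ y # rev s"
    using arg_cong[OF assms(1), of rev] by simp
  then obtain A' where "rev B = rev t @ y # A'" "rev s = A' @ replicate p x"
    using append_replicate_eq assms(2) by metis
  hence "B = rev A' @ y # t" "s = replicate p x @ rev A'"
    by (simp_all add: rev_swap)
  thus thesis using that by blast
qed

lemma replicate_eq_hd:
  assumes "replicate p x @ y # s = replicate q x @ z # t" "y \<noteq> x" "z \<noteq> x"
  shows "p = q" "s = t"
proof -
  have "p \<le> q" "q \<le> p"
    using replicate_prefix_le[OF assms(1)] replicate_prefix_le[OF assms(1)[symmetric]] assms by auto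
  thus "p = q" by simp
  with assms(1) show "s = t" by simp
qed

text \<open>Letters False between two consecutive letters True may be charged to either of them. A
  deletion at the last True of the left frame is thus a deletion before the first True of
  \<open>v\<close>, and the frame stays intact. If \<open>v\<close> has no True there is nothing to
  charge it to; then \<open>v\<close> just loses \<open>n\<close> letters.\<close>

lemma shortened_frame_True:
  assumes "K > 0" and v: "v \<noteq> []" "\<not> hd v" "\<not> last v" and n: "n > 0"
    and u: "u \<in> shortened (replicate K True @ v @ replicate K True) n"
  shows "\<exists>v'. u = replicate K True @ v' @ replicate K True \<and>
    (v' \<in> shortened v n \<or> True \<notin> set v \<and> v' = replicate (length v - n) False)"
proof -
  \<comment> \<open>General in \<open>u\<close> and \<open>v\<close>, so that deletions at the right
    frame follow from those at the left frame by reversal.\<close>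
  define P where "P u v \<longleftrightarrow> (\<exists>v'. u = replicate K True @ v' @ replicate K True \<and>
    (v' \<in> shortened v n \<or> True \<notin> set v \<and> v' = replicate (length v - n) False))" for u v
  have P_rev: "P u v" if "P (rev u) (rev v)" for u v
  proof -
    from that obtain v' where v': "rev u = replicate K True @ v' @ replicate K True"
      "v' \<in> shortened (rev v) n \<or> True \<notin> set v \<and> v' = replicate (length v - n) False"
      unfolding P_def by auto
    hence "u = replicate K True @ rev v' @ replicate K True" by (simp add: rev_swap)
    moreover have "rev v' \<in> shortened v n \<or> True \<notin> set v \<and> rev v' = replicate (length v - n) False"
      using v'(2) shortened_rev[of v' "rev v" n] by auto
    ultimately show ?thesis unfolding P_def by blast
  qed
  have first: "P (A @ True # B) v"
    if i: "i < K" "A @ replicate p False = replicate i True"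
      "replicate q False @ B = replicate (K - Suc i) True @ v @ replicate K True"
      and v: "v \<noteq> []" "\<not> hd v" and pq: "p + q = n" for A B p q i v
  proof -
    have p: "p = 0"
    proof (rule ccontr)
      assume "p \<noteq> 0"
      hence "False \<in> set (A @ replicate p False)" by simp
      thus False unfolding i(2) by simp
    qed
    hence A: "A = replicate i True" and q: "q = n" using i pq by auto
    \<comment> \<open>The chosen True is followed by \<open>q = n > 0\<close> letters False, so it
      is the last one of the left frame.\<close>
    have iK: "K = Suc i"
    proof (rule ccontr)
      assume "K \<noteq> Suc i"
      then obtain j where "K - Suc i = Suc j" using i(1) by (metis Suc_diff_Suc diff_Suc_Suc gr0_implies_Suc less_antisym zero_less_diff)
      moreover obtain m where "q = Suc m" using q n by (cases q) auto
      ultimately show False using i(3) by simp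
    qed
    have e: "replicate q False @ B = v @ replicate K True" using i(3) iK by simp
    show ?thesis
    proof (cases "True \<in> set v")
      case True
      then obtain v1 v2 where vs: "v = v1 @ True # v2" "True \<notin> set v1"
        using split_list_first by metis
      from e vs have "replicate q False @ B = v1 @ True # (v2 @ replicate K True)" by simp
      then obtain B' where B': "B = B' @ True # v2 @ replicate K True" "v1 = replicate q False @ B'"
        using replicate_append_eq by (metis (full_types))
      have "B' = replicate (length B') False"
        using vs(2) B'(2) by (metis (full_types) UnCI replicate_length_same set_append)
      \<comment> \<open>The deletion is now charged to the first True of \<open>v\<close>: all
        \<open>n\<close> letters before it, none after it.\<close>
      hence "v = B' @ replicate n False @ True # replicate 0 False @ v2"
        using vs B' q by (metis append.assoc append_Nil replicate_0 replicate_add add.commute)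
      hence "B' @ True # v2 \<in> shortened v n" unfolding shortened_def by force
      moreover have "A @ True # B = replicate K True @ (B' @ True # v2) @ replicate K True"
        using A iK B' by (simp add: replicate_append_same[symmetric])
      ultimately show ?thesis unfolding P_def by blast
    next
      case False
      hence vr: "v = replicate (length v) False" by (metis (full_types) replicate_length_same)
      have "replicate q False @ B = v @ True # replicate (K - 1) True" using e \<open>K > 0\<close>
        by (cases K) auto
      then obtain B' where B': "B = B' @ True # replicate (K - 1) True" "v = replicate q False @ B'"
        using replicate_append_eq by (metis (full_types))
      have "B' = replicate (length v - n) False"
        using False B' q by (metis (full_types) Un_iff add_diff_cancel_left' length_append length_replicate
          replicate_length_same set_append)
      moreover have "True # replicate (K - 1) True = replicate K True" using \<open>K > 0\<close> by (cases K) auto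
      ultimately have "A @ True # B = replicate K True @ replicate (length v - n) False @ replicate K True"
        using A iK B' by (simp add: replicate_append_same[symmetric])
      thus ?thesis using False unfolding P_def by blast
    qed
  qed
  from u obtain A B p q where uAB: "u = A @ True # B" and pq: "p + q = n"
    and w: "replicate K True @ v @ replicate K True = A @ replicate p False @ True # replicate q False @ B"
    unfolding shortened_def by blast
  let ?i = "length (A @ replicate p False)"
  have le: "take ?i (replicate K True @ v @ replicate K True) = A @ replicate p False"
    "drop (Suc ?i) (replicate K True @ v @ replicate K True) = replicate q False @ B"
    "(replicate K True @ v @ replicate K True) ! ?i = True" unfolding w by (simp_all add: nth_append)
  have len: "?i < K + length v + K" using arg_cong[OF w, of length] by simp
  consider "?i < K" | "K \<le> ?i" "?i < K + length v" | "K + length v \<le> ?i" by linarith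
  hence "P u v"
  proof cases
    case 1
    have "A @ replicate p False = replicate ?i True" using le(1) 1 by (simp add: min_def)
    moreover have "replicate q False @ B = replicate (K - Suc ?i) True @ v @ replicate K True"
      using le(2) 1 by simp
    ultimately show ?thesis using first[OF 1 _ _ v(1,2) pq] uAB by blast
  next
    case 2
    define v1 where "v1 = take (?i - K) v"
    define v2 where "v2 = drop (Suc ?i - K) v"
    have "v ! (?i - K)" using le(3) 2 by (simp add: nth_append)
    hence vs: "v = v1 @ True # v2" unfolding v1_def v2_def using 2
      by (metis (full_types) Suc_diff_le id_take_nth_drop less_diff_conv2 add.commute)
    obtain k where k: "K = Suc k" using \<open>K > 0\<close> by (cases K) auto
    have "A @ replicate p False = replicate K True @ v1" using le(1) 2 by (simp add: v1_def)
    also have "\<dots> = replicate k True @ True # v1" by (simp add: k replicate_app_Cons_same)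
    finally obtain A1 where A1: "A = replicate k True @ True # A1" "v1 = A1 @ replicate p False"
      using append_replicate_eq by (metis (full_types))
    have "replicate q False @ B = v2 @ replicate K True" using le(2) 2 by (simp add: v2_def)
    also have "\<dots> = v2 @ True # replicate k True" by (simp add: k)
    finally obtain B1 where B1: "B = B1 @ True # replicate k True" "v2 = replicate q False @ B1"
      using replicate_append_eq by (metis (full_types))
    have "A1 @ True # B1 \<in> shortened v n" unfolding shortened_def using vs A1 B1 pq by force
    moreover have "u = replicate K True @ (A1 @ True # B1) @ replicate K True"
      using uAB A1 B1 by (simp add: k replicate_app_Cons_same)
    ultimately show ?thesis unfolding P_def by blast
  next
    case 3
    define i where "i = length (replicate q False @ B)"
    have il: "?i + Suc i = K + length v + K" using arg_cong[OF w, of length] by (simp add: i_def)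
    hence iK: "i < K" using 3 by linarith
    have w': "replicate K True @ rev v @ replicate K True =
        rev B @ replicate q False @ True # replicate p False @ rev A"
      using arg_cong[OF w, of rev] by simp
    have "take i (replicate K True @ rev v @ replicate K True) = rev B @ replicate q False"
      unfolding w' by (simp add: i_def)
    hence 1: "rev B @ replicate q False = replicate i True" using iK by (simp add: min_def)
    have "drop (Suc i) (replicate K True @ rev v @ replicate K True) = replicate p False @ rev A"
      unfolding w' by (simp add: i_def)
    hence "replicate p False @ rev A = replicate (K - Suc i) True @ rev v @ replicate K True"
      using iK by simp
    hence "P (rev B @ True # rev A) (rev v)" using first[OF iK 1] v pq by (simp add: hd_rev)
    thus ?thesis using P_rev uAB by simp
  qed
  thus ?thesis unfolding P_def .
qed

text \<open>The frame has no True, so the chosen one lies in \<open>v\<close>. Only if it is the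
  first or the last letter of \<open>v\<close> can the deletion eat into the frame, which then keeps
  \<open>h < K\<close> letters on that side. The even count makes the first and the last True of
  \<open>v\<close> different letters, so at most one side is damaged.\<close>

lemma shortened_frame_False:
  assumes "K > 0" and v: "v \<noteq> []" "hd v" "last v" "even (count (mset v) True)"
    and u: "u \<in> shortened (replicate K False @ v @ replicate K False) n"
  obtains (mid) v' where "u = replicate K False @ v' @ replicate K False" "v' \<in> shortened v n"
      "v' \<noteq> []" "hd v'" "last v'"
    | (left) h q B where "h < K" "K - h + q = n" "v = True # replicate q False @ B @ [True]"
      "u = replicate h False @ True # B @ True # replicate K False"
    | (right) h q B where "h < K" "K - h + q = n" "rev v = True # replicate q False @ B @ [True]"
      "rev u = replicate h False @ True # B @ True # replicate K False"
proof -
  let ?w = "replicate K False @ v @ replicate K False"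
  from u obtain A B p q where uAB: "u = A @ True # B" and pq: "p + q = n"
    and w: "?w = A @ replicate p False @ True # replicate q False @ B"
    unfolding shortened_def by blast
  let ?i = "length (A @ replicate p False)"
  have le: "take ?i ?w = A @ replicate p False" "drop (Suc ?i) ?w = replicate q False @ B"
    "?w ! ?i = True" unfolding w by (simp_all add: nth_append)
  have len: "?i < K + length v + K" using arg_cong[OF w, of length] by simp
  have iK: "K \<le> ?i" using le(3) by (rule contrapos_pp) (simp add: nth_append)
  have iv: "?i < K + length v" using le(3) len iK by (auto simp: nth_append split: if_splits)
  define v1 where "v1 = take (?i - K) v"
  define v2 where "v2 = drop (Suc ?i - K) v"
  have "v ! (?i - K)" using le(3) iK iv by (simp add: nth_append)
  hence vs: "v = v1 @ True # v2" unfolding v1_def v2_def using iK iv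
    by (metis (full_types) Suc_diff_le id_take_nth_drop less_diff_conv2 add.commute)
  have A: "A @ replicate p False = replicate K False @ v1" using le(1) iK iv by (simp add: v1_def)
  have B: "replicate q False @ B = v2 @ replicate K False" using le(2) iK iv by (simp add: v2_def)
  have A0: "p \<le> K \<and> A = replicate (K - p) False" if "v1 = []"
  proof -
    have e: "A @ replicate p False = replicate K False" using A that by simp
    have "length A + p = K" using arg_cong[OF e, of length] by simp
    moreover have "A = take (length A) (replicate K False)" unfolding e[symmetric] by simp
    ultimately show ?thesis by (simp add: min_def split: if_splits) (metis add_diff_cancel_right')
  qed
  have B0: "q \<le> K \<and> B = replicate (K - q) False" if "v2 = []"
  proof -
    have e: "replicate q False @ B = replicate K False" using B that by simp
    have "q + length B = K" using arg_cong[OF e, of length] by simp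
    moreover have "B = drop q (replicate K False)" unfolding e[symmetric] by simp
    ultimately show ?thesis by simp
  qed
  have A1: "\<exists>A'. A = replicate K False @ True # A' \<and> v1 = True # A' @ replicate p False" if ne: "v1 \<noteq> []"
  proof -
    obtain t where t: "v1 = True # t" using ne v vs by (cases v1) auto
    with A have "A @ replicate p False = replicate K False @ True # t" by simp
    then obtain A' where "A = replicate K False @ True # A'" "t = A' @ replicate p False"
      using append_replicate_eq by (metis (full_types))
    thus ?thesis using t by blast
  qed
  have B1: "\<exists>B'. B = B' @ True # replicate K False \<and> v2 = replicate q False @ B' @ [True]" if ne: "v2 \<noteq> []"
  proof -
    obtain t where t: "v2 = t @ [True]" using ne v vs by (cases v2 rule: rev_cases) auto
    with B have "replicate q False @ B = t @ True # replicate K False" by simp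
    then obtain B' where "B = B' @ True # replicate K False" "t = replicate q False @ B'"
      using replicate_append_eq by (metis (full_types))
    thus ?thesis using t by auto
  qed
  show thesis
  proof (cases "v1 = []")
    case v1: True
    have "v2 \<noteq> []" using v(4) vs v1 by auto
    then obtain B' where B': "B = B' @ True # replicate K False" "v2 = replicate q False @ B' @ [True]"
      using B1 by blast
    show thesis
    proof (cases "p = 0")
      case True
      have "True # B' @ [True] \<in> shortened v n" unfolding shortened_def
        using vs v1 B' True pq by (intro CollectI exI[of _ "[]"] exI[of _ "B' @ [True]"] exI[of _ 0] exI[of _ n]) simp
      moreover have "u = replicate K False @ (True # B' @ [True]) @ replicate K False"
        using uAB A0[OF v1] True B' by simp
      ultimately show thesis by (intro mid) auto
    next
      case False
      show thesis
        by (rule left[of "K - p" q B']) (use A0[OF v1] False \<open>K > 0\<close> pq vs v1 B' uAB in auto)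
    qed
  next
    case v1: False
    then obtain A' where A': "A = replicate K False @ True # A'" "v1 = True # A' @ replicate p False"
      using A1 by blast
    show thesis
    proof (cases "v2 = []")
      case False
      then obtain B' where B': "B = B' @ True # replicate K False" "v2 = replicate q False @ B' @ [True]"
        using B1 by blast
      have "True # A' @ True # B' @ [True] \<in> shortened v n" unfolding shortened_def
        using vs A' B' pq
        by (intro CollectI exI[of _ "True # A'"] exI[of _ "B' @ [True]"] exI[of _ p] exI[of _ q]) auto
      moreover have "u = replicate K False @ (True # A' @ True # B' @ [True]) @ replicate K False"
        using uAB A' B' by simp
      ultimately show thesis by (intro mid) auto
    next
      case v2: True
      show thesis
      proof (cases "q = 0")
        case True
        have "True # A' @ [True] \<in> shortened v n" unfolding shortened_def
          using vs v2 A' True pq by (intro CollectI exI[of _ "True # A'"] exI[of _ "[]"] exI[of _ n] exI[of _ 0]) simp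
        moreover have "u = replicate K False @ (True # A' @ [True]) @ replicate K False"
          using uAB B0[OF v2] True A' by simp
        ultimately show thesis by (intro mid) auto
      next
        case False
        show thesis
          by (rule right[of "K - q" p "rev A'"]) (use B0[OF v2] False \<open>K > 0\<close> pq vs v2 A' uAB in auto)
      qed
    qed
  qed
qed

text \<open>\<open>f\<close> and the coefficients change by the same sign under reversal, so
  \<open>e\<close> and \<open>rev e\<close> contribute equally to the evaluation and cannot cancel
  in characteristic 0.\<close>

lemma coef_isolated:
  fixes f :: "bool list \<Rightarrow> 'a :: field_char_0"
  assumes anti: "\<And>u. f (rev u) = - ((-1) ^ length u) * f u"
    and ev: "bracket_eval z f = 0" and e: "coef z e \<noteq> (0 :: 'a)"
    and others: "\<And>u. f u \<noteq> 0 \<Longrightarrow> coef z u \<noteq> (0 :: 'a) \<Longrightarrow> u = e \<or> u = rev e"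
  shows "f e = 0"
proof -
  have me: "mset e = mset z" by (rule coef_mset[OF e])
  have fin: "finite {u. mset u = mset z}"
    by (rule finite_subset[OF _ finite_lists_length_eq[of UNIV "length z"]])
       (auto dest: mset_eq_length)
  have "bracket_eval z f = (\<Sum>u\<in>{e, rev e}. f u * coef z u)"
    unfolding bracket_eval_conv_coef
    by (rule sum.mono_neutral_right[OF fin]) (use me others in auto)
  hence s: "(\<Sum>u\<in>{e, rev e}. f u * coef z u) = 0" using ev by simp
  have len: "length z = length e" using mset_eq_length[OF me] by simp
  have r: "f (rev e) * coef z (rev e) = f e * coef z e"
    unfolding anti coef_rev len by (simp add: power_add[symmetric])
  show ?thesis
  proof (cases "rev e = e")
    case True
    thus ?thesis using s e by simp
  next
    case False
    hence "(\<Sum>u\<in>{e, rev e}. f u * coef z u) = 2 * (f e * coef z e)" using r by simp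
    thus ?thesis using s e by simp
  qed
qed

text \<open>Bracket with 2K further letters \<open>x\<close>: of all ways to split them between the
  two ends only \<open>j = K\<close> fits the support, and its binomial coefficient is non-zero.
  Hence the relations descend from framed words to their cores.\<close>

lemma bracket_eval_strip:
  fixes f :: "bool list \<Rightarrow> 'a :: field_char_0"
  assumes ev: "\<And>z. bracket_eval z f = 0"
    and supp: "\<And>u. f u \<noteq> 0 \<Longrightarrow> \<exists>v. u = replicate K x @ v @ replicate K x \<and>
      v \<noteq> [] \<and> hd v \<noteq> x \<and> last v \<noteq> x"
  shows "bracket_eval z (\<lambda>v. f (replicate K x @ v @ replicate K x)) = 0"
proof (cases "z = []")
  case False
  let ?t = "\<lambda>j. (-1) ^ j * of_nat (K + K choose j) *
       bracket_eval z (\<lambda>u. f (replicate (K + K - j) x @ u @ replicate j x))"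
  have "?t j = 0" if j: "j \<le> K + K" "j \<noteq> K" for j
  proof -
    have "f (replicate (K + K - j) x @ u @ replicate j x) = 0" for u
    proof (rule ccontr)
      assume "f (replicate (K + K - j) x @ u @ replicate j x) \<noteq> 0"
      from supp[OF this] obtain v where v: "replicate (K + K - j) x @ u @ replicate j x =
          replicate K x @ v @ replicate K x" "v \<noteq> []" "hd v \<noteq> x" "last v \<noteq> x" by blast
      from frame_le(1,2)[OF v] j show False by simp
    qed
    thus ?thesis by simp
  qed
  hence "(\<Sum>j\<le>K + K. ?t j) = (\<Sum>j\<in>{K}. ?t j)" by (intro sum.mono_neutral_right) auto
  also have "(\<Sum>j\<le>K + K. ?t j) = 0"
    unfolding bracket_eval_replicate[OF False, symmetric] by (rule ev)
  finally have "of_nat (K + K choose K) * bracket_eval z (\<lambda>v. f (replicate K x @ v @ replicate K x)) = 0"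
    by simp
  moreover have "(of_nat (K + K choose K) :: 'a) \<noteq> 0" by simp
  ultimately show ?thesis by (simp only: mult_eq_0_iff simp_thms)
qed simp

section \<open>Elimination of contracted words with an altered frame\<close>

lemma not_excluded_odd:
  assumes "odd (count (mset w) True)" "False \<in> set w"
  shows "\<not> excluded w"
proof
  assume "excluded w"
  then consider n x where "w = replicate n x" | "rev w = w" "even (length w)"
    unfolding excluded_def by blast
  thus False
  proof cases
    case 1
    have "True \<in> set w" using assms(1) by (metis count_mset_0_iff even_zero)
    thus False using assms(2) unfolding 1 in_set_replicate by blast
  next
    case 2
    thus False using even_count_palindrome[of w True] assms(1) by simp
  qed
qed

text \<open>The point is the bound \<open>L > 2 * K\<close>: when the leading letters True are split
  between the two ends of a word, one end receives more than \<open>K\<close>. The stripping is that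
  of \<open>exists_coef_nonzero\<close>; if one True has to stay behind, \<open>s > 0\<close> makes
  up for it.\<close>

lemma coef_start_True:
  assumes K: "K > 0" and B: "odd (count (mset B) True)" "\<not> last B" "B \<noteq> []"
  obtains L z where "L > 2 * K" "z \<noteq> []"
    "coef (replicate L True @ z) (replicate (Suc K) True @ B @ replicate K True) \<noteq> (0 :: 'a :: field_char_0)"
proof -
  have F: "False \<in> set B" using last_in_set[OF B(3)] B(2) by simp
  have "False \<noteq> True" by simp
  then obtain s t Y where BY: "B = replicate s True @ Y @ replicate t True"
    and Y: "Y \<noteq> []" "hd Y \<noteq> True" "last Y \<noteq> True" by (rule run_decomposition[OF F])
  have "t = 0" using B(2) BY by (cases t) (auto simp: replicate_append_same[symmetric])
  hence BY: "B = replicate s True @ Y" using BY by simp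
  have e: "replicate (Suc K) True @ B @ replicate K True =
      replicate (Suc K + s) True @ Y @ replicate K True"
    by (simp add: BY replicate_add)
  show thesis
  proof (cases "excluded Y")
    case False
    then obtain z where z: "z \<noteq> []" "coef z Y \<noteq> (0 :: 'a)" using exists_coef_nonzero by blast
    have "coef (replicate (Suc K + s + K) True @ z)
        (replicate (Suc K) True @ B @ replicate K True) \<noteq> (0 :: 'a)"
      unfolding e coef_strip_all[OF z(1) Y] using z(2) by simp
    with z(1) show thesis by (intro that[of "Suc K + s + K" z]) auto
  next
    case True
    have "s \<noteq> 0" using True BY not_excluded_odd[OF B(1) F] by (cases s) auto
    have rY: "rev Y = Y" using True unfolding excluded_def by auto
    have "\<not> excluded (True # Y)" using excluded_Cons_neq Y by blast
    then obtain z where z: "z \<noteq> []" "coef z (True # Y) \<noteq> (0 :: 'a)" using exists_coef_nonzero by blast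
    have pos: "Suc K + s > 0" "Suc K + s \<noteq> K" by auto
    have "coef (replicate (Suc K + s + K - 1) True @ z)
        (replicate (Suc K) True @ B @ replicate K True) \<noteq> (0 :: 'a)"
      unfolding e coef_strip_all_but_one[OF z(1) Y rY pos(1) K]
      using z(2) strip_factor_nonzero[OF pos(1) K, of "length Y", where 'a = 'a] pos(2)
      by (simp only: mult_eq_0_iff power_eq_0_iff neg_equal_0_iff_equal one_neq_zero simp_thms)
    with z(1) \<open>s \<noteq> 0\<close> show thesis by (intro that[of "Suc K + s + K - 1" z]) auto
  qed
qed

lemma palindrome_frame:
  assumes w: "w = replicate K x @ v @ replicate K' x" and "rev w = w"
    and v: "v \<noteq> []" "hd v \<noteq> x" "last v \<noteq> x"
  shows "K' = K" "rev v = v"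
proof -
  have 1: "replicate K' x @ rev v @ replicate K x = replicate K x @ v @ replicate K' x"
    using arg_cong[OF w, of rev] assms(2) w by simp
  from frame_le[OF 1 v] show "K' = K" "rev v = v" by auto
qed

text \<open>A word that begins with False gains a leading True only by losing its whole initial run;
  this fixes \<open>p\<close>, and \<open>q\<close> with it.\<close>

lemma shortened_hd_True:
  assumes "u \<in> shortened v n" "hd u" "v \<noteq> []" "\<not> hd v"
  obtains p q B where "p + q = n" "u = True # B"
    "v = replicate p False @ True # replicate q False @ B"
proof -
  from assms(1) obtain A B p q where u: "u = A @ True # B" "p + q = n"
    "v = A @ replicate p False @ True # replicate q False @ B" unfolding shortened_def by blast
  have "A = []"
  proof (rule ccontr)
    assume "A \<noteq> []"
    thus False using u assms by simp
  qed
  thus thesis using that u by simp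
qed

text \<open>A core with a leading True would put more than \<open>K\<close> letters True in front.
  There is only one such core, because the initial run of \<open>v\<close> determines the deletion.
  A bracket with more than \<open>2 * K\<close> leading letters True meets no other word of the
  support, up to reversal, so \<open>coef_isolated\<close> applies.\<close>

lemma supported_frame_True:
  fixes f :: "bool list \<Rightarrow> 'a :: field_char_0"
  assumes K: "K > 0" and v: "v \<noteq> []" "\<not> hd v" "\<not> last v" "rev v = v"
      "even (count (mset v) True)" "True \<in> set v"
    and n: "n > 0"
    and anti: "\<And>u. f (rev u) = - ((-1) ^ length u) * f u"
    and supp: "\<And>u. f u \<noteq> 0 \<Longrightarrow> u \<in> shortened (replicate K True @ v @ replicate K True) n"
    and ev: "\<And>z. bracket_eval z f = 0"
    and u: "f u \<noteq> 0"
  shows "\<exists>v'. u = replicate K True @ v' @ replicate K True \<and> v' \<in> shortened v n \<and>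
    v' \<noteq> [] \<and> \<not> hd v' \<and> \<not> last v'"
proof -
  let ?c = "replicate K True"
  have frame: "\<exists>v'. u = ?c @ v' @ ?c \<and> v' \<in> shortened v n" if "f u \<noteq> 0" for u
    using shortened_frame_True[OF K v(1-3) n supp[OF that]] v(6) by blast
  have rev_short: "rev v' \<in> shortened v n" if "v' \<in> shortened v n" for v'
    using shortened_rev[OF that] v(4) by simp
  have ne: "v' \<noteq> []" if "v' \<in> shortened v n" for v'
    using that unfolding shortened_def by auto
  have kill: "f (?c @ v' @ ?c) = 0" if v': "v' \<in> shortened v n" "hd v'" for v'
  proof -
    obtain p q B where pq: "p + q = n" and B: "v' = True # B"
      "v = replicate p False @ True # replicate q False @ B"
      by (rule shortened_hd_True[OF v' v(1,2)])
    have odd: "odd (count (mset B) True)" using v(5) unfolding B(2) by simp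
    hence Bne: "B \<noteq> []" by auto
    hence lB: "\<not> last B" using v(3) unfolding B(2) by simp
    have e: "?c @ v' @ ?c = replicate (Suc K) True @ B @ ?c"
      by (simp add: B(1) replicate_app_Cons_same)
    obtain L z where L: "L > 2 * K" and z: "z \<noteq> []"
      "coef (replicate L True @ z) (?c @ v' @ ?c) \<noteq> (0 :: 'a)"
      unfolding e by (rule coef_start_True[OF K odd lB Bne])
    have uniq: "v'' = v'" if v'': "v'' \<in> shortened v n" "hd v''" for v''
    proof -
      obtain p' q' B' where pq': "p' + q' = n" and B': "v'' = True # B'"
        "v = replicate p' False @ True # replicate q' False @ B'"
        by (rule shortened_hd_True[OF v'' v(1,2)])
      have eq: "replicate p False @ True # replicate q False @ B =
          replicate p' False @ True # replicate q' False @ B'" using B(2) B'(2) by simp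
      have "p = p'" "replicate q False @ B = replicate q' False @ B'"
        using replicate_eq_hd[OF eq] by simp_all
      with pq pq' have "B = B'" by auto
      thus ?thesis using B(1) B'(1) by simp
    qed
    show ?thesis
    proof (rule coef_isolated[OF anti ev z(2)])
      fix u assume fu: "f u \<noteq> 0" and cu: "coef (replicate L True @ z) u \<noteq> (0 :: 'a)"
      obtain v'' where u: "u = ?c @ v'' @ ?c" and s: "v'' \<in> shortened v n" using frame[OF fu] by blast
      obtain j u' where j: "j \<le> L" "u = replicate (L - j) True @ u' @ replicate j True"
        by (rule coef_replicate_dest[OF z(1) cu])
      show "u = ?c @ v' @ ?c \<or> u = rev (?c @ v' @ ?c)"
      proof (cases "hd v''")
        case True
        thus ?thesis using uniq[OF s] u by simp
      next
        case False
        have "replicate (L - j) True @ u' @ replicate j True = ?c @ v'' @ ?c" using j(2) u by simp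
        from replicate_prefix_le[OF this] False ne[OF s] have "L - j \<le> K" by simp
        hence jK: "\<not> j \<le> K" using L j(1) by linarith
        have "replicate j True @ rev u' @ replicate (L - j) True = rev u" unfolding j(2) by simp
        also have "rev u = ?c @ rev v'' @ ?c" unfolding u by simp
        finally have eq: "replicate j True @ rev u' @ replicate (L - j) True = ?c @ rev v'' @ ?c" .
        have "hd (rev v'')"
        proof (rule ccontr)
          assume "\<not> hd (rev v'')"
          with replicate_prefix_le[OF eq] ne[OF s] jK show False by simp
        qed
        hence "rev v'' = v'" using uniq rev_short[OF s] by blast
        hence "rev u = ?c @ v' @ ?c" unfolding u by simp
        thus ?thesis by (simp add: rev_swap)
      qed
    qed
  qed
  obtain v' where v': "u = ?c @ v' @ ?c" "v' \<in> shortened v n" using frame[OF u] by blast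
  have "\<not> hd v'" using kill v' u by blast
  moreover have "\<not> last v'"
  proof
    assume "last v'"
    hence "hd (rev v')" by (simp add: hd_rev)
    hence "f (?c @ rev v' @ ?c) = 0" using kill rev_short v'(2) by blast
    moreover have "?c @ rev v' @ ?c = rev u" unfolding v'(1) by simp
    ultimately show False using anti[of u] u by simp
  qed
  ultimately show ?thesis using v' ne by blast
qed

text \<open>Words with a damaged frame, having \<open>h < K\<close> letters False at one end, are
  eliminated in increasing order of \<open>h\<close>. A bracket starting with \<open>h\<close>
  letters False and then True only meets words with at most \<open>h\<close> letters False at one
  end, and up to reversal just one word of the support has exactly \<open>h\<close>.\<close>

lemma supported_frame_False:
  fixes f :: "bool list \<Rightarrow> 'a :: field_char_0"
  assumes K: "K > 0" and v: "v \<noteq> []" "hd v" "last v" "rev v = v" "even (count (mset v) True)"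
    and anti: "\<And>u. f (rev u) = - ((-1) ^ length u) * f u"
    and supp: "\<And>u. f u \<noteq> 0 \<Longrightarrow> u \<in> shortened (replicate K False @ v @ replicate K False) n"
    and ev: "\<And>z. bracket_eval z f = 0"
    and u: "f u \<noteq> 0"
  shows "\<exists>v'. u = replicate K False @ v' @ replicate K False \<and> v' \<in> shortened v n \<and>
    v' \<noteq> [] \<and> hd v' \<and> last v'"
proof -
  let ?a = "replicate K False"
  have f_rev: "f (rev u) \<noteq> 0" if "f u \<noteq> 0" for u using that anti[of u] by simp
  have left_form: "\<exists>q B. K - h + q = n \<and> v = True # replicate q False @ B @ [True] \<and> Y = B @ True # ?a"
    if h: "h < K" and fe: "f (replicate h False @ True # Y) \<noteq> 0" for h Y
    using supp[OF fe]
  proof (cases rule: shortened_frame_False[OF K v(1-3,5), consumes 1, case_names mid left right])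
    case (mid v')
    then obtain t where "v' = True # t" by (cases v') auto
    with mid(1) have "replicate h False @ True # Y = replicate K False @ True # (t @ ?a)" by simp
    from replicate_eq_hd(1)[OF this] h show ?thesis by simp
  next
    case (left h' q B)
    from replicate_eq_hd[OF left(4)] have "h = h'" "Y = B @ True # ?a" by simp_all
    thus ?thesis using left by blast
  next
    case (right h' q B)
    have "replicate h False @ True # Y = rev (rev (replicate h False @ True # Y))" by simp
    also have "\<dots> = replicate K False @ True # rev B @ True # replicate h' False"
      unfolding right(4) by simp
    finally have "replicate h False @ True # Y = replicate K False @ True # rev B @ True # replicate h' False" .
    from replicate_eq_hd(1)[OF this] h show ?thesis by simp
  qed
  have kill: "f (replicate h False @ True # Y) = 0" if "h < K" for h Y
    using that
  proof (induction h arbitrary: Y rule: less_induct)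
    case (less h)
    let ?e = "replicate h False @ True # Y"
    show ?case
    proof (rule ccontr)
      assume fe: "f ?e \<noteq> 0"
      obtain q B where q: "K - h + q = n" and vB: "v = True # replicate q False @ B @ [True]"
        and Y: "Y = B @ True # ?a" using left_form[OF less.prems fe] by blast
      have "odd (count (mset Y) True)" using v(5) unfolding vB Y by simp
      moreover have "False \<in> set Y" unfolding Y using K by simp
      ultimately have "\<not> excluded Y" by (rule not_excluded_odd)
      then obtain zY where zY: "zY \<noteq> []" "coef zY Y \<noteq> (0 :: 'a)" using exists_coef_nonzero by blast
      let ?z = "replicate h False @ True # zY"
      let ?Y = "True # B @ [True]"
      have e: "?e = replicate h False @ ?Y @ ?a" unfolding Y by simp
      \<comment> \<open>Here \<open>j\<close> counts the letters False taken off the right end. For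
        \<open>j > 0\<close> the remaining word begins and ends with False and cannot come from a
        bracket with outermost letter True; for \<open>j = 0\<close> only its leading True can be
        removed, which leaves \<open>Y\<close>. The framing lemma produces \<open>j\<close> in the
        form \<open>h - (h - j)\<close>.\<close>
      have "coef ?z ?e = (\<Sum>j\<le>h. if h - (h - j) = 0 then coef zY Y else (0 :: 'a))"
        unfolding e
      proof (subst coef_replicate_framed, goal_cases)
        case 5
        show ?case
        proof (rule sum.cong)
          fix j assume "j \<in> {..h}"
          hence j: "j \<le> h" by simp
          hence jK: "j < K" using less.prems by simp
          have hj: "h - (h - j) = j" using j by simp
          have "last (replicate j False @ ?Y @ replicate (K - j) False) = False"
            using jK by simp
          moreover have "hd (replicate j False @ ?Y @ replicate (K - j) False) = (j = 0)"
            by (cases j) auto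
          ultimately have "coef (True # zY) (replicate j False @ ?Y @ replicate (K - j) False) =
             (if j = 0 then coef zY Y else (0 :: 'a))"
            unfolding coef_Cons[OF zY(1)] Y by auto
          thus "(if h - j \<le> h \<and> j \<le> K then (-1) ^ j * of_nat (h choose j) *
              coef (True # zY) (replicate (h - (h - j)) False @ ?Y @ replicate (K - j) False) else 0) =
              (if h - (h - j) = 0 then coef zY Y else (0 :: 'a))"
            unfolding hj using jK by auto
        qed simp
      qed simp_all
      also have "\<dots> = (\<Sum>j\<le>h. if j = 0 then coef zY Y else (0 :: 'a))"
        by (rule sum.cong) auto
      also have "\<dots> = coef zY Y" by (simp add: sum.delta)
      finally have cz: "coef ?z ?e \<noteq> (0 :: 'a)" using zY(2) by simp
      have "f ?e = 0"
      proof (rule coef_isolated[OF anti ev cz])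
        fix u assume fu: "f u \<noteq> 0" and cu: "coef ?z u \<noteq> (0 :: 'a)"
        have "True # zY \<noteq> []" by simp
        from this cu obtain j u' where j: "j \<le> h" "u = replicate (h - j) False @ u' @ replicate j False"
          and cu': "coef (True # zY) u' \<noteq> (0 :: 'a)" by (rule coef_replicate_dest)
        have u': "u' \<noteq> []" "hd u' \<or> last u'"
          using cu' unfolding coef_Cons[OF zY(1)] by (auto split: if_splits)
        \<comment> \<open>One end of \<open>u\<close> has at most \<open>h\<close> letters False
          before its first True. The induction hypothesis rules out fewer than \<open>h\<close>, and
          \<open>left_form\<close> determines the word with exactly \<open>h\<close>.\<close>
        show "u = ?e \<or> u = rev ?e"
        proof (cases "hd u'")
          case True
          define t where "t = tl u' @ replicate j False"
          have u: "u = replicate (h - j) False @ True # t"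
            using j(2) u'(1) True by (cases u') (auto simp: t_def)
          have "\<not> h - j < h"
            using less.IH[of "h - j" t] less.prems fu u by fastforce
          hence hj: "h - j = h" by simp
          have "f (replicate h False @ True # t) \<noteq> 0" using fu u hj by simp
          from left_form[OF less.prems this] obtain q' B' where "K - h + q' = n"
            "v = True # replicate q' False @ B' @ [True]" "t = B' @ True # ?a" by blast
          hence "t = Y" using q vB Y by simp
          thus ?thesis using u hj by simp
        next
          case False
          hence l: "last u'" using u'(2) by simp
          define t where "t = tl (rev u') @ replicate (h - j) False"
          have "rev u' = True # tl (rev u')" using l u'(1) by (cases u' rule: rev_cases) auto
          hence ru: "rev u = replicate j False @ True # t" unfolding j(2) t_def by simp
          have fru: "f (rev u) \<noteq> 0" using f_rev[OF fu] .
          have "\<not> j < h" using less.IH[of j t] less.prems fru ru by fastforce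
          hence hj: "j = h" using j(1) by simp
          have "f (replicate h False @ True # t) \<noteq> 0" using fru ru hj by simp
          from left_form[OF less.prems this] obtain q' B' where "K - h + q' = n"
            "v = True # replicate q' False @ B' @ [True]" "t = B' @ True # ?a" by blast
          hence "t = Y" using q vB Y by simp
          hence "rev u = ?e" using ru hj by simp
          thus ?thesis by (simp add: rev_swap)
        qed
      qed
      with fe show False by simp
    qed
  qed
  show ?thesis
    using supp[OF u]
  proof (cases rule: shortened_frame_False[OF K v(1-3,5), consumes 1, case_names mid left right])
    case (mid v')
    thus ?thesis by blast
  next
    case (left h q B)
    thus ?thesis using kill u by simp
  next
    case (right h q B)
    thus ?thesis using kill[of h "B @ True # ?a"] f_rev[OF u] by simp
  qed
qed

text \<open>The two outer runs of a palindrome have equal length. The support of \<open>f\<close>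
  respects them, so \<open>f\<close> descends to the core \<open>v\<close> with all its properties;
  the number of letters True stays even because runs are removed in pairs.\<close>

lemma shortened_palindrome_zero:
  fixes f :: "bool list \<Rightarrow> 'a :: field_char_0"
  assumes "rev w = w" and "even (count (mset w) True)" and n: "n > 0"
    and "\<And>u. f (rev u) = - ((-1) ^ length u) * f u"
    and "\<And>u. f u \<noteq> 0 \<Longrightarrow> u \<in> shortened w n"
    and "\<And>z. bracket_eval z f = 0"
  shows "f u = 0"
  using assms(1,2,4-6)
proof (induction w arbitrary: f u rule: measure_induct_rule[of length])
  case (less w)
  note anti = less.prems(3) and supp = less.prems(4) and ev = less.prems(5)
  show ?case
  proof (rule ccontr)
    assume fu: "f u \<noteq> 0"
    obtain A B p q where w0: "w = A @ replicate p False @ True # replicate q False @ B" "p + q = n"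
      using supp[OF fu] unfolding shortened_def by blast
    have mem: "True \<in> set w" "False \<in> set w" using w0 n by auto
    define x where "x = hd w"
    have mem': "(\<not> x) \<in> set w" using mem by (cases x) simp_all
    have "(\<not> x) \<noteq> x" by simp
    then obtain K K' v where w: "w = replicate K x @ v @ replicate K' x"
      and v: "v \<noteq> []" "hd v \<noteq> x" "last v \<noteq> x" by (rule run_decomposition[OF mem'])
    have KK: "K' = K" and rv: "rev v = v" using palindrome_frame[OF w less.prems(1) v] by auto
    have wK: "w = replicate K x @ v @ replicate K x" using w KK by simp
    have K: "K > 0"
    proof (rule ccontr)
      assume "\<not> K > 0"
      hence "w = v" using wK by simp
      thus False using v(2) x_def by simp
    qed
    let ?g = "\<lambda>v. f (replicate K x @ v @ replicate K x)"
    have cv: "even (count (mset v) True)" using less.prems(2) unfolding wK by (cases x) auto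
    have IH: False if frame: "\<And>u. f u \<noteq> 0 \<Longrightarrow> \<exists>v'. u = replicate K x @ v' @ replicate K x \<and>
        v' \<in> shortened v n \<and> v' \<noteq> [] \<and> hd v' \<noteq> x \<and> last v' \<noteq> x"
    proof -
      have "?g v' = 0" for v'
      proof (rule less.IH[of v ?g v'])
        show "length v < length w" using wK K by simp
        show "rev v = v" "even (count (mset v) True)" by fact+
        show "?g (rev y) = - ((-1) ^ length y) * ?g y" for y
          using anti[of "replicate K x @ y @ replicate K x"] by (simp add: power_add)
        show "y \<in> shortened v n" if "?g y \<noteq> 0" for y using frame[OF that] by auto
        show "bracket_eval z ?g = 0" for z
          by (rule bracket_eval_strip[OF ev]) (use frame in blast)
      qed
      thus False using frame[OF fu] fu by auto
    qed
    show False
    proof (cases x)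
      case False
      show False
      proof (rule IH)
        fix u assume "f u \<noteq> 0"
        from supported_frame_False[of K v f n, OF K _ _ _ rv cv anti _ ev this] v supp wK False
        show "\<exists>v'. u = replicate K x @ v' @ replicate K x \<and>
          v' \<in> shortened v n \<and> v' \<noteq> [] \<and> hd v' \<noteq> x \<and> last v' \<noteq> x" by simp
      qed
    next
      case x: True
      show False
      proof (cases "True \<in> set v")
        case True
        show False
        proof (rule IH)
          fix u assume "f u \<noteq> 0"
          from supported_frame_True[of K v n f, OF K _ _ _ rv cv True n anti _ ev this] v supp wK x
          show "\<exists>v'. u = replicate K x @ v' @ replicate K x \<and>
            v' \<in> shortened v n \<and> v' \<noteq> [] \<and> hd v' \<noteq> x \<and> last v' \<noteq> x" by simp
        qed
      next
        case False
        \<comment> \<open>The induction ends here: the core is a run of letters False and only one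
          contracted word is left. It is a palindrome, so the symmetry of \<open>f\<close> forces
          its length to be odd, and then it is not excluded.\<close>
        define e where "e = replicate K True @ replicate (length v - n) False @ replicate K True"
        have only: "u = e" if "f u \<noteq> 0" for u
        proof -
          have "\<exists>v'. u = replicate K True @ v' @ replicate K True \<and>
              (v' \<in> shortened v n \<or> True \<notin> set v \<and> v' = replicate (length v - n) False)"
            by (rule shortened_frame_True) (use K v x n supp[OF that] wK in simp_all)
          moreover have "v' \<notin> shortened v n" for v' using False unfolding shortened_def by auto
          ultimately show ?thesis unfolding e_def by blast
        qed
        have fe: "f e \<noteq> 0" using only[OF fu] fu by simp
        have "rev e = e" by (simp add: e_def)
        hence odd: "odd (length e)" using anti[of e] fe by (cases "even (length e)") auto
        hence "length v - n > 0" by (auto simp: e_def intro: ccontr)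
        hence me: "False \<in> set e" "True \<in> set e" using K by (auto simp: e_def)
        have "\<not> excluded e"
        proof
          assume "excluded e"
          then obtain m y where ey: "e = replicate m y" using odd unfolding excluded_def by blast
          show False using me unfolding ey in_set_replicate by blast
        qed
        then obtain z where "coef z e \<noteq> (0 :: 'a)" using exists_coef_nonzero by blast
        moreover have "bracket_eval z f = f e * coef z e" by (rule bracket_eval_single) (rule only)
        ultimately show False using ev[of z] fe by simp
      qed
    qed
  qed
qed

subsection \<open>Words in matrices and the lower central series\<close>

lemma subspace_gl_iff:
  "VectorSpace.subspace class_ring L (gl TYPE('a :: field) d) \<longleftrightarrow>
    L \<subseteq> carrier_mat d d \<and> 0\<^sub>m d d \<in> L \<and> (\<forall>A\<in>L. \<forall>B\<in>L. A + B \<in> L) \<and> (\<forall>c. \<forall>A\<in>L. c \<cdot>\<^sub>m A \<in> L)"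
proof -
  interpret vectorspace class_ring "gl TYPE('a) d" by (rule vectorspace_module_mat)
  show ?thesis
    unfolding VectorSpace.subspace_def submodule_def
    using vectorspace_axioms module_axioms by (auto simp: module_mat_simps class_ring_simps)
qed

abbreviation mat_span :: "nat \<Rightarrow> 'a :: field mat set \<Rightarrow> 'a mat set" where
  "mat_span d S \<equiv> LinearCombinations.module.span class_ring (gl TYPE('a) d) S"

lemma mat_span_subspace:
  assumes "S \<subseteq> carrier_mat d d"
  shows "VectorSpace.subspace class_ring (mat_span d S) (gl TYPE('a :: field) d)"
proof -
  interpret vectorspace class_ring "gl TYPE('a) d" by (rule vectorspace_module_mat)
  show ?thesis using span_is_subspace[of S] assms by (simp add: module_mat_simps)
qed

lemma mat_span_superset: "S \<subseteq> carrier_mat d d \<Longrightarrow> S \<subseteq> mat_span d (S :: 'a :: field mat set)"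
proof -
  interpret vectorspace class_ring "gl TYPE('a) d" by (rule vectorspace_module_mat)
  assume "S \<subseteq> carrier_mat d d"
  thus ?thesis using in_own_span[of S] by (simp add: module_mat_simps)
qed

lemma mat_span_minimal:
  assumes "S \<subseteq> N" "VectorSpace.subspace class_ring N (gl TYPE('a :: field) d)"
  shows "mat_span d S \<subseteq> N"
proof -
  interpret vectorspace class_ring "gl TYPE('a) d" by (rule vectorspace_module_mat)
  show ?thesis using span_is_subset[of S N] assms unfolding VectorSpace.subspace_def by blast
qed

lemma mat_mult_entry:
  fixes A B :: "'a :: semiring_0 mat"
  assumes "A \<in> carrier_mat n n" "B \<in> carrier_mat n n" "i < n" "j < n"
  shows "(A * B) $$ (i, j) = (\<Sum>l<n. A $$ (i, l) * B $$ (l, j))"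
  using assms by (simp add: scalar_prod_def atLeast0LessThan)

lemma smult_line_subspace:
  assumes A: "(A :: 'a :: field mat) \<in> carrier_mat d d"
  shows "VectorSpace.subspace class_ring (range (\<lambda>c. c \<cdot>\<^sub>m A)) (gl TYPE('a) d)"
  unfolding subspace_gl_iff
proof (intro conjI ballI allI)
  have "0\<^sub>m d d = 0 \<cdot>\<^sub>m A" using A by (intro eq_matI) auto
  thus "0\<^sub>m d d \<in> range (\<lambda>c. c \<cdot>\<^sub>m A)" by blast
next
  fix X Y assume "X \<in> range (\<lambda>c. c \<cdot>\<^sub>m A)" "Y \<in> range (\<lambda>c. c \<cdot>\<^sub>m A)"
  then obtain a b where "X = a \<cdot>\<^sub>m A" "Y = b \<cdot>\<^sub>m A" by blast
  hence "X + Y = (a + b) \<cdot>\<^sub>m A" using A by (intro eq_matI) (auto simp: distrib_right)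
  thus "X + Y \<in> range (\<lambda>c. c \<cdot>\<^sub>m A)" by blast
next
  fix c X assume "X \<in> range (\<lambda>c. c \<cdot>\<^sub>m A)"
  then obtain a where "X = a \<cdot>\<^sub>m A" by blast
  hence "c \<cdot>\<^sub>m X = (c * a) \<cdot>\<^sub>m A" using A by (intro eq_matI) auto
  thus "c \<cdot>\<^sub>m X \<in> range (\<lambda>c. c \<cdot>\<^sub>m A)" by blast
qed (use A in auto)

lemma lie_subalgebra_iff:
  "lie_subalgebra d (L :: 'a :: field mat set) \<longleftrightarrow>
    L \<subseteq> carrier_mat d d \<and> 0\<^sub>m d d \<in> L \<and> (\<forall>A\<in>L. \<forall>B\<in>L. A + B \<in> L) \<and> (\<forall>c. \<forall>A\<in>L. c \<cdot>\<^sub>m A \<in> L) \<and>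
    (\<forall>A\<in>L. \<forall>B\<in>L. lie_bracket A B \<in> L)"
  unfolding lie_subalgebra_def subspace_gl_iff by blast

lemma lie_bracket_carrier [simp, intro]:
  "A \<in> carrier_mat d d \<Longrightarrow> B \<in> carrier_mat d d \<Longrightarrow> lie_bracket A B \<in> carrier_mat d d"
  unfolding lie_bracket_def by (intro minus_carrier_mat mult_carrier_mat)

lemma lie_bracket_add_right:
  assumes "X \<in> carrier_mat d d" "A \<in> carrier_mat d d" "B \<in> carrier_mat d d"
  shows "lie_bracket X (A + B) = lie_bracket X A + lie_bracket X B"
proof -
  have "X * (A + B) = X * A + X * B" using mult_add_distrib_mat assms by blast
  moreover have "(A + B) * X = A * X + B * X" using add_mult_distrib_mat assms by blast
  ultimately show ?thesis using assms unfolding lie_bracket_def by (intro eq_matI) auto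
qed

lemma lie_bracket_smult_right:
  assumes "X \<in> carrier_mat d d" "A \<in> carrier_mat d d"
  shows "lie_bracket X (c \<cdot>\<^sub>m A) = c \<cdot>\<^sub>m lie_bracket X A"
proof -
  have "X * (c \<cdot>\<^sub>m A) = c \<cdot>\<^sub>m (X * A)" using mult_smult_distrib assms by blast
  moreover have "(c \<cdot>\<^sub>m A) * X = c \<cdot>\<^sub>m (A * X)" using mult_smult_assoc_mat assms by blast
  ultimately show ?thesis using assms unfolding lie_bracket_def
    by (intro eq_matI) (auto simp: right_diff_distrib)
qed

lemma lie_bracket_swap:
  assumes "X \<in> carrier_mat d d" "A \<in> carrier_mat d d"
  shows "lie_bracket A X = (-1) \<cdot>\<^sub>m lie_bracket X A"
  using assms unfolding lie_bracket_def by (intro eq_matI) auto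

lemma lie_bracket_jacobi:
  assumes "X \<in> carrier_mat d d" "A \<in> carrier_mat d d" "B \<in> carrier_mat d d"
  shows "lie_bracket X (lie_bracket A B) =
    lie_bracket (lie_bracket X A) B + lie_bracket A (lie_bracket X B)"
proof -
  have m1: "U * (V - W) = U * V - U * W"
    if "U \<in> carrier_mat d d" "V \<in> carrier_mat d d" "W \<in> carrier_mat d d" for U V W :: "'a mat"
    using that by (rule mult_minus_distrib_mat)
  have m2: "(V - W) * U = V * U - W * U"
    if "U \<in> carrier_mat d d" "V \<in> carrier_mat d d" "W \<in> carrier_mat d d" for U V W :: "'a mat"
    using that(2,3,1) by (rule minus_mult_distrib_mat)
  have a: "U * V * W = U * (V * W)"
    if "U \<in> carrier_mat d d" "V \<in> carrier_mat d d" "W \<in> carrier_mat d d" for U V W :: "'a mat"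
    using assoc_mult_mat that by blast
  have c: "U * V \<in> carrier_mat d d" if "U \<in> carrier_mat d d" "V \<in> carrier_mat d d" for U V :: "'a mat"
    using that by (rule mult_carrier_mat)
  show ?thesis unfolding lie_bracket_def using assms
    by (simp add: m1 m2 a c) (intro eq_matI, auto)
qed

lemma lie_bracket_zero_right:
  "X \<in> carrier_mat d d \<Longrightarrow> lie_bracket X (0\<^sub>m d d) = 0\<^sub>m d d"
  unfolding lie_bracket_def by (intro eq_matI) auto

lemma lie_bracket_self: "X \<in> carrier_mat d d \<Longrightarrow> lie_bracket X X = 0\<^sub>m d d"
  unfolding lie_bracket_def by (intro eq_matI) auto

section \<open>Lower central series of a generated algebra\<close>

lemma lie_generated_subalgebra:
  assumes "X \<subseteq> carrier_mat d d"
  shows "lie_subalgebra d (lie_generated d X)" "X \<subseteq> lie_generated d X"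
proof -
  have "lie_subalgebra d (carrier_mat d d)"
    unfolding lie_subalgebra_iff by auto
  thus "lie_subalgebra d (lie_generated d X)" "X \<subseteq> lie_generated d X"
    using assms unfolding lie_generated_def lie_subalgebra_iff by auto
qed

lemma lie_generated_minimal:
  "lie_subalgebra d N \<Longrightarrow> X \<subseteq> N \<Longrightarrow> lie_generated d X \<subseteq> N"
  unfolding lie_generated_def by blast

lemma lower_central_subset_subspace:
  assumes "lie_subalgebra d L"
  shows "VectorSpace.subspace class_ring (lower_central d L i) (gl TYPE('a :: field) d)"
    and "lower_central d L i \<subseteq> carrier_mat d d"
proof -
  have "VectorSpace.subspace class_ring (lower_central d L i) (gl TYPE('a) d)"
  proof (induction i)
    case 0
    thus ?case using assms by (simp add: lie_subalgebra_def)
  next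
    case (Suc i)
    hence "lower_central d L i \<subseteq> carrier_mat d d" unfolding subspace_gl_iff by blast
    moreover have "L \<subseteq> carrier_mat d d" using assms unfolding lie_subalgebra_iff by blast
    ultimately have "{lie_bracket A B | A B. A \<in> L \<and> B \<in> lower_central d L i} \<subseteq> carrier_mat d d"
      by blast
    thus ?case unfolding lower_central.simps by (rule mat_span_subspace)
  qed
  thus "VectorSpace.subspace class_ring (lower_central d L i) (gl TYPE('a) d)"
    "lower_central d L i \<subseteq> carrier_mat d d" unfolding subspace_gl_iff by blast+
qed

lemma lower_central_bracket:
  assumes L: "lie_subalgebra d L" and "A \<in> L" "B \<in> lower_central d L i"
  shows "lie_bracket A B \<in> lower_central d L (Suc i)"
proof -
  have "{lie_bracket A B | A B. A \<in> L \<and> B \<in> lower_central d L i} \<subseteq> carrier_mat d d"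
    using L lower_central_subset_subspace(2)[OF L, of i] unfolding lie_subalgebra_iff by blast
  from mat_span_superset[OF this] assms show ?thesis unfolding lower_central.simps by blast
qed

lemma lower_central_zero_mono:
  assumes L: "lie_subalgebra d L" and "lower_central d L i = {0\<^sub>m d d}" "i \<le> j"
  shows "lower_central d L j = {0\<^sub>m d d}"
  using assms(3)
proof (induction rule: dec_induct)
  case (step j)
  have "{lie_bracket A B | A B. A \<in> L \<and> B \<in> lower_central d L j} \<subseteq> {0\<^sub>m d d}"
    using L unfolding step.IH lie_subalgebra_iff by (auto simp: lie_bracket_zero_right)
  hence "lower_central d L (Suc j) \<subseteq> {0\<^sub>m d d}" unfolding lower_central.simps
    by (rule mat_span_minimal) (auto simp: subspace_gl_iff)
  thus ?case using lower_central_subset_subspace(1)[OF L, of "Suc j"] unfolding subspace_gl_iff by blast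
qed (use assms in simp)

text \<open>By the Jacobi identity, a derivation that preserves \<open>L\<close> preserves each term
  of its lower central series. It serves for ad D(0,0), where D(0,0) itself need not lie in
  \<open>L\<close>.\<close>

lemma lower_central_derivation:
  assumes L: "lie_subalgebra d L" and X: "X \<in> carrier_mat d d"
    and der: "\<And>A. A \<in> L \<Longrightarrow> lie_bracket X A \<in> L"
    and B: "B \<in> lower_central d L i"
  shows "lie_bracket X B \<in> lower_central d L i"
  using B
proof (induction i arbitrary: B)
  case 0
  thus ?case using der by simp
next
  case (Suc i)
  let ?C = "lower_central d L (Suc i)"
  let ?N = "{B \<in> ?C. lie_bracket X B \<in> ?C}"
  have C: "?C \<subseteq> carrier_mat d d" "0\<^sub>m d d \<in> ?C" "\<And>A B. A \<in> ?C \<Longrightarrow> B \<in> ?C \<Longrightarrow> A + B \<in> ?C"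
    "\<And>c A. A \<in> ?C \<Longrightarrow> c \<cdot>\<^sub>m A \<in> ?C"
    using lower_central_subset_subspace(1)[OF L, of "Suc i"] unfolding subspace_gl_iff by blast+
  have "VectorSpace.subspace class_ring ?N (gl TYPE('a) d)"
    unfolding subspace_gl_iff
  proof (intro conjI ballI allI)
    fix A B assume "A \<in> ?N" "B \<in> ?N"
    moreover from this have "A \<in> carrier_mat d d" "B \<in> carrier_mat d d" using C(1) by blast+
    ultimately show "A + B \<in> ?N" using C(3) X lie_bracket_add_right[of X d A B] by simp
  next
    fix c A assume "A \<in> ?N"
    moreover from this have "A \<in> carrier_mat d d" using C(1) by blast
    ultimately show "c \<cdot>\<^sub>m A \<in> ?N" using C(4) X lie_bracket_smult_right[of X d A c] by simp
  qed (use C lie_bracket_zero_right[OF X] in auto)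
  moreover have "{lie_bracket A B | A B. A \<in> L \<and> B \<in> lower_central d L i} \<subseteq> ?N"
  proof clarify
    fix A B assume A: "A \<in> L" and B: "B \<in> lower_central d L i"
    have car: "A \<in> carrier_mat d d" "B \<in> carrier_mat d d"
      using A B L lower_central_subset_subspace(2)[OF L] unfolding lie_subalgebra_iff by blast+
    have "lie_bracket (lie_bracket X A) B \<in> ?C" "lie_bracket A (lie_bracket X B) \<in> ?C"
      "lie_bracket A B \<in> ?C"
      using lower_central_bracket[OF L] A B der Suc.IH by blast+
    thus "lie_bracket A B \<in> ?C \<and> lie_bracket X (lie_bracket A B) \<in> ?C"
      using lie_bracket_jacobi[OF X car] C(3) by simp
  qed
  ultimately have "?C \<subseteq> ?N" unfolding lower_central.simps by (intro mat_span_minimal)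
  thus ?case using Suc.prems by blast
qed

text \<open>By the Jacobi identity, the elements that ad \<open>D\<close> keeps inside the generated
  algebra form a subalgebra; it contains the generators because ad \<open>D\<close> shifts the index
  \<open>l\<close>.\<close>

lemma lie_generated_ad_stable:
  fixes D E :: "'a :: field mat"
  assumes D: "D \<in> carrier_mat d d" and E: "E \<in> carrier_mat d d"
  defines "G \<equiv> range (\<lambda>l. (lie_bracket D ^^ l) E)"
  shows "G \<subseteq> carrier_mat d d" "E \<in> lie_generated d G"
    "A \<in> lie_generated d G \<Longrightarrow> lie_bracket D A \<in> lie_generated d G"
proof -
  have "(lie_bracket D ^^ l) E \<in> carrier_mat d d" for l
    by (induction l) (use D E in auto)
  thus G: "G \<subseteq> carrier_mat d d" unfolding G_def by blast
  let ?L = "lie_generated d G"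
  have L: "lie_subalgebra d ?L" "G \<subseteq> ?L" using lie_generated_subalgebra[OF G] by auto
  have "(lie_bracket D ^^ 0) E \<in> G" unfolding G_def by blast
  thus "E \<in> ?L" using L(2) by auto
  let ?N = "{B \<in> ?L. lie_bracket D B \<in> ?L}"
  have C: "?L \<subseteq> carrier_mat d d" "0\<^sub>m d d \<in> ?L" "\<And>A B. A \<in> ?L \<Longrightarrow> B \<in> ?L \<Longrightarrow> A + B \<in> ?L"
    "\<And>c A. A \<in> ?L \<Longrightarrow> c \<cdot>\<^sub>m A \<in> ?L" "\<And>A B. A \<in> ?L \<Longrightarrow> B \<in> ?L \<Longrightarrow> lie_bracket A B \<in> ?L"
    using L(1) unfolding lie_subalgebra_iff by blast+
  have "lie_subalgebra d ?N"
    unfolding lie_subalgebra_iff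
  proof (intro conjI ballI allI)
    fix A B assume AB: "A \<in> ?N" "B \<in> ?N"
    hence car: "A \<in> carrier_mat d d" "B \<in> carrier_mat d d" using C(1) by blast+
    show "A + B \<in> ?N" using AB car C(3) lie_bracket_add_right[OF D car] by simp
    show "lie_bracket A B \<in> ?N" using AB C(3,5) lie_bracket_jacobi[OF D car] by simp
  next
    fix c A assume A: "A \<in> ?N"
    hence "A \<in> carrier_mat d d" using C(1) by blast
    thus "c \<cdot>\<^sub>m A \<in> ?N" using A C(4) lie_bracket_smult_right[OF D, of A c] by simp
  qed (use C lie_bracket_zero_right[OF D] in auto)
  moreover have "G \<subseteq> ?N"
  proof clarify
    fix A assume A: "A \<in> G"
    then obtain l where "A = (lie_bracket D ^^ l) E" unfolding G_def by blast
    hence "lie_bracket D A = (lie_bracket D ^^ Suc l) E" by simp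
    hence "lie_bracket D A \<in> G" unfolding G_def by blast
    thus "A \<in> ?L \<and> lie_bracket D A \<in> ?L" using A L(2) by blast
  qed
  ultimately have "?L \<subseteq> ?N" by (rule lie_generated_minimal)
  thus "A \<in> ?L \<Longrightarrow> lie_bracket D A \<in> ?L" by blast
qed

text \<open>Upper bounds come from filtrations whose degrees add under brackets. The index is
  shifted by one because the generators already have degree 1.\<close>

lemma lower_central_generated_subset:
  fixes N :: "nat \<Rightarrow> 'a :: field mat set"
  assumes sub: "\<And>j. VectorSpace.subspace class_ring (N j) (gl TYPE('a) d)"
    and gen: "G \<subseteq> N 1" and mono: "N 2 \<subseteq> N 1"
    and br: "\<And>A B j. A \<in> N 1 \<Longrightarrow> B \<in> N j \<Longrightarrow> lie_bracket A B \<in> N (Suc j)"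
  shows "lower_central d (lie_generated d G) i \<subseteq> N (Suc i)"
proof -
  have "lie_bracket A B \<in> N 1" if "A \<in> N 1" "B \<in> N 1" for A B
    using br[OF that] mono by (auto simp: numeral_2_eq_2)
  hence "lie_subalgebra d (N 1)" unfolding lie_subalgebra_def using sub by blast
  hence 1: "lie_generated d G \<subseteq> N 1" using gen by (rule lie_generated_minimal)
  show ?thesis
  proof (induction i)
    case 0
    thus ?case using 1 by simp
  next
    case (Suc i)
    show ?case unfolding lower_central.simps
      by (rule mat_span_minimal[OF _ sub]) (use Suc 1 br in blast)
  qed
qed

section \<open>Products and right-normed brackets of two matrices\<close>

primrec word_mat :: "nat \<Rightarrow> 'a :: field mat \<Rightarrow> 'a mat \<Rightarrow> bool list \<Rightarrow> 'a mat" where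
  "word_mat d D E [] = 1\<^sub>m d"
| "word_mat d D E (b # u) = (if b then E else D) * word_mat d D E u"

text \<open>The empty bracket is 0 as in \<open>bracket_eval\<close>, so that the entry formula
  \<open>word_bracket_entry\<close> holds for every word.\<close>

primrec word_bracket :: "nat \<Rightarrow> 'a :: field mat \<Rightarrow> 'a mat \<Rightarrow> bool list \<Rightarrow> 'a mat" where
  "word_bracket d D E [] = 0\<^sub>m d d"
| "word_bracket d D E (b # z) = (if z = [] then if b then E else D
     else lie_bracket (if b then E else D) (word_bracket d D E z))"

lemma word_mat_carrier [simp]:
  "D \<in> carrier_mat d d \<Longrightarrow> E \<in> carrier_mat d d \<Longrightarrow> word_mat d D E u \<in> carrier_mat d d"
  by (induction u) auto

lemma word_bracket_carrier [simp]:
  "D \<in> carrier_mat d d \<Longrightarrow> E \<in> carrier_mat d d \<Longrightarrow> word_bracket d D E u \<in> carrier_mat d d"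
  by (induction u) auto

lemma word_mat_append:
  assumes "D \<in> carrier_mat d d" "E \<in> carrier_mat d d"
  shows "word_mat d D E (u @ v) = word_mat d D E u * word_mat d D E v"
proof (induction u)
  case Nil
  show ?case using left_mult_one_mat[OF word_mat_carrier[OF assms, of v]] by simp
next
  case (Cons b u)
  have "(if b then E else D) \<in> carrier_mat d d" using assms by simp
  thus ?case using Cons assoc_mult_mat[OF _ word_mat_carrier[OF assms, of u] word_mat_carrier[OF assms, of v]]
    by simp
qed

text \<open>The outer factors carry the induction: the commutator with the outermost letter moves
  that letter into \<open>A\<close> or into \<open>B\<close>.\<close>

lemma word_bracket_frame_entry:
  assumes D: "D \<in> carrier_mat d d" and E: "E \<in> carrier_mat d d"
    and A: "A \<in> carrier_mat d d" and B: "B \<in> carrier_mat d d" and ij: "i < d" "j < d"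
  shows "(A * word_bracket d D E z * B) $$ (i, j) =
    bracket_eval z (\<lambda>u. (A * word_mat d D E u * B) $$ (i, j))"
  using A B
proof (induction z arbitrary: A B)
  case Nil
  thus ?case using ij by simp
next
  case (Cons b z)
  define X where "X = (if b then E else D)"
  have X: "X \<in> carrier_mat d d" using D E by (simp add: X_def)
  note A = Cons.prems(1) and B = Cons.prems(2)
  show ?case
  proof (cases "z = []")
    case True
    have "word_mat d D E [b] = X" using right_mult_one_mat[OF X] by (simp add: X_def)
    thus ?thesis using True by (simp add: X_def)
  next
    case False
    let ?Y = "word_bracket d D E z"
    have Y: "?Y \<in> carrier_mat d d" using D E by simp
    have m: "A * lie_bracket X ?Y * B = (A * X) * ?Y * B - A * ?Y * (X * B)"
    proof -
      have "A * lie_bracket X ?Y = A * (X * ?Y) - A * (?Y * X)"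
        unfolding lie_bracket_def using mult_minus_distrib_mat[of A d d "X * ?Y" d "?Y * X"] A X Y by auto
      also have "\<dots> * B = A * (X * ?Y) * B - A * (?Y * X) * B"
        using minus_mult_distrib_mat[of "A * (X * ?Y)" d d "A * (?Y * X)" B d] A X Y B by auto
      also have "A * (X * ?Y) = A * X * ?Y" using assoc_mult_mat[OF A X Y] by simp
      also have "A * (?Y * X) * B = A * ?Y * (X * B)"
        using assoc_mult_mat[OF A Y X] assoc_mult_mat[of "A * ?Y" d d X d B d] A X Y B by auto
      finally show ?thesis .
    qed
    have AX: "A * X \<in> carrier_mat d d" and XB: "X * B \<in> carrier_mat d d" using A X B by auto
    have e1: "A * word_mat d D E (b # u) * B = A * X * word_mat d D E u * B" for u
      using assoc_mult_mat[OF A X word_mat_carrier[OF D E, of u]] by (simp add: X_def)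
    have e2: "A * word_mat d D E (u @ [b]) * B = A * word_mat d D E u * (X * B)" for u
    proof -
      have "word_mat d D E [b] = X" using right_mult_one_mat[OF X] by (simp add: X_def)
      hence "word_mat d D E (u @ [b]) = word_mat d D E u * X" using word_mat_append[OF D E] by simp
      thus ?thesis
        using assoc_mult_mat[OF A word_mat_carrier[OF D E, of u] X]
          assoc_mult_mat[OF mult_carrier_mat[OF A word_mat_carrier[OF D E, of u]] X B] by simp
    qed
    have "(A * word_bracket d D E (b # z) * B) $$ (i, j) =
       ((A * X) * ?Y * B - A * ?Y * (X * B)) $$ (i, j)" using False m by (simp add: X_def)
    also have "\<dots> = ((A * X) * ?Y * B) $$ (i, j) - (A * ?Y * (X * B)) $$ (i, j)"
      using A B X Y ij by (intro index_minus_mat) auto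
    also have "\<dots> = bracket_eval z (\<lambda>u. (A * X * word_mat d D E u * B) $$ (i, j)) -
        bracket_eval z (\<lambda>u. (A * word_mat d D E u * (X * B)) $$ (i, j))"
      using Cons.IH[OF AX B] Cons.IH[OF A XB] by simp
    also have "\<dots> = bracket_eval (b # z) (\<lambda>u. (A * word_mat d D E u * B) $$ (i, j))"
      using False by (simp only: bracket_eval.simps if_False e1 e2)
    finally show ?thesis .
  qed
qed

lemma word_bracket_entry:
  assumes D: "D \<in> carrier_mat d d" and E: "E \<in> carrier_mat d d" and ij: "i < d" "j < d"
  shows "word_bracket d D E z $$ (i, j) = bracket_eval z (\<lambda>u. word_mat d D E u $$ (i, j))"
proof -
  have one: "1\<^sub>m d * Y * 1\<^sub>m d = Y" if "Y \<in> carrier_mat d d" for Y :: "'a mat" using that by simp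
  show ?thesis
    using word_bracket_frame_entry[OF D E one_carrier_mat one_carrier_mat ij, of z]
    unfolding one[OF word_bracket_carrier[OF D E]] one[OF word_mat_carrier[OF D E]] .
qed

lemma word_bracket_no_True:
  assumes "D \<in> carrier_mat d d" "True \<notin> set z"
  shows "\<exists>c. word_bracket d D E z = c \<cdot>\<^sub>m D"
  using assms(2)
proof (induction z)
  case Nil
  have "word_bracket d D E [] = 0 \<cdot>\<^sub>m D" using assms(1) by (intro eq_matI) auto
  thus ?case by blast
next
  case (Cons b z)
  then obtain c where c: "word_bracket d D E z = c \<cdot>\<^sub>m D" by auto
  show ?case
  proof (cases "z = []")
    case True
    hence "word_bracket d D E (b # z) = 1 \<cdot>\<^sub>m D" using Cons.prems by (intro eq_matI) auto
    thus ?thesis by blast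
  next
    case False
    have "word_bracket d D E (b # z) = lie_bracket D (c \<cdot>\<^sub>m D)" using False c Cons.prems by simp
    also have "\<dots> = 0 \<cdot>\<^sub>m D"
      unfolding lie_bracket_smult_right[OF assms(1) assms(1)] lie_bracket_self[OF assms(1)]
      using assms(1) by (intro eq_matI) auto
    finally show ?thesis by blast
  qed
qed

text \<open>Letters \<open>E\<close> raise the index and letters \<open>D\<close> act by a
  derivation; the innermost \<open>E\<close> only gives membership in \<open>L\<close>, hence
  \<open>Suc n\<close> letters for index \<open>n\<close>.\<close>

lemma word_bracket_lower_central:
  assumes L: "lie_subalgebra d L" and D: "D \<in> carrier_mat d d" and E: "E \<in> L"
    and der: "\<And>A. A \<in> L \<Longrightarrow> lie_bracket D A \<in> L"
  shows "count (mset z) True = Suc n \<Longrightarrow> word_bracket d D E z \<in> lower_central d L n"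
proof (induction z arbitrary: n)
  case (Cons b z)
  have Ec: "E \<in> carrier_mat d d" using L E unfolding lie_subalgebra_iff by blast
  show ?case
  proof (cases b)
    case False
    hence "z \<noteq> []" "word_bracket d D E z \<in> lower_central d L n" using Cons by auto
    thus ?thesis using False lower_central_derivation[OF L D der] by simp
  next
    case b: True
    show ?thesis
    proof (cases n)
      case 0
      hence T: "True \<notin> set z" using Cons.prems b by (simp add: count_eq_zero_iff)
      show ?thesis
      proof (cases "z = []")
        case True
        thus ?thesis using b 0 E by simp
      next
        case False
        \<comment> \<open>The inner bracket has letters \<open>D\<close> only and is a multiple of
          \<open>D\<close>, possibly outside \<open>L\<close>; bracketed with \<open>E\<close> it
          becomes a multiple of \<open>lie_bracket D E\<close>, which lies in
          \<open>L\<close>.\<close>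
        obtain c where "word_bracket d D E z = c \<cdot>\<^sub>m D" using word_bracket_no_True[OF D T] by blast
        hence "word_bracket d D E (b # z) = c \<cdot>\<^sub>m ((-1) \<cdot>\<^sub>m lie_bracket D E)"
          using b False lie_bracket_smult_right[OF Ec D] lie_bracket_swap[OF D Ec] by simp
        moreover have "lie_bracket D E \<in> L" by (rule der[OF E])
        ultimately show ?thesis using 0 L unfolding lie_subalgebra_iff by simp
      qed
    next
      case (Suc m)
      hence c: "count (mset z) True = Suc m" using Cons.prems b by simp
      hence "z \<noteq> []" by auto
      thus ?thesis using b Suc Cons.IH[OF c] lower_central_bracket[OF L E] by simp
    qed
  qed
qed simp

lemma word_mat_strict_upper:
  assumes D: "D \<in> carrier_mat d d" "\<And>i j. i < d \<Longrightarrow> j < d \<Longrightarrow> D $$ (i, j) \<noteq> 0 \<Longrightarrow> i < j"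
    and E: "E \<in> carrier_mat d d" "\<And>i j. i < d \<Longrightarrow> j < d \<Longrightarrow> E $$ (i, j) \<noteq> 0 \<Longrightarrow> i < j"
  shows "i < d \<Longrightarrow> j < d \<Longrightarrow> word_mat d D E u $$ (i, j) \<noteq> 0 \<Longrightarrow> i + length u \<le> j"
proof (induction u arbitrary: i)
  case (Cons b u)
  define X where "X = (if b then E else D)"
  have X1: "X \<in> carrier_mat d d" by (simp add: X_def D(1) E(1))
  have X2: "i < j" if "i < d" "j < d" "X $$ (i, j) \<noteq> 0" for i j
    using that D(2)[of i j] E(2)[of i j] by (cases b) (simp_all add: X_def)
  note X = X1 X2
  have "word_mat d D E (b # u) $$ (i, j) = (\<Sum>k<d. X $$ (i, k) * word_mat d D E u $$ (k, j))"
    using Cons.prems X(1) word_mat_carrier[OF D(1) E(1), of u]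
    by (simp add: X_def[symmetric] scalar_prod_def atLeast0LessThan)
  then obtain k where "k < d" "X $$ (i, k) * word_mat d D E u $$ (k, j) \<noteq> 0"
    using Cons.prems(3) by (metis (no_types, lifting) lessThan_iff sum.neutral)
  hence "i < k" "k + length u \<le> j" using X(2) Cons by auto
  thus ?case by simp
qed (auto split: if_splits)

text \<open>A path of \<open>length u\<close> strictly rightward steps that covers distance
  \<open>length u\<close> has only steps of length one, so the sum over paths is a single
  product.\<close>

lemma word_mat_superdiagonal:
  assumes D: "D \<in> carrier_mat d d" "\<And>i j. i < d \<Longrightarrow> j < d \<Longrightarrow> D $$ (i, j) \<noteq> 0 \<Longrightarrow> i < j"
    and E: "E \<in> carrier_mat d d" "\<And>i j. i < d \<Longrightarrow> j < d \<Longrightarrow> E $$ (i, j) \<noteq> 0 \<Longrightarrow> i < j"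
  shows "i + length u < d \<Longrightarrow> word_mat d D E u $$ (i, i + length u) =
    (\<Prod>k<length u. (if u ! k then E else D) $$ (i + k, Suc (i + k)))"
proof (induction u arbitrary: i)
  case (Cons b u)
  define X where "X = (if b then E else D)"
  have X1: "X \<in> carrier_mat d d" by (simp add: X_def D(1) E(1))
  have X2: "i < j" if "i < d" "j < d" "X $$ (i, j) \<noteq> 0" for i j
    using that D(2)[of i j] E(2)[of i j] by (cases b) (simp_all add: X_def)
  note X = X1 X2
  let ?j = "i + length (b # u)"
  have z: "X $$ (i, k) * word_mat d D E u $$ (k, ?j) = 0" if "k < d" "k \<noteq> Suc i" for k
  proof (rule ccontr)
    assume "\<not> ?thesis"
    hence "i < k" "k + length u \<le> ?j"
      using X(2)[of i k] word_mat_strict_upper[OF D E, of k ?j u] that Cons.prems by auto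
    thus False using that by simp
  qed
  have "word_mat d D E (b # u) $$ (i, ?j) = (\<Sum>k<d. X $$ (i, k) * word_mat d D E u $$ (k, ?j))"
    using Cons.prems X(1) word_mat_carrier[OF D(1) E(1), of u]
    by (simp add: X_def[symmetric] scalar_prod_def atLeast0LessThan)
  also have "\<dots> = (\<Sum>k\<in>{Suc i}. X $$ (i, k) * word_mat d D E u $$ (k, ?j))"
    by (rule sum.mono_neutral_right) (use Cons.prems z in auto)
  also have "\<dots> = X $$ (i, Suc i) * (\<Prod>k<length u. (if u ! k then E else D) $$ (Suc i + k, Suc (Suc i + k)))"
    using Cons.IH[of "Suc i"] Cons.prems by simp
  also have "\<dots> = (\<Prod>k<length (b # u). (if (b # u) ! k then E else D) $$ (i + k, Suc (i + k)))"
    by (simp only: length_Cons prod.lessThan_Suc_shift) (simp add: X_def)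
  finally show ?case .
qed simp

subsection \<open>The matrices of the theorem\<close>

text \<open>The index of the block that contains row or column \<open>r\<close>. The recursion
  follows the list of sizes, so that the entries of D(0,0) can be computed by induction.\<close>

primrec blk :: "nat list \<Rightarrow> nat \<Rightarrow> nat" where
  "blk [] r = 0"
| "blk (n # ns) r = (if r < n then 0 else Suc (blk ns (r - n)))"

lemma block_start_0 [simp]: "block_start ds 0 = 0"
  by (simp add: block_start_def)

lemma block_start_Cons_Suc [simp]: "block_start (n # ns) (Suc i) = n + block_start ns i"
  by (simp add: block_start_def)

lemma block_start_Suc: "i < length ds \<Longrightarrow> block_start ds (Suc i) = block_start ds i + ds ! i"
  by (simp add: block_start_def take_Suc_conv_app_nth)

lemma block_start_mono: "i \<le> j \<Longrightarrow> block_start ds i \<le> block_start ds j"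
  unfolding block_start_def by (metis le_add1 le_add_diff_inverse sum_list_append take_add)

lemma block_start_length: "length ds \<le> i \<Longrightarrow> block_start ds i = sum_list ds"
  by (simp add: block_start_def)

lemma block_start_le: "block_start ds i \<le> sum_list ds"
  using block_start_mono[of i "max i (length ds)" ds] block_start_length[of ds "max i (length ds)"]
  by simp

lemma blk_bounds:
  "r < sum_list ds \<Longrightarrow>
    blk ds r < length ds \<and> block_start ds (blk ds r) \<le> r \<and> r < block_start ds (Suc (blk ds r))"
proof (induction ds arbitrary: r)
  case (Cons n ns)
  show ?case
  proof (cases "r < n")
    case False
    hence "r - n < sum_list ns" using Cons.prems by simp
    from Cons.IH[OF this] False show ?thesis by auto
  qed (use Cons in simp)
qed simp

lemma blk_eqI: "block_start ds i \<le> r \<Longrightarrow> r < block_start ds (Suc i) \<Longrightarrow> blk ds r = i"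
proof (induction ds arbitrary: i r)
  case Nil
  thus ?case by (simp add: block_start_def)
next
  case (Cons n ns)
  show ?case
  proof (cases i)
    case (Suc j)
    have "blk ns (r - n) = j" by (rule Cons.IH) (use Cons.prems Suc in auto)
    thus ?thesis using Cons.prems Suc by simp
  qed (use Cons.prems in simp)
qed

lemma blk_mono: "r \<le> s \<Longrightarrow> s < sum_list ds \<Longrightarrow> blk ds r \<le> blk ds s"
proof (rule ccontr)
  assume rs: "r \<le> s" "s < sum_list ds" and n: "\<not> blk ds r \<le> blk ds s"
  have "s < block_start ds (Suc (blk ds s))" using blk_bounds rs by blast
  also have "\<dots> \<le> block_start ds (blk ds r)" by (rule block_start_mono) (use n in simp)
  also have "\<dots> \<le> r" using blk_bounds[of r ds] rs by simp
  finally show False using rs by simp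
qed

lemma D_mat_carrier [simp]: "D_mat ds \<in> carrier_mat (sum_list ds) (sum_list ds)"
proof -
  have "map fst (map (\<lambda>n. (n, 0 :: 'a)) ds) = ds" by (induction ds) auto
  thus ?thesis unfolding D_mat_def using jordan_matrix_carrier[of "map (\<lambda>n. (n, 0 :: 'a)) ds"] by simp
qed

lemma D_mat_Cons:
  "D_mat (n # ns) = four_block_mat (jordan_block n 0) (0\<^sub>m n (sum_list ns)) (0\<^sub>m (sum_list ns) n)
    (D_mat ns :: 'a :: field mat)"
proof -
  have d: "(D_mat ns :: 'a mat) \<in> carrier_mat (sum_list ns) (sum_list ns)" by (rule D_mat_carrier)
  have "D_mat (n # ns) = four_block_mat (jordan_block n 0) (0\<^sub>m n (dim_col (D_mat ns :: 'a mat)))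
      (0\<^sub>m (dim_row (D_mat ns :: 'a mat)) n) (D_mat ns :: 'a mat)"
    unfolding D_mat_def jordan_matrix_def by (simp add: Let_def)
  thus ?thesis using carrier_matD[OF d] by simp
qed

lemma D_mat_entry:
  "r < sum_list ds \<Longrightarrow> c < sum_list ds \<Longrightarrow>
    D_mat ds $$ (r, c) = (if c = Suc r \<and> blk ds r = blk ds c then 1 else 0 :: 'a :: field)"
proof (induction ds arbitrary: r c)
  case (Cons n ns)
  have dim: "dim_row (D_mat ns :: 'a mat) = sum_list ns" "dim_col (D_mat ns :: 'a mat) = sum_list ns"
    using D_mat_carrier[of ns, where 'a = 'a] unfolding carrier_mat_def by auto
  have IH: "D_mat ns $$ (r - n, c - n) = (if c - n = Suc (r - n) \<and> blk ns (r - n) = blk ns (c - n)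
      then 1 else 0 :: 'a)" if "\<not> r < n" "\<not> c < n"
    by (rule Cons.IH) (use Cons.prems that in auto)
  show ?case unfolding D_mat_Cons using Cons.prems IH dim by auto
qed simp

lemma E_mat_carrier [simp]: "E_mat ds S \<in> carrier_mat (sum_list ds) (sum_list ds)"
  by (simp add: E_mat_def)

lemma E_mat_entry:
  assumes "Suc (length S) = length ds" "r < sum_list ds" "c < sum_list ds"
  shows "E_mat ds S $$ (r, c) = (if blk ds c = Suc (blk ds r)
    then S ! blk ds r $$ (r - block_start ds (blk ds r), c - block_start ds (blk ds c)) else 0)"
proof -
  let ?P = "\<lambda>i. block_start ds i \<le> r \<and> r < block_start ds (Suc i) \<and>
          block_start ds (Suc i) \<le> c \<and> c < block_start ds (Suc (Suc i))"
  have P: "?P i \<longleftrightarrow> i = blk ds r \<and> blk ds c = Suc (blk ds r)" for i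
    using blk_bounds[OF assms(2)] blk_bounds[OF assms(3)] blk_eqI[of ds i r] blk_eqI[of ds "Suc i" c]
    by auto
  have "E_mat ds S $$ (r, c) = (\<Sum>i<length S. if ?P i
      then S ! i $$ (r - block_start ds i, c - block_start ds (Suc i)) else 0)"
    using assms by (simp add: E_mat_def)
  also have "\<dots> = (\<Sum>i<length S. if i = blk ds r then
      (if blk ds c = Suc (blk ds r) then S ! i $$ (r - block_start ds i, c - block_start ds (Suc i)) else 0) else 0)"
    unfolding P by (rule sum.cong) auto
  also have "\<dots> = (if blk ds c = Suc (blk ds r)
    then S ! blk ds r $$ (r - block_start ds (blk ds r), c - block_start ds (blk ds c)) else 0)"
    using blk_bounds[OF assms(3)] assms(1) by (auto simp: sum.delta)
  finally show ?thesis .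
qed

section \<open>Conjugation by the group G(d)\<close>

lemma list_all2_diag_block_commute:
  assumes "list_all2 (\<lambda>A B. \<exists>n. A \<in> carrier_mat n n \<and> B \<in> carrier_mat n n \<and> A * B = B * A) As
    (Bs :: 'a :: comm_ring_1 mat list)"
  shows "\<exists>n. diag_block_mat As \<in> carrier_mat n n \<and> diag_block_mat Bs \<in> carrier_mat n n \<and>
    diag_block_mat As * diag_block_mat Bs = diag_block_mat Bs * diag_block_mat As"
  using assms
proof (induction rule: list_all2_induct)
  case Nil
  show ?case by (intro exI[of _ 0]) auto
next
  case (Cons A As B Bs)
  then obtain n m where n: "A \<in> carrier_mat n n" "B \<in> carrier_mat n n" "A * B = B * A"
    and m: "diag_block_mat As \<in> carrier_mat m m" "diag_block_mat Bs \<in> carrier_mat m m"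
      "diag_block_mat As * diag_block_mat Bs = diag_block_mat Bs * diag_block_mat As" by blast
  have dA: "diag_block_mat (A # As) = four_block_mat A (0\<^sub>m n m) (0\<^sub>m m n) (diag_block_mat As)"
    using n(1) m(1) by (simp add: Let_def)
  have dB: "diag_block_mat (B # Bs) = four_block_mat B (0\<^sub>m n m) (0\<^sub>m m n) (diag_block_mat Bs)"
    using n(2) m(2) by (simp add: Let_def)
  have "diag_block_mat (A # As) * diag_block_mat (B # Bs) =
      four_block_mat (A * B) (0\<^sub>m n m) (0\<^sub>m m n) (diag_block_mat As * diag_block_mat Bs)"
    unfolding dA dB
    by (subst mult_four_block_mat[OF n(1) _ _ m(1) n(2) _ _ m(2)]) (use n m in auto)
  also have "\<dots> = four_block_mat (B * A) (0\<^sub>m n m) (0\<^sub>m m n) (diag_block_mat Bs * diag_block_mat As)"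
    using n(3) m(3) by simp
  also have "\<dots> = diag_block_mat (B # Bs) * diag_block_mat (A # As)"
    unfolding dA dB
    by (subst mult_four_block_mat[OF n(2) _ _ m(2) n(1) _ _ m(1)]) (use n m in auto)
  finally show ?case
    using four_block_carrier_mat[OF n(1) m(1)] four_block_carrier_mat[OF n(2) m(2)]
    unfolding dA dB by blast
qed

lemma mat_poly_eval_commute:
  assumes A: "A \<in> carrier_mat n n"
  shows "mat_poly_eval p n A * A = A * mat_poly_eval p n A"
proof -
  have pow: "A ^\<^sub>m m \<in> carrier_mat n n" for m using A by simp
  have comm: "A ^\<^sub>m m * A = A * A ^\<^sub>m m" for m
  proof (induction m)
    case (Suc m)
    thus ?case using assoc_mult_mat[OF A pow[of m] A] by simp
  qed (use A in simp)
  have P: "mat_poly_eval p n A \<in> carrier_mat n n" by (simp add: mat_poly_eval_def)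
  show ?thesis
  proof (rule eq_matI)
    fix i j assume "i < dim_row (A * mat_poly_eval p n A)" "j < dim_col (A * mat_poly_eval p n A)"
    hence ij: "i < n" "j < n" using A P by auto
    have "(mat_poly_eval p n A * A) $$ (i, j) =
        (\<Sum>l<n. \<Sum>m\<le>degree p. coeff p m * ((A ^\<^sub>m m) $$ (i, l) * A $$ (l, j)))"
      unfolding mat_mult_entry[OF P A ij] using ij by (simp add: mat_poly_eval_def sum_distrib_right mult.assoc)
    also have "\<dots> = (\<Sum>m\<le>degree p. coeff p m * (A ^\<^sub>m m * A) $$ (i, j))"
      unfolding mat_mult_entry[OF pow A ij] sum_distrib_left by (rule sum.swap)
    also have "\<dots> = (\<Sum>m\<le>degree p. coeff p m * (A * A ^\<^sub>m m) $$ (i, j))" unfolding comm ..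
    also have "\<dots> = (\<Sum>l<n. \<Sum>m\<le>degree p. coeff p m * (A $$ (i, l) * (A ^\<^sub>m m) $$ (l, j)))"
      unfolding mat_mult_entry[OF A pow ij] sum_distrib_left by (rule sum.swap)
    also have "\<dots> = (A * mat_poly_eval p n A) $$ (i, j)"
      unfolding mat_mult_entry[OF A P ij] using ij
      by (simp add: mat_poly_eval_def sum_distrib_left mult.left_commute)
    finally show "(mat_poly_eval p n A * A) $$ (i, j) = (A * mat_poly_eval p n A) $$ (i, j)" .
  qed (use A P in auto)
qed

text \<open>Polynomials in a Jordan block commute with it. Hence conjugation by \<open>P\<close>
  fixes D(0,0) and carries brackets in D(0,0) and E(S) to the same brackets in D(0,0) and
  E(T).\<close>

lemma G_group_commute:
  assumes "P \<in> G_group ds"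
  shows "P * D_mat ds = D_mat ds * (P :: 'a :: field mat)"
proof -
  from assms obtain Ps where P: "P = diag_block_mat Ps" and len: "length Ps = length ds"
    and Ps: "\<forall>i<length ds. \<exists>p. Ps ! i = mat_poly_eval p (ds ! i) (jordan_block (ds ! i) 0)"
    unfolding G_group_def by blast
  let ?Js = "map (\<lambda>n. jordan_block n 0 :: 'a mat) ds"
  have "list_all2 (\<lambda>A B. \<exists>n. A \<in> carrier_mat n n \<and> B \<in> carrier_mat n n \<and> A * B = B * A) Ps ?Js"
    unfolding list_all2_conv_all_nth
  proof (intro conjI allI impI)
    fix i assume "i < length Ps"
    hence i: "i < length ds" using len by simp
    then obtain p where p: "Ps ! i = mat_poly_eval p (ds ! i) (jordan_block (ds ! i) 0)"
      using Ps by blast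
    have J: "jordan_block (ds ! i) 0 \<in> carrier_mat (ds ! i) (ds ! i)" by simp
    have "Ps ! i \<in> carrier_mat (ds ! i) (ds ! i)" by (simp add: p mat_poly_eval_def)
    moreover have "Ps ! i * jordan_block (ds ! i) 0 = jordan_block (ds ! i) 0 * Ps ! i"
      unfolding p by (rule mat_poly_eval_commute[OF J])
    ultimately show "\<exists>n. Ps ! i \<in> carrier_mat n n \<and> ?Js ! i \<in> carrier_mat n n \<and> Ps ! i * ?Js ! i = ?Js ! i * Ps ! i"
      using i J by auto
  qed (use len in simp)
  moreover have "D_mat ds = diag_block_mat ?Js"
    unfolding D_mat_def jordan_matrix_def by (simp add: comp_def)
  ultimately show ?thesis using list_all2_diag_block_commute[of Ps ?Js] P by auto
qed

lemma conj_lie_bracket: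
  assumes PQ: "P \<in> carrier_mat d d" "Q \<in> carrier_mat d d" "Q * P = 1\<^sub>m d"
    and AB: "A \<in> carrier_mat d d" "B \<in> carrier_mat d d"
  shows "P * lie_bracket A B * Q = lie_bracket (P * A * Q) (P * B * Q)"
proof -
  have pr: "(P * X * Q) * (P * Y * Q) = P * (X * Y) * Q"
    if X: "X \<in> carrier_mat d d" and Y: "Y \<in> carrier_mat d d" for X Y
  proof -
    have c: "U * V \<in> carrier_mat d d" if "U \<in> carrier_mat d d" "V \<in> carrier_mat d d" for U V :: "'a mat"
      using that by (rule mult_carrier_mat)
    have a: "U * V * W = U * (V * W)"
      if "U \<in> carrier_mat d d" "V \<in> carrier_mat d d" "W \<in> carrier_mat d d" for U V W :: "'a mat"
      using that by (rule assoc_mult_mat)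
    have "(P * X * Q) * (P * Y * Q) = P * (X * ((Q * P) * (Y * Q)))"
      using PQ(1,2) X Y by (simp add: a c)
    also have "(Q * P) * (Y * Q) = Y * Q" unfolding PQ(3) using Y PQ by simp
    also have "P * (X * (Y * Q)) = P * (X * Y) * Q" using PQ X Y by (simp add: a c)
    finally show ?thesis .
  qed
  have "P * (A * B - B * A) = P * (A * B) - P * (B * A)"
    by (rule mult_minus_distrib_mat) (use PQ AB in auto)
  moreover have "(P * (A * B) - P * (B * A)) * Q = P * (A * B) * Q - P * (B * A) * Q"
    by (rule minus_mult_distrib_mat) (use PQ AB in auto)
  ultimately show ?thesis unfolding lie_bracket_def pr[OF AB] pr[OF AB(2,1)] by simp
qed

lemma conj_word_bracket:
  assumes PQ: "P \<in> carrier_mat d d" "Q \<in> carrier_mat d d" "Q * P = 1\<^sub>m d"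
    and D: "D \<in> carrier_mat d d" "P * D * Q = D" and E: "E \<in> carrier_mat d d" "P * E * Q = E'"
  shows "P * word_bracket d D E z * Q = word_bracket d D E' z"
proof (induction z)
  case Nil
  show ?case using PQ by simp
next
  case (Cons b z)
  have X: "(if b then E else D) \<in> carrier_mat d d" using D E by simp
  have w: "word_bracket d D E z \<in> carrier_mat d d" using D E by simp
  show ?case using Cons conj_lie_bracket[OF PQ X w] D E by auto
qed

section \<open>The automorphism phi on products and brackets\<close>

lemma phi_carrier [simp]: "phi d A \<in> carrier_mat d d"
  by (simp add: phi_def)

lemma phi_entry:
  assumes "i < d" "j < d"
  shows "phi d A $$ (i, j) = - ((-1) ^ (i + j)) * A $$ (d - 1 - j, d - 1 - i)"
proof -
  have "(-1 :: 'a) powi (int i - int j + 1) = - ((-1) ^ (i + j))"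
  proof (cases "even (i + j)")
    case True
    hence "odd (int i - int j + 1)" by presburger
    thus ?thesis using True by simp
  next
    case False
    hence "even (int i - int j + 1)" by presburger
    thus ?thesis using False by simp
  qed
  thus ?thesis using assms by (simp add: phi_def)
qed

text \<open>Minus phi is transposition along the antidiagonal with alternating signs, an
  anti-automorphism of the matrix algebra; hence phi respects commutators.\<close>

lemma phi_mult_entry:
  assumes A: "A \<in> carrier_mat d d" and B: "B \<in> carrier_mat d d" and ij: "i < d" "j < d"
  shows "(phi d A * phi d B) $$ (i, j) = (-1) ^ (i + j) * (B * A) $$ (d - 1 - j, d - 1 - i)"
proof -
  have "(phi d A * phi d B) $$ (i, j) = (\<Sum>l<d. phi d A $$ (i, l) * phi d B $$ (l, j))"
    by (rule mat_mult_entry) (use ij in auto)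
  also have "\<dots> = (\<Sum>l<d. (-1) ^ (i + j) * (B $$ (d - 1 - j, d - 1 - l) * A $$ (d - 1 - l, d - 1 - i)))"
  proof (rule sum.cong)
    fix l assume "l \<in> {..<d}"
    hence l: "l < d" by simp
    have s: "(-1 :: 'a) ^ (i + l) * (-1) ^ (l + j) = (-1) ^ (i + j)"
      by (cases "even i"; cases "even l"; cases "even j") (simp_all add: power_add)
    have "phi d A $$ (i, l) * phi d B $$ (l, j) =
        ((-1) ^ (i + l) * (-1) ^ (l + j)) * (B $$ (d - 1 - j, d - 1 - l) * A $$ (d - 1 - l, d - 1 - i))"
      unfolding phi_entry[OF ij(1) l] phi_entry[OF l ij(2)] by (simp add: mult_ac)
    thus "phi d A $$ (i, l) * phi d B $$ (l, j) =
        (-1) ^ (i + j) * (B $$ (d - 1 - j, d - 1 - l) * A $$ (d - 1 - l, d - 1 - i))"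
      unfolding s .
  qed simp
  also have "\<dots> = (-1) ^ (i + j) * (\<Sum>l<d. B $$ (d - 1 - j, d - 1 - l) * A $$ (d - 1 - l, d - 1 - i))"
    by (simp add: sum_distrib_left)
  also have "(\<Sum>l<d. B $$ (d - 1 - j, d - 1 - l) * A $$ (d - 1 - l, d - 1 - i)) =
      (\<Sum>l<d. B $$ (d - 1 - j, l) * A $$ (l, d - 1 - i))"
    by (rule sum.reindex_bij_witness[of _ "\<lambda>l. d - 1 - l" "\<lambda>l. d - 1 - l"]) auto
  also have "\<dots> = (B * A) $$ (d - 1 - j, d - 1 - i)" by (rule mat_mult_entry[symmetric]) (use A B ij in auto)
  finally show ?thesis .
qed

lemma phi_lie_bracket:
  assumes A: "A \<in> carrier_mat d d" and B: "B \<in> carrier_mat d d"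
  shows "phi d (lie_bracket A B) = lie_bracket (phi d A) (phi d B)"
proof (rule eq_matI)
  fix i j assume "i < dim_row (lie_bracket (phi d A) (phi d B))" "j < dim_col (lie_bracket (phi d A) (phi d B))"
  hence ij: "i < d" "j < d"
    using lie_bracket_carrier[OF phi_carrier[of d A] phi_carrier[of d B]] by auto
  have 1: "lie_bracket (phi d A) (phi d B) $$ (i, j) =
      (phi d A * phi d B) $$ (i, j) - (phi d B * phi d A) $$ (i, j)"
    unfolding lie_bracket_def using ij by (intro index_minus_mat) (auto simp: phi_def)
  have 2: "lie_bracket A B $$ (d - 1 - j, d - 1 - i) =
      (A * B) $$ (d - 1 - j, d - 1 - i) - (B * A) $$ (d - 1 - j, d - 1 - i)"
    unfolding lie_bracket_def using ij A B by (intro index_minus_mat) auto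
  show "phi d (lie_bracket A B) $$ (i, j) = lie_bracket (phi d A) (phi d B) $$ (i, j)"
    unfolding phi_entry[OF ij] 1 2 phi_mult_entry[OF A B ij] phi_mult_entry[OF B A ij]
    by (simp add: algebra_simps)
qed (use carrier_matD[OF lie_bracket_carrier[OF phi_carrier[of d A] phi_carrier[of d B]]]
    carrier_matD[OF phi_carrier[of d "lie_bracket A B"]] in simp_all)

text \<open>Each letter contributes a factor -1, and the anti-automorphism that remains reverses the
  word.\<close>

lemma word_mat_phi_entry:
  assumes D: "D \<in> carrier_mat d d" and E: "E \<in> carrier_mat d d"
  shows "i < d \<Longrightarrow> j < d \<Longrightarrow> word_mat d (phi d D) (phi d E) u $$ (i, j) =
    (-1) ^ length u * (-1) ^ (i + j) * word_mat d D E (rev u) $$ (d - 1 - j, d - 1 - i)"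
proof (induction u arbitrary: i)
  case Nil
  thus ?case by (auto simp: power_add[symmetric])
next
  case (Cons b u)
  let ?l = "\<lambda>u. (-1 :: 'a) ^ length u"
  define X where "X = (if b then E else D)"
  have X: "X \<in> carrier_mat d d" using D E by (simp add: X_def)
  let ?W = "word_mat d (phi d D) (phi d E) u"
  have pX: "phi d X = (if b then phi d E else phi d D)" by (simp add: X_def)
  have "word_mat d (phi d D) (phi d E) (b # u) $$ (i, j) = (phi d X * ?W) $$ (i, j)" by (simp add: pX)
  also have "\<dots> = (\<Sum>l<d. phi d X $$ (i, l) * ?W $$ (l, j))"
    by (rule mat_mult_entry) (use Cons.prems in auto)
  also have "\<dots> = (\<Sum>l<d. ?l (b # u) * (-1) ^ (i + j) *
      (word_mat d D E (rev u) $$ (d - 1 - j, d - 1 - l) * X $$ (d - 1 - l, d - 1 - i)))"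
  proof (rule sum.cong)
    fix l assume "l \<in> {..<d}"
    hence l: "l < d" by simp
    have s: "(-1 :: 'a) ^ (i + l) * (-1) ^ (l + j) = (-1) ^ (i + j)"
      by (cases "even i"; cases "even l"; cases "even j") (simp_all add: power_add)
    have "phi d X $$ (i, l) * ?W $$ (l, j) = - (?l u * ((-1) ^ (i + l) * (-1) ^ (l + j)) *
      (word_mat d D E (rev u) $$ (d - 1 - j, d - 1 - l) * X $$ (d - 1 - l, d - 1 - i)))"
      unfolding phi_entry[OF Cons.prems(1) l] Cons.IH[OF l Cons.prems(2)] by (simp add: mult_ac)
    thus "phi d X $$ (i, l) * ?W $$ (l, j) = ?l (b # u) * (-1) ^ (i + j) *
      (word_mat d D E (rev u) $$ (d - 1 - j, d - 1 - l) * X $$ (d - 1 - l, d - 1 - i))"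
      unfolding s by simp
  qed simp
  also have "\<dots> = ?l (b # u) * (-1) ^ (i + j) *
      (\<Sum>l<d. word_mat d D E (rev u) $$ (d - 1 - j, d - 1 - l) * X $$ (d - 1 - l, d - 1 - i))"
    by (simp add: sum_distrib_left)
  also have "(\<Sum>l<d. word_mat d D E (rev u) $$ (d - 1 - j, d - 1 - l) * X $$ (d - 1 - l, d - 1 - i)) =
      (\<Sum>l<d. word_mat d D E (rev u) $$ (d - 1 - j, l) * X $$ (l, d - 1 - i))"
    by (rule sum.reindex_bij_witness[of _ "\<lambda>l. d - 1 - l" "\<lambda>l. d - 1 - l"]) auto
  also have "\<dots> = (word_mat d D E (rev u) * X) $$ (d - 1 - j, d - 1 - i)"
    by (rule mat_mult_entry[symmetric]) (use X D E Cons.prems in auto)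
  also have "word_mat d D E (rev u) * X = word_mat d D E (rev (b # u))"
    using word_mat_append[OF D E, of "rev u" "[b]"] right_mult_one_mat[OF X] by (simp add: X_def)
  finally show ?case .
qed

section \<open>Block dimensions and the superdiagonal word\<close>

locale block_dims =
  fixes ds :: "nat list"
  assumes len: "length ds \<ge> 2" and pos: "\<And>i. i < length ds \<Longrightarrow> ds ! i > 0"
begin

abbreviation "d \<equiv> sum_list ds"
abbreviation "k \<equiv> length ds"

text \<open>The superdiagonal word: on the first superdiagonal, \<open>E(S)\<close> is non-zero exactly in the rows with
  \<open>W r\<close>, and \<open>D(0,0)\<close> exactly in the others.\<close>

definition W :: "nat \<Rightarrow> bool" where
  "W r \<longleftrightarrow> blk ds (Suc r) \<noteq> blk ds r"

lemma block_start_strict: "i < j \<Longrightarrow> j \<le> k \<Longrightarrow> block_start ds i < block_start ds j"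
  using block_start_Suc[of i ds] pos[of i] block_start_mono[of "Suc i" j ds] by simp

lemma block_start_k [simp]: "block_start ds k = d"
  by (simp add: block_start_length)

lemma d_gt: "d > 1"
  using block_start_strict[of 0 1] block_start_strict[of 1 k] len by simp

lemma blk_Suc_cases:
  assumes "Suc r < d"
  shows "Suc r < block_start ds (Suc (blk ds r)) \<and> blk ds (Suc r) = blk ds r \<or>
    Suc r = block_start ds (Suc (blk ds r)) \<and> blk ds (Suc r) = Suc (blk ds r)"
proof -
  have b: "blk ds r < k" "block_start ds (blk ds r) \<le> r" "r < block_start ds (Suc (blk ds r))"
    using blk_bounds[of r ds] assms by auto
  show ?thesis
  proof (cases "Suc r < block_start ds (Suc (blk ds r))")
    case True
    thus ?thesis using blk_eqI[of ds "blk ds r" "Suc r"] b by simp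
  next
    case False
    hence e: "Suc r = block_start ds (Suc (blk ds r))" using b by simp
    have "Suc (blk ds r) \<noteq> k" using e assms by (metis block_start_k less_irrefl)
    hence "block_start ds (Suc (blk ds r)) < block_start ds (Suc (Suc (blk ds r)))"
      using b by (intro block_start_strict) auto
    hence "blk ds (Suc r) = Suc (blk ds r)" using e by (intro blk_eqI) auto
    thus ?thesis using e by simp
  qed
qed

lemma blk_Suc: "Suc r < d \<Longrightarrow> blk ds (Suc r) = blk ds r + of_bool (W r)"
  using blk_Suc_cases[of r] unfolding W_def by auto

text \<open>Every True on the first superdiagonal is one crossing into the next block.\<close>

lemma blk_add:
  "i + l < d \<Longrightarrow> blk ds (i + l) = blk ds i + count (mset (map W [i..<i + l])) True"
proof (induction l)
  case (Suc l)
  thus ?case using blk_Suc[of "i + l"] by (cases "W (i + l)") auto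
qed simp

lemma blk_block_start: "i < k \<Longrightarrow> blk ds (block_start ds i) = i"
  using block_start_strict[of i "Suc i"] by (intro blk_eqI) auto

lemma block_start_last: "block_start ds (k - 1) + ds ! (k - 1) = d"
proof -
  have "k - 1 < k" "Suc (k - 1) = k" using len by linarith+
  thus ?thesis using block_start_Suc[of "k - 1" ds] by (metis block_start_k)
qed

lemma blk_last: "blk ds (d - 1) = k - 1"
proof (rule blk_eqI)
  show "block_start ds (k - 1) \<le> d - 1" "d - 1 < block_start ds (Suc (k - 1))"
  proof -
    have "k - 1 < k" "Suc (k - 1) = k" using len by linarith+
    moreover from this have "block_start ds (k - 1) < d"
      using block_start_strict[of "k - 1" k] by simp
    ultimately show "block_start ds (k - 1) \<le> d - 1" "d - 1 < block_start ds (Suc (k - 1))"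
      by simp_all
  qed
qed

lemma blk_0 [simp]: "blk ds 0 = 0"
  using blk_block_start[of 0] len by (metis block_start_0 less_le_trans zero_less_numeral)

text \<open>Sizes as numbers of rows, so that a symmetry of the map \<open>blk\<close> transfers to
  the dimensions.\<close>

lemma block_size_card: "i < k \<Longrightarrow> ds ! i = card {r. r < d \<and> blk ds r = i}"
proof -
  assume i: "i < k"
  have "{r. r < d \<and> blk ds r = i} = {block_start ds i..<block_start ds (Suc i)}"
  proof (intro equalityI subsetI)
    fix r assume "r \<in> {r. r < d \<and> blk ds r = i}"
    thus "r \<in> {block_start ds i..<block_start ds (Suc i)}" using blk_bounds[of r ds] by auto
  next
    fix r assume "r \<in> {block_start ds i..<block_start ds (Suc i)}"
    thus "r \<in> {r. r < d \<and> blk ds r = i}"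
      using blk_eqI[of ds i r] block_start_le[of ds "Suc i"] by auto
  qed
  thus ?thesis using block_start_Suc[OF i] by simp
qed

lemma symmetric_block_start:
  assumes "symmetric_dims ds" "i \<le> k"
  shows "block_start ds i + block_start ds (k - i) = d"
proof -
  have "rev ds = ds"
  proof (rule nth_equalityI)
    fix j assume "j < length (rev ds)"
    hence j: "j < k" by simp
    have "rev ds ! j = ds ! (k - 1 - j)" using rev_nth[OF j] by simp
    also have "\<dots> = ds ! j" using assms(1) j unfolding symmetric_dims_def by (intro sym[of "ds ! j"]) blast
    finally show "rev ds ! j = ds ! j" .
  qed simp
  hence "take i ds = rev (drop (k - i) ds)" by (metis take_rev)
  hence "block_start ds i = sum_list (drop (k - i) ds)" by (simp add: block_start_def sum_list_rev)
  thus ?thesis unfolding block_start_def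
    by (metis add.commute append_take_drop_id sum_list_append)
qed

lemma symmetric_blk:
  assumes "symmetric_dims ds" "r < d"
  shows "blk ds (d - 1 - r) = k - 1 - blk ds r"
proof (rule blk_eqI)
  have b: "blk ds r < k" "block_start ds (blk ds r) \<le> r" "r < block_start ds (Suc (blk ds r))"
    using blk_bounds[OF assms(2)] by auto
  have e: "k - blk ds r = Suc (k - 1 - blk ds r)" "k - Suc (blk ds r) = k - 1 - blk ds r"
    using b(1) by auto
  have "block_start ds (Suc (blk ds r)) + block_start ds (k - 1 - blk ds r) = d"
    using symmetric_block_start[OF assms(1), of "Suc (blk ds r)"] b(1) unfolding e by simp
  thus "block_start ds (k - 1 - blk ds r) \<le> d - 1 - r" using b(3) by linarith
  have "block_start ds (blk ds r) + block_start ds (Suc (k - 1 - blk ds r)) = d"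
    using symmetric_block_start[OF assms(1), of "blk ds r"] b(1) unfolding e by simp
  thus "d - 1 - r < block_start ds (Suc (k - 1 - blk ds r))" using b(2) assms(2) by linarith
qed

lemma palindrome_blk:
  assumes "rev (map W [0..<d - 1]) = map W [0..<d - 1]"
  shows "r < d \<Longrightarrow> blk ds (d - 1 - r) = k - 1 - blk ds r"
proof (induction r)
  case 0
  show ?case using blk_last by simp
next
  case (Suc r)
  have l: "d - 1 - r = Suc (d - 1 - Suc r)" "d - 1 - Suc r < d - 1" using Suc.prems by auto
  let ?w = "map W [0..<d - 1]"
  have "?w ! (d - 1 - Suc r) = rev ?w ! (d - 1 - Suc r)" using assms by simp
  also have "\<dots> = ?w ! (length ?w - Suc (d - 1 - Suc r))" by (rule rev_nth) (use l in simp)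
  also have "length ?w - Suc (d - 1 - Suc r) = r"
    using Suc.prems by (simp only: length_map length_upt)
  finally have W: "W (d - 1 - Suc r) = W r" using Suc.prems l by simp
  have "blk ds (d - 1 - r) = blk ds (d - 1 - Suc r) + of_bool (W r)"
    unfolding l(1) using l Suc.prems W by (subst blk_Suc) auto
  moreover have "blk ds (Suc r) = blk ds r + of_bool (W r)" by (rule blk_Suc[OF Suc.prems])
  ultimately show ?case using Suc by simp
qed

lemma palindrome_symmetric:
  assumes "rev (map W [0..<d - 1]) = map W [0..<d - 1]"
  shows "symmetric_dims ds"
  unfolding symmetric_dims_def
proof (intro allI impI)
  fix i assume i: "i < k"
  have "bij_betw (\<lambda>r. d - 1 - r) {r. r < d \<and> blk ds r = i} {r. r < d \<and> blk ds r = k - 1 - i}"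
  proof (rule bij_betwI[where g = "\<lambda>r. d - 1 - r"])
    show "(\<lambda>r. d - 1 - r) \<in> {r. r < d \<and> blk ds r = i} \<rightarrow> {r. r < d \<and> blk ds r = k - 1 - i}"
      using palindrome_blk[OF assms] by auto
    show "(\<lambda>r. d - 1 - r) \<in> {r. r < d \<and> blk ds r = k - 1 - i} \<rightarrow> {r. r < d \<and> blk ds r = i}"
      using palindrome_blk[OF assms] i by auto
  qed auto
  hence "card {r. r < d \<and> blk ds r = i} = card {r. r < d \<and> blk ds r = k - 1 - i}"
    by (rule bij_betw_same_card)
  thus "ds ! i = ds ! (k - 1 - i)"
    using block_size_card[OF i] block_size_card[of "k - 1 - i"] i by simp
qed

text \<open>The blocks pair off around the middle one, whose parity therefore decides.\<close>

lemma symmetric_odd_sum: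
  assumes "symmetric_dims ds" "odd k"
  shows "odd d \<longleftrightarrow> odd (ds ! ((k - 1) div 2))"
proof -
  let ?m = "(k - 1) div 2"
  have m: "?m < k" "k - ?m = Suc ?m" using assms(2) len by (auto elim!: oddE)
  have "block_start ds ?m + block_start ds (Suc ?m) = d"
    using symmetric_block_start[OF assms(1), of ?m] m by simp
  thus ?thesis using block_start_Suc[OF m(1)] by presburger
qed

lemma D_superdiagonal: "Suc r < d \<Longrightarrow> D_mat ds $$ (r, Suc r) = (if W r then 0 else 1 :: 'a :: field)"
  by (simp add: D_mat_entry W_def)

lemma D_strict_upper:
  "i < d \<Longrightarrow> j < d \<Longrightarrow> D_mat ds $$ (i, j) \<noteq> (0 :: 'a :: field) \<Longrightarrow> i < j"
  by (simp add: D_mat_entry split: if_splits)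

lemma blk_less: "blk ds i < blk ds j \<Longrightarrow> i < d \<Longrightarrow> i < j"
  by (rule ccontr) (use blk_mono[of j i ds] in simp)

end

section \<open>Non-zero terms of the series from the superdiagonal\<close>

locale block_matrices = block_dims ds for ds :: "nat list" +
  fixes S :: "'a :: field_char_0 mat list"
  assumes seq: "block_seq ds S"
begin

abbreviation "D \<equiv> D_mat ds :: 'a mat"
abbreviation "E \<equiv> E_mat ds S"
abbreviation "L \<equiv> n_alg ds S"

lemma E_entry:
  "r < d \<Longrightarrow> c < d \<Longrightarrow> E $$ (r, c) = (if blk ds c = Suc (blk ds r)
    then S ! blk ds r $$ (r - block_start ds (blk ds r), c - block_start ds (blk ds c)) else 0)"
  using seq by (intro E_mat_entry) (auto simp: block_seq_def)

lemma E_nonzero: "i < d \<Longrightarrow> j < d \<Longrightarrow> E $$ (i, j) \<noteq> 0 \<Longrightarrow> blk ds j = Suc (blk ds i)"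
  by (simp add: E_entry split: if_splits)

lemma E_strict_upper: "i < d \<Longrightarrow> j < d \<Longrightarrow> E $$ (i, j) \<noteq> 0 \<Longrightarrow> i < j"
  using E_nonzero[of i j] blk_less[of i j] by simp

lemma E_superdiagonal_corner:
  assumes "Suc r < d" "W r"
  shows "E $$ (r, Suc r) = S ! blk ds r $$ (ds ! blk ds r - 1, 0)"
proof -
  have e: "Suc r = block_start ds (Suc (blk ds r))" "blk ds (Suc r) = Suc (blk ds r)"
    using blk_Suc_cases[OF assms(1)] assms(2) unfolding W_def by auto
  have "blk ds r < k" using blk_bounds[of r ds] assms(1) by simp
  hence "r - block_start ds (blk ds r) = ds ! blk ds r - 1"
    using e(1) block_start_Suc[of "blk ds r" ds] by simp
  thus ?thesis using E_entry[of r "Suc r"] e assms(1) by simp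
qed

lemma E_superdiagonal_nonzero:
  assumes "Suc r < d"
  shows "E $$ (r, Suc r) \<noteq> 0 \<longleftrightarrow> W r"
proof
  show "W r" if "E $$ (r, Suc r) \<noteq> 0"
    using E_nonzero[of r "Suc r"] that assms unfolding W_def by simp
  assume W: "W r"
  have "Suc (blk ds r) < k" using blk_Suc[OF assms] W blk_bounds[OF assms] by simp
  thus "E $$ (r, Suc r) \<noteq> 0"
    unfolding E_superdiagonal_corner[OF assms W] using seq unfolding block_seq_def by simp
qed

lemma word_mat_interval:
  assumes "i + length u < d"
  shows "word_mat d D E u $$ (i, i + length u) \<noteq> 0 \<longleftrightarrow> u = map W [i..<i + length u]"
proof -
  have "word_mat d D E u $$ (i, i + length u) =
      (\<Prod>m<length u. (if u ! m then E else D) $$ (i + m, Suc (i + m)))"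
    by (rule word_mat_superdiagonal) (use assms D_strict_upper E_strict_upper in auto)
  hence "word_mat d D E u $$ (i, i + length u) \<noteq> 0 \<longleftrightarrow>
      (\<forall>m\<in>{..<length u}. (if u ! m then E else D) $$ (i + m, Suc (i + m)) \<noteq> 0)" by simp
  also have "\<dots> \<longleftrightarrow> (\<forall>m\<in>{..<length u}. u ! m = W (i + m))"
  proof (intro ball_cong refl)
    fix m assume "m \<in> {..<length u}"
    hence "Suc (i + m) < d" using assms by simp
    thus "((if u ! m then E else D) $$ (i + m, Suc (i + m)) \<noteq> 0) = (u ! m = W (i + m))"
      using E_superdiagonal_nonzero[of "i + m"] D_superdiagonal[of "i + m", where 'a = 'a] by simp
  qed
  also have "\<dots> \<longleftrightarrow> u = map W [i..<i + length u]"
  proof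
    assume a: "\<forall>m\<in>{..<length u}. u ! m = W (i + m)"
    show "u = map W [i..<i + length u]" by (rule nth_equalityI) (use a in simp_all)
  next
    assume b: "u = map W [i..<i + length u]"
    show "\<forall>m\<in>{..<length u}. u ! m = W (i + m)"
    proof
      fix m assume "m \<in> {..<length u}"
      hence "map W [i..<i + length u] ! m = W (i + m)" by simp
      with b show "u ! m = W (i + m)" by (rule trans[OF arg_cong[of _ _ "\<lambda>v. v ! m"]])
    qed
  qed
  finally show ?thesis .
qed

lemma L_subalgebra: "lie_subalgebra d L"
  and E_in_L: "E \<in> L"
  and D_derivation: "A \<in> L \<Longrightarrow> lie_bracket D A \<in> L"
  unfolding n_alg_def
  using lie_generated_subalgebra(1)[OF lie_generated_ad_stable(1)[OF D_mat_carrier E_mat_carrier]]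
    lie_generated_ad_stable(2,3)[OF D_mat_carrier E_mat_carrier] by blast+

lemma lower_central_nonzeroI:
  assumes "count (mset z) True = Suc n" "i < d" "j < d" "word_bracket d D E z $$ (i, j) \<noteq> 0"
  shows "lower_central d L n \<noteq> {0\<^sub>m d d}"
proof
  assume "lower_central d L n = {0\<^sub>m d d}"
  moreover have "word_bracket d D E z \<in> lower_central d L n"
    by (rule word_bracket_lower_central[OF L_subalgebra _ E_in_L D_derivation assms(1)]) simp_all
  ultimately show False using assms by simp
qed

lemma interval_bracket_nonzero:
  assumes il: "i + l < d" and "\<not> excluded (map W [i..<i + l])"
  shows "\<exists>z. mset z = mset (map W [i..<i + l]) \<and> word_bracket d D E z $$ (i, i + l) \<noteq> 0"
proof -
  let ?w = "map W [i..<i + l]"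
  obtain z where z: "coef z ?w \<noteq> (0 :: 'a)" using exists_coef_nonzero[OF assms(2), where 'a = 'a] by blast
  have m: "mset ?w = mset z" by (rule coef_mset[OF z])
  have "word_bracket d D E z $$ (i, i + l) = bracket_eval z (\<lambda>u. word_mat d D E u $$ (i, i + l))"
    by (rule word_bracket_entry) (use il in auto)
  also have "\<dots> = word_mat d D E ?w $$ (i, i + l) * coef z ?w"
  proof (rule bracket_eval_single)
    fix u assume "mset u = mset z" and nz: "word_mat d D E u $$ (i, i + l) \<noteq> 0"
    hence "mset u = mset ?w" using m by simp
    hence "length u = length ?w" by (rule mset_eq_length)
    hence lu: "length u = l" by simp
    show "u = ?w" using word_mat_interval[of i u] nz il unfolding lu by blast
  qed
  also have "\<dots> \<noteq> 0" using z word_mat_interval[of i ?w] il by simp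
  finally show ?thesis using m by metis
qed

text \<open>Proper intervals of the superdiagonal settle the case of large end blocks and the lower
  bound in the exceptional case.\<close>

lemma lower_central_nonzero_interval:
  assumes "i + l < d" "\<not> excluded (map W [i..<i + l])" "blk ds (i + l) = blk ds i + Suc n"
  shows "lower_central d L n \<noteq> {0\<^sub>m d d}"
proof -
  obtain z where z: "mset z = mset (map W [i..<i + l])" "word_bracket d D E z $$ (i, i + l) \<noteq> 0"
    using interval_bracket_nonzero[OF assms(1,2)] by blast
  have "count (mset z) True = Suc n" using blk_add[OF assms(1)] assms(3) z(1) by simp
  thus ?thesis by (rule lower_central_nonzeroI[OF _ _ _ z(2)]) (use assms(1) in auto)
qed

end

lemma excluded_rev: "excluded (rev w) \<longleftrightarrow> excluded w"
proof -
  have 1: "rev w = replicate n x \<longleftrightarrow> w = replicate n x" for n x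
    by (metis rev_replicate rev_rev_ident)
  have 2: "rev (rev w) = rev w \<longleftrightarrow> rev w = w" by (metis rev_rev_ident)
  show ?thesis unfolding excluded_def 1 2 length_rev ..
qed

lemma phi_add:
  "A \<in> carrier_mat d d \<Longrightarrow> B \<in> carrier_mat d d \<Longrightarrow> phi d (A + B) = phi d A + phi d B"
  by (rule eq_matI) (auto simp: phi_def distrib_left)

lemma phi_smult: "A \<in> carrier_mat d d \<Longrightarrow> phi d (c \<cdot>\<^sub>m A) = c \<cdot>\<^sub>m phi d A"
  by (rule eq_matI) (auto simp: phi_def)

lemma phi_zero: "phi d (0\<^sub>m d d) = 0\<^sub>m d d"
  by (rule eq_matI) (auto simp: phi_def)

lemma lie_dim_line:
  fixes A :: "'a :: field mat"
  assumes A: "A \<in> carrier_mat d d" "A \<noteq> 0\<^sub>m d d"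
  shows "lie_dim d (range (\<lambda>c. c \<cdot>\<^sub>m A)) = 1"
proof -
  let ?N = "range (\<lambda>c. c \<cdot>\<^sub>m A)" and ?V = "gl TYPE('a) d"
  interpret V: vectorspace class_ring ?V by (rule vectorspace_module_mat)
  have sub: "VectorSpace.subspace class_ring ?N ?V" by (rule smult_line_subspace[OF A(1)])
  interpret W: vectorspace class_ring "?V\<lparr>carrier := ?N\<rparr>" by (rule V.subspace_is_vs[OF sub])
  have "1 \<cdot>\<^sub>m A = A" using A by (intro eq_matI) auto
  hence AN: "A \<in> ?N" by (metis rangeI)
  have "W.span {A} \<subseteq> ?N" using W.span_is_subset2[of "{A}"] AN by simp
  moreover have "c \<cdot>\<^sub>m A \<in> W.span {A}" for c
  proof -
    have "submodule class_ring (W.span {A}) (?V\<lparr>carrier := ?N\<rparr>)"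
      using AN by (intro W.span_is_submodule) simp
    moreover have "A \<in> W.span {A}" using W.in_own_span[of "{A}"] AN by simp
    ultimately have "c \<odot>\<^bsub>?V\<lparr>carrier := ?N\<rparr>\<^esub> A \<in> W.span {A}"
      by (intro LinearCombinations.submodule.smult_closed) (auto simp: class_ring_simps)
    thus ?thesis by (simp add: module_mat_simps)
  qed
  ultimately have "W.span {A} = ?N" by blast
  hence "W.dim = 1" using A AN by (intro W.dim1I[of A]) (auto simp: module_mat_simps)
  thus ?thesis unfolding lie_dim_def .
qed

section \<open>Block filtration, upper bounds and the choice of intervals\<close>

context block_dims
begin

lemma ds_nonempty [simp]: "ds \<noteq> []"
  using len by auto

text \<open>A filtration by block distance at least \<open>j\<close>, rather than the grading by
  exact distance, already gives the upper bounds: distances add under products, and distance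
  \<open>k\<close> is impossible.\<close>

definition block_filtered :: "nat \<Rightarrow> 'a :: field mat set" where
  "block_filtered j = {A \<in> carrier_mat d d.
     \<forall>r<d. \<forall>c<d. A $$ (r, c) \<noteq> 0 \<longrightarrow> blk ds r + j \<le> blk ds c}"

lemma block_filtered_carrier: "A \<in> block_filtered j \<Longrightarrow> A \<in> carrier_mat d d"
  by (simp add: block_filtered_def)

lemma block_filtered_subspace:
  "VectorSpace.subspace class_ring (block_filtered j) (gl TYPE('a :: field) d)"
  unfolding subspace_gl_iff
proof (intro conjI ballI allI)
  fix A B :: "'a mat" assume AB: "A \<in> block_filtered j" "B \<in> block_filtered j"
  have "blk ds r + j \<le> blk ds c" if rc: "r < d" "c < d" and nz: "(A + B) $$ (r, c) \<noteq> 0" for r c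
  proof -
    have "(A + B) $$ (r, c) = A $$ (r, c) + B $$ (r, c)"
      using block_filtered_carrier[OF AB(2)] rc by simp
    hence "A $$ (r, c) \<noteq> 0 \<or> B $$ (r, c) \<noteq> 0" using nz by auto
    thus ?thesis using AB rc unfolding block_filtered_def by blast
  qed
  thus "A + B \<in> block_filtered j" using AB unfolding block_filtered_def by simp
qed (auto simp: block_filtered_def)

lemma block_filtered_mult:
  fixes A B :: "'a :: field mat"
  assumes "A \<in> block_filtered i" "B \<in> block_filtered j"
  shows "A * B \<in> block_filtered (i + j)"
proof -
  have car: "A \<in> carrier_mat d d" "B \<in> carrier_mat d d" using assms block_filtered_carrier by blast+
  have "blk ds r + (i + j) \<le> blk ds c" if rc: "r < d" "c < d" and nz: "(A * B) $$ (r, c) \<noteq> 0" for r c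
  proof -
    have "(A * B) $$ (r, c) = (\<Sum>l<d. A $$ (r, l) * B $$ (l, c))"
      using car rc by (simp add: scalar_prod_def atLeast0LessThan)
    then obtain l where "l < d" "A $$ (r, l) * B $$ (l, c) \<noteq> 0"
      using nz by (metis (no_types, lifting) lessThan_iff sum.neutral)
    hence "blk ds r + i \<le> blk ds l" "blk ds l + j \<le> blk ds c"
      using assms rc unfolding block_filtered_def by auto
    thus ?thesis by simp
  qed
  thus ?thesis using car unfolding block_filtered_def by simp
qed

lemma block_filtered_bracket:
  fixes A B :: "'a :: field mat"
  assumes "A \<in> block_filtered i" "B \<in> block_filtered j"
  shows "lie_bracket A B \<in> block_filtered (i + j)"
proof -
  have sub: "X \<in> block_filtered n \<Longrightarrow> Y \<in> block_filtered n \<Longrightarrow> X + Y \<in> block_filtered n"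
    "X \<in> block_filtered n \<Longrightarrow> c \<cdot>\<^sub>m X \<in> block_filtered n" for X Y :: "'a mat" and c n
    using block_filtered_subspace[of n, where 'a = 'a] unfolding subspace_gl_iff by blast+
  have car: "A \<in> carrier_mat d d" "B \<in> carrier_mat d d" using assms block_filtered_carrier by blast+
  have "lie_bracket A B = A * B + (-1) \<cdot>\<^sub>m (B * A)"
    unfolding lie_bracket_def using car by (intro eq_matI) auto
  moreover have "A * B \<in> block_filtered (i + j)" "B * A \<in> block_filtered (i + j)"
    using block_filtered_mult[OF assms] block_filtered_mult[OF assms(2,1)] by (simp_all add: add.commute)
  ultimately show ?thesis using sub by simp
qed

lemma block_filtered_mono: "i \<le> j \<Longrightarrow> block_filtered j \<subseteq> block_filtered i"
  unfolding block_filtered_def by fastforce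

lemma block_filtered_D: "D_mat ds \<in> block_filtered 0"
  unfolding block_filtered_def by (auto simp: D_mat_entry split: if_splits)

lemma block_filtered_k: "block_filtered k = {0\<^sub>m d d :: 'a :: field mat}"
proof
  show "{0\<^sub>m d d} \<subseteq> (block_filtered k :: 'a mat set)"
    using block_filtered_subspace[of k, where 'a = 'a] unfolding subspace_gl_iff by blast
  show "block_filtered k \<subseteq> {0\<^sub>m d d :: 'a mat}"
  proof
    fix A :: "'a mat" assume A: "A \<in> block_filtered k"
    have "A $$ (r, c) = 0" if "r < d" "c < d" for r c
      using A that blk_bounds[of c ds] unfolding block_filtered_def by fastforce
    thus "A \<in> {0\<^sub>m d d}" using block_filtered_carrier[OF A] by (intro singletonI[THEN back_subst[of "\<lambda>X. X \<in> _"]]) (auto intro: eq_matI)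
  qed
qed

text \<open>Reflection permutes the blocks, and on the first superdiagonal, where
  \<open>i + j\<close> is odd, the sign in phi is +1.\<close>

lemma phi_D:
  assumes "symmetric_dims ds"
  shows "phi d (D_mat ds) = (D_mat ds :: 'a :: field mat)"
proof (rule eq_matI)
  fix i j assume "i < dim_row (D_mat ds :: 'a mat)" "j < dim_col (D_mat ds :: 'a mat)"
  hence ij: "i < d" "j < d" using carrier_matD[OF D_mat_carrier[of ds, where 'a = 'a]] by auto
  have l: "d - 1 - i < d" "d - 1 - j < d" using ij by auto
  have b: "blk ds i < k" "blk ds j < k" using ij blk_bounds by blast+
  have c: "d - 1 - i = Suc (d - 1 - j) \<longleftrightarrow> j = Suc i" using ij by arith
  have e: "blk ds (d - 1 - j) = blk ds (d - 1 - i) \<longleftrightarrow> blk ds i = blk ds j"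
    unfolding symmetric_blk[OF assms ij(1)] symmetric_blk[OF assms ij(2)] using b by arith
  show "phi d (D_mat ds) $$ (i, j) = (D_mat ds :: 'a mat) $$ (i, j)"
    unfolding phi_entry[OF ij] D_mat_entry[OF l(2,1)] D_mat_entry[OF ij] c e
    by (simp add: power_add[symmetric] mult_2[symmetric] power_mult)
qed (use carrier_matD[OF D_mat_carrier[of ds, where 'a = 'a]]
    carrier_matD[OF phi_carrier[of d "D_mat ds :: 'a mat"]] in simp_all)

lemma all_ones_blk:
  assumes "all_ones_dims ds"
  shows "r < d \<Longrightarrow> blk ds r = r"
proof -
  have s: "block_start ds i = i" if "i \<le> k" for i
    using that
  proof (induction i)
    case (Suc i)
    thus ?case using block_start_Suc[of i ds] assms unfolding all_ones_dims_def by simp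
  qed simp
  assume "r < d"
  moreover have "d = k" using s[of k] by simp
  ultimately show ?thesis using s by (intro blk_eqI) auto
qed

end

context block_matrices
begin

lemma E_filtered: "E \<in> block_filtered 1"
  unfolding block_filtered_def using E_nonzero by simp

lemma lower_central_k: "lower_central d L (k - 1) = {0\<^sub>m d d}"
proof -
  have "(lie_bracket D ^^ l) E \<in> block_filtered 1" for l
  proof (induction l)
    case (Suc l)
    thus ?case using block_filtered_bracket[OF block_filtered_D Suc] by simp
  qed (use E_filtered in simp)
  hence "lower_central d L (k - 1) \<subseteq> block_filtered (Suc (k - 1))"
    unfolding n_alg_def
    using block_filtered_bracket[of _ 1]
    by (intro lower_central_generated_subset block_filtered_subspace block_filtered_mono) auto
  also have "Suc (k - 1) = k" using len by simp
  finally show ?thesis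
    using block_filtered_k[where 'a = 'a] lower_central_subset_subspace(1)[OF L_subalgebra, of "k - 1"]
    unfolding subspace_gl_iff by blast
qed

lemma lower_central_phi_invariant:
  assumes PQ: "P \<in> carrier_mat d d" "Q \<in> carrier_mat d d" "Q * P = 1\<^sub>m d" "P * D * Q = D"
    and T: "P * E * Q \<in> block_filtered 1" "phi d (P * E * Q) = P * E * Q"
    and sym: "symmetric_dims ds" and d: "odd d" and ends: "ds ! 0 = 1" "ds ! (k - 1) = 1"
    and k: "k > 2"
  shows "lower_central d L (k - 2) = {0\<^sub>m d d}"
proof -
  define c where "c A = P * A * Q" for A :: "'a mat"
  have c [simp]: "c A \<in> carrier_mat d d" if "A \<in> carrier_mat d d" for A
    unfolding c_def using PQ that by simp
  have c_br: "c (lie_bracket A B) = lie_bracket (c A) (c B)"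
    if "A \<in> carrier_mat d d" "B \<in> carrier_mat d d" for A B
    unfolding c_def by (rule conj_lie_bracket[OF PQ(1-3) that])
  have c_add: "c (A + B) = c A + c B" if A: "A \<in> carrier_mat d d" and B: "B \<in> carrier_mat d d" for A B
  proof -
    have "P * (A + B) = P * A + P * B" by (rule mult_add_distrib_mat[OF PQ(1) A B])
    moreover have "(P * A + P * B) * Q = P * A * Q + P * B * Q"
      by (rule add_mult_distrib_mat) (use PQ A B in auto)
    ultimately show ?thesis unfolding c_def by simp
  qed
  have c_smult: "c (a \<cdot>\<^sub>m A) = a \<cdot>\<^sub>m c A" if A: "A \<in> carrier_mat d d" for a A
  proof -
    have "P * (a \<cdot>\<^sub>m A) = a \<cdot>\<^sub>m (P * A)" by (rule mult_smult_distrib[OF PQ(1) A])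
    moreover have "a \<cdot>\<^sub>m (P * A) * Q = a \<cdot>\<^sub>m (P * A * Q)"
      by (rule mult_smult_assoc_mat) (use PQ A in auto)
    ultimately show ?thesis unfolding c_def by simp
  qed
  have c_zero: "c (0\<^sub>m d d) = 0\<^sub>m d d" unfolding c_def using PQ by simp
  \<comment> \<open>The invariance is known for E(T) but the series belongs to \<open>S\<close>, so
    the filtration by phi-fixed matrices is pulled back along conjugation by
    \<open>P\<close>.\<close>
  define N where "N j = {A \<in> carrier_mat d d. c A \<in> block_filtered j \<and> phi d (c A) = c A}" for j
  have sub: "VectorSpace.subspace class_ring (N j) (gl TYPE('a) d)" for j
  proof -
    have F: "0\<^sub>m d d \<in> (block_filtered j :: 'a mat set)"
      "\<And>A B :: 'a mat. A \<in> block_filtered j \<Longrightarrow> B \<in> block_filtered j \<Longrightarrow> A + B \<in> block_filtered j"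
      "\<And>a. \<And>A :: 'a mat. A \<in> block_filtered j \<Longrightarrow> a \<cdot>\<^sub>m A \<in> block_filtered j"
      using block_filtered_subspace[of j, where 'a = 'a] unfolding subspace_gl_iff by blast+
    show ?thesis unfolding subspace_gl_iff N_def
      using F by (auto simp: c_add c_smult c_zero phi_add phi_smult phi_zero)
  qed
  \<comment> \<open>The degree \<open>i\<close> is left open to cover \<open>D\<close> with
    \<open>i = 0\<close> and the elements of \<open>N 1\<close> with \<open>i = 1\<close>.\<close>
  have br: "lie_bracket A B \<in> N (i + j)"
    if A: "A \<in> carrier_mat d d" "c A \<in> block_filtered i" "phi d (c A) = c A" and B: "B \<in> N j" for A B i j
    using A B block_filtered_bracket[of "c A" i "c B" j] unfolding N_def
    by (simp add: c_br phi_lie_bracket)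
  have cD: "c D = D" unfolding c_def by (rule PQ(4))
  have gen: "(lie_bracket D ^^ l) E \<in> N 1" for l
  proof (induction l)
    case 0
    show ?case using T unfolding N_def c_def by simp
  next
    case (Suc l)
    have "lie_bracket D ((lie_bracket D ^^ l) E) \<in> N (0 + 1)"
      by (rule br[OF _ _ _ Suc]) (simp_all add: cD phi_D[OF sym] block_filtered_D)
    thus ?case by simp
  qed
  have "lower_central d L (k - 2) \<subseteq> N (Suc (k - 2))"
    unfolding n_alg_def
  proof (rule lower_central_generated_subset[OF sub])
    show "N 2 \<subseteq> N 1" using block_filtered_mono[of 1 2] unfolding N_def by auto
    show "lie_bracket A B \<in> N (Suc j)" if "A \<in> N 1" "B \<in> N j" for A B j
      using br[of A 1 B j] that unfolding N_def by simp
  qed (use gen in blast)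
  moreover have "Suc (k - 2) = k - 1" using k by simp
  moreover have "A = 0\<^sub>m d d" if A: "A \<in> N (k - 1)" for A
  proof -
    have cA: "c A \<in> carrier_mat d d" "c A \<in> block_filtered (k - 1)" "phi d (c A) = c A"
      and Ac: "A \<in> carrier_mat d d"
      using A unfolding N_def by auto
    have "c A $$ (r, s) = 0" if rs: "r < d" "s < d" for r s
    proof (rule ccontr)
      assume nz: "c A $$ (r, s) \<noteq> 0"
      have "blk ds r + (k - 1) \<le> blk ds s" using cA(2) rs nz unfolding block_filtered_def by blast
      hence b: "blk ds r = 0" "blk ds s = k - 1" using blk_bounds[OF rs(2)] by auto
      have "r < block_start ds 1" using blk_bounds[OF rs(1)] b by simp
      hence r: "r = 0" using block_start_Suc[of 0 ds] ends(1) len by simp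
      have "block_start ds (k - 1) \<le> s" using blk_bounds[OF rs(2)] b by simp
      hence s: "s = d - 1" using block_start_last ends(2) rs(2) by simp
      have "c A $$ (r, s) = phi d (c A) $$ (r, s)" using cA(3) by simp
      also have "\<dots> = - ((-1) ^ (r + s)) * c A $$ (r, s)"
        using phi_entry[OF rs, of "c A"] unfolding r s by simp
      also have "\<dots> = - c A $$ (r, s)" using d unfolding r s by simp
      finally have "c A $$ (r, s) = 0" by simp
      with nz show False by simp
    qed
    hence z: "c A = 0\<^sub>m d d" using cA(1) by (intro eq_matI) auto
    have a: "U * V * X = U * (V * X)"
      if "U \<in> carrier_mat d d" "V \<in> carrier_mat d d" "X \<in> carrier_mat d d" for U V X :: "'a mat"
      using that by (rule assoc_mult_mat)
    have "Q * c A * P = (Q * P) * A * (Q * P)"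
      unfolding c_def using PQ(1,2) Ac by (simp add: a)
    also have "\<dots> = A" unfolding PQ(3) using Ac by simp
    finally show ?thesis using PQ(1,2) unfolding z by simp
  qed
  ultimately show ?thesis
    using lower_central_subset_subspace(1)[OF L_subalgebra, of "k - 2"]
    unfolding subspace_gl_iff by (metis (no_types, lifting) insertI1 singletonD subsetD subsetI subset_antisym singletonI)
qed

text \<open>The interval runs from the last but one row of the first block to the first row of the
  last block. Its word is False followed by a word with True at both ends, and it still crosses all
  \<open>k - 1\<close> boundaries.\<close>

lemma lower_central_nonzero_first:
  assumes "ds ! 0 > 1"
  shows "lower_central d L (k - 2) \<noteq> {0\<^sub>m d d}"
proof -
  define i where "i = ds ! 0 - 2"
  define j where "j = block_start ds (k - 1)"
  have i1: "Suc (Suc i) = block_start ds 1" using assms block_start_Suc[of 0 ds] len by (simp add: i_def)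
  have k: "1 \<le> k - 1" "k - 1 < k" "0 < k" "Suc (k - 2) = k - 1" using len by linarith+
  have ij: "Suc (Suc i) \<le> j" using block_start_mono[OF k(1), of ds] i1 j_def by simp
  have jd: "j < d" using block_start_strict[OF k(2)] by (simp add: j_def)
  have bi: "blk ds i = 0" "blk ds (Suc i) = 0" using i1 by (auto intro!: blk_eqI)
  have "blk ds (Suc (Suc i)) = 1" unfolding i1 using blk_block_start[of 1] len by simp
  hence W: "\<not> W i" "W (Suc i)" using bi by (auto simp: W_def)
  have bj: "blk ds j = k - 1" unfolding j_def using blk_block_start k by simp
  have "W (j - 1)"
  proof (rule ccontr)
    assume "\<not> W (j - 1)"
    hence "blk ds (j - 1) = k - 1" using bj ij unfolding W_def by simp
    hence "j \<le> j - 1" using blk_bounds[of "j - 1" ds] jd by (simp add: j_def)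
    thus False using ij by simp
  qed
  define Y where "Y = map W [Suc i..<j]"
  have Y: "Y \<noteq> []" "hd Y = W (Suc i)" "last Y = W (j - 1)"
    using ij unfolding Y_def by (auto simp: hd_map last_map last_upt)
  have w: "map W [i..<i + (j - i)] = W i # Y" using ij unfolding Y_def by (simp add: upt_conv_Cons)
  have "\<not> excluded (W i # Y)" by (rule excluded_Cons_neq) (use Y W \<open>W (j - 1)\<close> in auto)
  thus ?thesis using w ij jd bi bj k
    by (intro lower_central_nonzero_interval[of i "j - i"]) auto
qed

text \<open>The mirror image: the interval reaches one row further into the last block, so the extra
  False stands at the end, and reversal brings it to the front.\<close>

lemma lower_central_nonzero_last:
  assumes "ds ! (k - 1) > 1"
  shows "lower_central d L (k - 2) \<noteq> {0\<^sub>m d d}"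
proof -
  define i where "i = ds ! 0 - 1"
  define j where "j = block_start ds (k - 1)"
  have i1: "Suc i = block_start ds 1" using pos[of 0] block_start_Suc[of 0 ds] len by (auto simp: i_def)
  have k: "1 \<le> k - 1" "k - 1 < k" "0 < k" "Suc (k - 2) = k - 1" using len by linarith+
  have ij: "Suc i \<le> j" using block_start_mono[OF k(1), of ds] i1 j_def by simp
  have jd: "Suc j < d" using block_start_last assms by (simp add: j_def)
  have bi: "blk ds i = 0" using i1 by (auto intro!: blk_eqI)
  have "blk ds (Suc i) = 1" unfolding i1 using blk_block_start[of 1] len by simp
  hence W: "W i" using bi by (auto simp: W_def)
  have bj: "blk ds j = k - 1" unfolding j_def using blk_block_start k by simp
  have bj': "blk ds (Suc j) = k - 1"
    by (rule blk_eqI) (use jd k in \<open>auto simp: j_def\<close>)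
  have Wj: "\<not> W j" using bj bj' by (simp add: W_def)
  have "W (j - 1)"
  proof (rule ccontr)
    assume "\<not> W (j - 1)"
    hence "blk ds (j - 1) = k - 1" using bj ij unfolding W_def by simp
    hence "j \<le> j - 1" using blk_bounds[of "j - 1" ds] jd by (simp add: j_def)
    thus False using ij by simp
  qed
  define Y where "Y = map W [i..<j]"
  have Y: "Y \<noteq> []" "hd Y = W i" "last Y = W (j - 1)"
    using ij unfolding Y_def by (auto simp: hd_map last_map last_upt)
  have w: "map W [i..<i + (Suc j - i)] = Y @ [W j]" using ij unfolding Y_def by simp
  have "\<not> excluded (W j # rev Y)"
    by (rule excluded_Cons_neq) (use Y W Wj \<open>W (j - 1)\<close> in \<open>auto simp: hd_rev last_rev\<close>)
  hence "\<not> excluded (rev (Y @ [W j]))" by simp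
  hence "\<not> excluded (Y @ [W j])" unfolding excluded_rev .
  thus ?thesis using w ij jd bi bj' k
    by (intro lower_central_nonzero_interval[of i "Suc j - i"]) auto
qed

text \<open>Dropping the first superdiagonal position loses one crossing. The remaining word has
  \<open>k - 2\<close> letters True, an odd number, and contains False because some inner block is
  larger than 1.\<close>

lemma lower_central_nonzero_inner:
  assumes ends: "ds ! 0 = 1" "ds ! (k - 1) = 1" and "\<not> all_ones_dims ds" and k: "odd k" "k > 2"
  shows "lower_central d L (k - 3) \<noteq> {0\<^sub>m d d}"
proof -
  have b1: "blk ds 1 = 1" using blk_block_start[of 1] block_start_Suc[of 0 ds] ends len by simp
  have "1 + (d - 2) = d - 1" using d_gt by linarith
  hence bl: "blk ds (1 + (d - 2)) = k - 1" using blk_last by (simp only:)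
  have l: "1 + (d - 2) < d" using d_gt by simp
  have n: "blk ds (1 + (d - 2)) = blk ds 1 + Suc (k - 3)" unfolding b1 bl using k by simp
  let ?w = "map W [1..<1 + (d - 2)]"
  have "count (mset ?w) True = Suc (k - 3)" using blk_add[OF l] n by linarith
  hence c: "odd (count (mset ?w) True)" using k by simp
  obtain i where i: "i < k" "ds ! i \<noteq> 1" using assms(3) unfolding all_ones_dims_def by blast
  have i0: "0 < i" "i < k - 1" using i ends by (metis gr0I, metis Suc_pred' i(1) less_SucE len less_le_trans zero_less_numeral)
  define r where "r = block_start ds i"
  have s: "r + ds ! i = block_start ds (Suc i)" "ds ! i > 1" "r > 0"
    using block_start_Suc[OF i(1)] pos[OF i(1)] i block_start_strict[OF i0(1)] by (auto simp: r_def)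
  have "block_start ds (Suc i) \<le> d - 1"
    using block_start_mono[of "Suc i" "k - 1" ds] i0 block_start_last ends(2) by simp
  hence r: "1 \<le> r" "r < 1 + (d - 2)" using s by auto
  have "blk ds r = i" "blk ds (Suc r) = i" using s by (auto intro!: blk_eqI simp: r_def)
  hence nW: "\<not> W r" by (simp add: W_def)
  have "W r \<in> set ?w" unfolding set_map by (rule imageI) (use r in auto)
  with nW have "False \<in> set ?w" by (simp only:)
  with c have "\<not> excluded ?w" by (rule not_excluded_odd)
  from lower_central_nonzero_interval[OF l this n] show ?thesis .
qed

text \<open>With blocks of size 1 the matrix D(0,0) is 0, so E(S) is the only non-zero
  generator.\<close>

lemma all_ones_case:
  assumes "all_ones_dims ds"
  shows "lie_dim d L = 1 \<and> lie_abelian d L"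
proof -
  have D0: "D = 0\<^sub>m d d"
    by (rule eq_matI) (use all_ones_blk[OF assms] in \<open>auto simp: D_mat_entry carrier_matD[OF D_mat_carrier[of ds, where 'a = 'a]]\<close>)
  have car: "E \<in> carrier_mat d d" by simp
  note carD = carrier_matD[OF car]
  let ?N = "range (\<lambda>c. c \<cdot>\<^sub>m E)"
  have ab: "lie_bracket X Y = 0\<^sub>m d d" if XY: "X \<in> ?N" "Y \<in> ?N" for X Y
  proof -
    from XY obtain a b where "X = a \<cdot>\<^sub>m E" "Y = b \<cdot>\<^sub>m E" by blast
    moreover have "lie_bracket E E = 0\<^sub>m d d" by (rule lie_bracket_self[OF car])
    moreover have "lie_bracket (a \<cdot>\<^sub>m E) E = (-1) \<cdot>\<^sub>m (a \<cdot>\<^sub>m lie_bracket E E)"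
      using lie_bracket_swap[of E d "a \<cdot>\<^sub>m E"] lie_bracket_smult_right[OF car car, of a] by simp
    ultimately show ?thesis
      using lie_bracket_smult_right[of "a \<cdot>\<^sub>m E" d E b] by simp
  qed
  have "E $$ (0, 1) \<noteq> 0"
    using E_superdiagonal_nonzero[of 0] d_gt all_ones_blk[OF assms, of 1] by (simp add: W_def)
  hence E0: "E \<noteq> 0\<^sub>m d d" using d_gt by auto
  have sub: "VectorSpace.subspace class_ring ?N (gl TYPE('a) d)" by (rule smult_line_subspace[OF car])
  hence zN: "0\<^sub>m d d \<in> ?N" unfolding subspace_gl_iff by blast
  have "lie_subalgebra d ?N" unfolding lie_subalgebra_def using sub ab zN by simp
  moreover have "(lie_bracket D ^^ l) E \<in> ?N" for l
  proof (cases l)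
    case 0
    have "E = 1 \<cdot>\<^sub>m E" using carD by (intro eq_matI) auto
    thus ?thesis using 0 by auto
  next
    case (Suc m)
    have "(lie_bracket D ^^ m) E \<in> carrier_mat d d" by (induction m) auto
    hence "lie_bracket D ((lie_bracket D ^^ m) E) = 0\<^sub>m d d"
      unfolding D0 lie_bracket_def by (intro eq_matI) auto
    thus ?thesis using Suc zN by simp
  qed
  ultimately have "L \<subseteq> ?N" unfolding n_alg_def by (intro lie_generated_minimal) auto
  moreover have "?N \<subseteq> L" using L_subalgebra E_in_L unfolding lie_subalgebra_iff by blast
  ultimately have L: "L = ?N" by blast
  show ?thesis unfolding L lie_abelian_def using lie_dim_line[OF car E0] ab by blast
qed

end

section \<open>The first diagonal on which E and phi(E) differ\<close>

lemma count_True_one_split: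
  assumes "count (mset w) True = 1"
  obtains p q where "w = replicate p False @ True # replicate q False"
proof -
  have "True \<in> set w" using assms by (metis count_mset_0_iff zero_neq_one)
  then obtain u v where w: "w = u @ True # v" by (meson split_list)
  have "count (mset u) True = 0" "count (mset v) True = 0" using assms unfolding w by auto
  hence uv: "True \<notin> set u" "True \<notin> set v" by (simp_all add: count_mset_0_iff)
  have "u = replicate (length u) False" "v = replicate (length v) False"
    using uv by (intro replicate_eqI; metis (full_types))+
  thus thesis using that[of "length u" "length v"] w by simp
qed

context block_dims
begin

text \<open>Here the exact value is wanted and not only whether it vanishes: in the comparison of
  two matrices the letters read off the superdiagonal must contribute a factor 1.\<close>

lemma word_mat_unit_superdiagonal:
  fixes E :: "'a :: field mat"
  assumes E: "E \<in> carrier_mat d d" "\<And>i j. i < d \<Longrightarrow> j < d \<Longrightarrow> E $$ (i, j) \<noteq> 0 \<Longrightarrow> i < j"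
    and sup: "\<And>r. Suc r < d \<Longrightarrow> E $$ (r, Suc r) = of_bool (W r)" and iu: "i + length u < d"
  shows "word_mat d (D_mat ds) E u $$ (i, i + length u) = of_bool (u = map W [i..<i + length u])"
proof -
  have "word_mat d (D_mat ds) E u $$ (i, i + length u) =
      (\<Prod>m<length u. (if u ! m then E else D_mat ds) $$ (i + m, Suc (i + m)))"
    by (rule word_mat_superdiagonal) (use iu D_strict_upper E in auto)
  also have "\<dots> = (\<Prod>m<length u. of_bool (u ! m = W (i + m)))"
  proof (rule prod.cong)
    fix m assume "m \<in> {..<length u}"
    hence "Suc (i + m) < d" using iu by simp
    thus "(if u ! m then E else D_mat ds) $$ (i + m, Suc (i + m)) = of_bool (u ! m = W (i + m))"
      using sup[of "i + m"] D_superdiagonal[of "i + m", where 'a = 'a] by simp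
  qed simp
  also have "\<dots> = of_bool (u = map W [i..<i + length u])"
  proof (cases "\<forall>m<length u. u ! m = W (i + m)")
    case True
    hence e: "u = map W [i..<i + length u]" by (intro nth_equalityI) simp_all
    have "(\<Prod>m<length u. of_bool (u ! m = W (i + m))) = (1 :: 'a)"
      using True by (intro prod.neutral) auto
    also have "1 = of_bool (u = map W [i..<i + length u])" unfolding eqTrueI[OF e] by simp
    finally show ?thesis .
  next
    case False
    then obtain m where m: "m < length u" "u ! m \<noteq> W (i + m)" by blast
    have "u \<noteq> map W [i..<i + length u]"
    proof
      assume e: "u = map W [i..<i + length u]"
      have "map W [i..<i + length u] ! m = W (i + m)" using m(1) by simp
      with e have "u ! m = W (i + m)" by (rule trans[OF arg_cong[of _ _ "\<lambda>v. v ! m"]])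
      with m(2) show False ..
    qed
    moreover have "(\<Prod>m<length u. of_bool (u ! m = W (i + m))) = (0 :: 'a)"
      using m by (intro prod_zero) auto
    ultimately show ?thesis by (simp only: of_bool_eq)
  qed
  finally show ?thesis .
qed

text \<open>A step longer than \<open>n\<close> and the other \<open>length u - 1\<close> steps
  together cover at least \<open>length u + n\<close>, so shorter distances cannot see the
  difference.\<close>

lemma word_mat_agree:
  fixes E E' :: "'a :: field mat"
  assumes E: "E \<in> carrier_mat d d" "\<And>i j. i < d \<Longrightarrow> j < d \<Longrightarrow> E $$ (i, j) \<noteq> 0 \<Longrightarrow> i < j"
    and E': "E' \<in> carrier_mat d d" "\<And>i j. i < d \<Longrightarrow> j < d \<Longrightarrow> E' $$ (i, j) \<noteq> 0 \<Longrightarrow> i < j"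
    and eq: "\<And>i j. i < d \<Longrightarrow> j < d \<Longrightarrow> j \<le> i + n \<Longrightarrow> E $$ (i, j) = E' $$ (i, j)"
  shows "i < d \<Longrightarrow> j < d \<Longrightarrow> j < i + length u + n \<Longrightarrow>
    word_mat d (D_mat ds) E u $$ (i, j) = word_mat d (D_mat ds) E' u $$ (i, j)"
proof (induction u arbitrary: i)
  case (Cons b u)
  let ?D = "D_mat ds :: 'a mat"
  let ?X = "if b then E else ?D" and ?X' = "if b then E' else ?D"
  have X: "?X \<in> carrier_mat d d" "?X' \<in> carrier_mat d d" using E(1) E'(1) by auto
  have M: "word_mat d ?D E u \<in> carrier_mat d d" "word_mat d ?D E' u \<in> carrier_mat d d"
    using E(1) E'(1) by auto
  have "word_mat d ?D E (b # u) $$ (i, j) = (\<Sum>l<d. ?X $$ (i, l) * word_mat d ?D E u $$ (l, j))"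
    using X(1) M(1) Cons.prems by (simp add: scalar_prod_def atLeast0LessThan)
  also have "\<dots> = (\<Sum>l<d. ?X' $$ (i, l) * word_mat d ?D E' u $$ (l, j))"
  proof (rule sum.cong)
    fix l assume "l \<in> {..<d}"
    hence l: "l < d" by simp
    show "?X $$ (i, l) * word_mat d ?D E u $$ (l, j) = ?X' $$ (i, l) * word_mat d ?D E' u $$ (l, j)"
    proof (cases "i < l")
      case False
      hence "?X $$ (i, l) = 0" "?X' $$ (i, l) = 0"
        using E(2)[OF Cons.prems(1) l] E'(2)[OF Cons.prems(1) l]
          D_strict_upper[OF Cons.prems(1) l, where 'a = 'a] by auto
      thus ?thesis by simp
    next
      case True
      hence M: "word_mat d ?D E u $$ (l, j) = word_mat d ?D E' u $$ (l, j)"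
        using Cons.prems l by (intro Cons.IH) auto
      show ?thesis
      proof (cases "l \<le> i + n")
        case True
        hence "?X $$ (i, l) = ?X' $$ (i, l)" using eq[OF Cons.prems(1) l] by simp
        thus ?thesis using M by simp
      next
        case False
        have "word_mat d ?D E' u $$ (l, j) = 0"
        proof (rule ccontr)
          assume "word_mat d ?D E' u $$ (l, j) \<noteq> 0"
          hence "l + length u \<le> j"
            using word_mat_strict_upper[OF D_mat_carrier D_strict_upper E'] l Cons.prems(2) by blast
          thus False using False Cons.prems(3) by simp
        qed
        thus ?thesis using M by simp
      qed
    qed
  qed simp
  also have "\<dots> = word_mat d ?D E' (b # u) $$ (i, j)"
    using X(2) M(2) Cons.prems by (simp add: scalar_prod_def atLeast0LessThan)
  finally show ?case .
qed simp

text \<open>Replacing \<open>E'\<close> by \<open>E\<close> in a single letter contributes to the entry on the diagonal at distance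
  \<open>length u + n\<close> only if all other letters are read off the first superdiagonal.\<close>

lemma word_mat_first_difference:
  fixes E E' :: "'a :: field mat"
  assumes E: "E \<in> carrier_mat d d" "\<And>i j. i < d \<Longrightarrow> j < d \<Longrightarrow> E $$ (i, j) \<noteq> 0 \<Longrightarrow> i < j"
    and E': "E' \<in> carrier_mat d d" "\<And>i j. i < d \<Longrightarrow> j < d \<Longrightarrow> E' $$ (i, j) \<noteq> 0 \<Longrightarrow> i < j"
    and sup: "\<And>r. Suc r < d \<Longrightarrow> E $$ (r, Suc r) = of_bool (W r)"
      "\<And>r. Suc r < d \<Longrightarrow> E' $$ (r, Suc r) = of_bool (W r)"
    and eq: "\<And>i j. i < d \<Longrightarrow> j < d \<Longrightarrow> j \<le> i + n \<Longrightarrow> E $$ (i, j) = E' $$ (i, j)"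
  shows "i + length u + n < d \<Longrightarrow>
    word_mat d (D_mat ds) E u $$ (i, i + length u + n) - word_mat d (D_mat ds) E' u $$ (i, i + length u + n) =
    (\<Sum>m<length u. if u ! m \<and> take m u = map W [i..<i + m] \<and>
        drop (Suc m) u = map W [i + m + n + 1..<i + length u + n]
      then E $$ (i + m, i + m + n + 1) - E' $$ (i + m, i + m + n + 1) else 0)"
proof (induction u arbitrary: i)
  case Nil
  show ?case by simp
next
  case (Cons b v)
  let ?D = "D_mat ds :: 'a mat"
  let ?X = "if b then E else ?D" and ?X' = "if b then E' else ?D"
  let ?M = "word_mat d ?D E v" and ?M' = "word_mat d ?D E' v"
  let ?j = "i + length (b # v) + n"
  have i: "i < d" and j: "?j < d" using Cons.prems by auto
  have X: "?X \<in> carrier_mat d d" "?X' \<in> carrier_mat d d" using E(1) E'(1) by auto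
  have M: "?M \<in> carrier_mat d d" "?M' \<in> carrier_mat d d" using E(1) E'(1) by auto
  have b1: "?X $$ (i, Suc i) = of_bool (b = W i)"
    using sup(1)[of i] D_superdiagonal[of i, where 'a = 'a] j by simp
  have e1: "word_mat d ?D E (b # v) $$ (i, ?j) = (\<Sum>l<d. ?X $$ (i, l) * ?M $$ (l, ?j))"
    using X(1) M(1) i j by (simp add: scalar_prod_def atLeast0LessThan)
  have e2: "word_mat d ?D E' (b # v) $$ (i, ?j) = (\<Sum>l<d. ?X' $$ (i, l) * ?M' $$ (l, ?j))"
    using X(2) M(2) i j by (simp add: scalar_prod_def atLeast0LessThan)
  \<comment> \<open>Telescoping: X M - X' M' = X (M - M') + (X - X') M'. In the first sum only the
    step to \<open>Suc i\<close> leaves enough room for a later difference; in the second only a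
    step of length \<open>n + 1\<close> survives.\<close>
  have "word_mat d ?D E (b # v) $$ (i, ?j) - word_mat d ?D E' (b # v) $$ (i, ?j) =
     (\<Sum>l<d. ?X $$ (i, l) * (?M $$ (l, ?j) - ?M' $$ (l, ?j)) + (?X $$ (i, l) - ?X' $$ (i, l)) * ?M' $$ (l, ?j))"
    unfolding e1 e2 sum_subtractf[symmetric] by (rule sum.cong) (auto simp: algebra_simps)
  also have "\<dots> = (\<Sum>l<d. ?X $$ (i, l) * (?M $$ (l, ?j) - ?M' $$ (l, ?j))) +
      (\<Sum>l<d. (?X $$ (i, l) - ?X' $$ (i, l)) * ?M' $$ (l, ?j))" by (rule sum.distrib)
  also have "(\<Sum>l<d. ?X $$ (i, l) * (?M $$ (l, ?j) - ?M' $$ (l, ?j))) =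
      (\<Sum>l\<in>{Suc i}. ?X $$ (i, l) * (?M $$ (l, ?j) - ?M' $$ (l, ?j)))"
  proof (rule sum.mono_neutral_right)
    show "\<forall>l\<in>{..<d} - {Suc i}. ?X $$ (i, l) * (?M $$ (l, ?j) - ?M' $$ (l, ?j)) = 0"
    proof
      fix l assume l: "l \<in> {..<d} - {Suc i}"
      show "?X $$ (i, l) * (?M $$ (l, ?j) - ?M' $$ (l, ?j)) = 0"
      proof (cases "i < l")
        case True
        hence "?M $$ (l, ?j) = ?M' $$ (l, ?j)"
          using l j by (intro word_mat_agree[OF E E' eq]) auto
        thus ?thesis by simp
      next
        case False
        hence "?X $$ (i, l) = 0" using E(2)[OF i, of l] D_strict_upper[OF i, of l, where 'a = 'a] l by auto
        thus ?thesis by simp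
      qed
    qed
  qed (use j in auto)
  also have "(\<Sum>l<d. (?X $$ (i, l) - ?X' $$ (i, l)) * ?M' $$ (l, ?j)) =
      (\<Sum>l\<in>{i + n + 1}. (?X $$ (i, l) - ?X' $$ (i, l)) * ?M' $$ (l, ?j))"
  proof (rule sum.mono_neutral_right)
    show "\<forall>l\<in>{..<d} - {i + n + 1}. (?X $$ (i, l) - ?X' $$ (i, l)) * ?M' $$ (l, ?j) = 0"
    proof
      fix l assume l: "l \<in> {..<d} - {i + n + 1}"
      show "(?X $$ (i, l) - ?X' $$ (i, l)) * ?M' $$ (l, ?j) = 0"
      proof (cases "l \<le> i + n")
        case True
        hence "?X $$ (i, l) = ?X' $$ (i, l)" using eq[OF i, of l] l by simp
        thus ?thesis by simp
      next
        case False
        have "?M' $$ (l, ?j) = 0"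
        proof (rule ccontr)
          assume "?M' $$ (l, ?j) \<noteq> 0"
          moreover have "l < d" using l by simp
          ultimately have "l + length v \<le> ?j"
            using word_mat_strict_upper[OF D_mat_carrier D_strict_upper E'] j by blast
          thus False using False l by simp
        qed
        thus ?thesis by simp
      qed
    qed
  qed (use j in auto)
  finally have main: "word_mat d ?D E (b # v) $$ (i, ?j) - word_mat d ?D E' (b # v) $$ (i, ?j) =
      ?X $$ (i, Suc i) * (?M $$ (Suc i, ?j) - ?M' $$ (Suc i, ?j)) +
      (?X $$ (i, i + n + 1) - ?X' $$ (i, i + n + 1)) * ?M' $$ (i + n + 1, ?j)" by simp
  let ?t = "\<lambda>u i m. if u ! m \<and> take m u = map W [i..<i + m] \<and>
        drop (Suc m) u = map W [i + m + n + 1..<i + length u + n]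
      then E $$ (i + m, i + m + n + 1) - E' $$ (i + m, i + m + n + 1) else 0"
  have IH: "?M $$ (Suc i, ?j) - ?M' $$ (Suc i, ?j) = (\<Sum>m<length v. ?t v (Suc i) m)"
    using Cons.IH[of "Suc i"] Cons.prems by simp
  have step: "?X $$ (i, Suc i) * ?t v (Suc i) m = ?t (b # v) i (Suc m)" for m
  proof -
    have "take (Suc m) (b # v) = map W [i..<i + Suc m] \<longleftrightarrow>
        b = W i \<and> take m v = map W [Suc i..<Suc i + m]"
      by (simp add: upt_conv_Cons del: upt_Suc)
    thus ?thesis unfolding b1 by (cases "b = W i") (simp_all del: upt_Suc)
  qed
  have "?M' $$ (i + n + 1, i + n + 1 + length v) = of_bool (v = map W [i + n + 1..<i + n + 1 + length v])"
    by (rule word_mat_unit_superdiagonal[OF E' sup(2)]) (use j in auto)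
  moreover have "i + n + 1 + length v = ?j" by simp
  ultimately have M': "?M' $$ (i + n + 1, ?j) = of_bool (v = map W [i + n + 1..<?j])" by (simp only:)
  have zero: "(?X $$ (i, i + n + 1) - ?X' $$ (i, i + n + 1)) * ?M' $$ (i + n + 1, ?j) = ?t (b # v) i 0"
    unfolding M' by (cases b; cases "v = map W [i + n + 1..<?j]") (simp_all del: upt_Suc)
  have "word_mat d ?D E (b # v) $$ (i, ?j) - word_mat d ?D E' (b # v) $$ (i, ?j) =
      (\<Sum>m<length v. ?t (b # v) i (Suc m)) + ?t (b # v) i 0"
    unfolding main IH sum_distrib_left zero step ..
  also have "\<dots> = (\<Sum>m<length (b # v). ?t (b # v) i m)"
    unfolding length_Cons sum.lessThan_Suc_shift by (rule add.commute)
  finally show ?case .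
qed

end

lemma upt_split: "i \<le> j \<Longrightarrow> j \<le> k \<Longrightarrow> [i..<k] = [i..<j] @ [j..<k]"
  using upt_add_eq_append[of i j "k - j"] by simp

context block_matrices
begin

lemma word_mat_grading:
  "i < d \<Longrightarrow> j < d \<Longrightarrow> word_mat d D E u $$ (i, j) \<noteq> 0 \<Longrightarrow>
    blk ds j = blk ds i + count (mset u) True"
proof (induction u arbitrary: i)
  case (Cons b u)
  let ?X = "if b then E else D"
  have car: "?X \<in> carrier_mat d d" "word_mat d D E u \<in> carrier_mat d d" by auto
  have "word_mat d D E (b # u) $$ (i, j) = (\<Sum>l<d. ?X $$ (i, l) * word_mat d D E u $$ (l, j))"
    using Cons.prems carrier_matD[OF car(1)] carrier_matD[OF car(2)]
    by (simp add: scalar_prod_def atLeast0LessThan)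
  then obtain l where l: "l < d" "?X $$ (i, l) * word_mat d D E u $$ (l, j) \<noteq> 0"
    using Cons.prems(3) by (metis (no_types, lifting) lessThan_iff sum.neutral)
  have "blk ds j = blk ds l + count (mset u) True" using l Cons by auto
  moreover have "blk ds l = blk ds i + of_bool b"
  proof (cases b)
    case True
    thus ?thesis using l E_nonzero[OF Cons.prems(1) l(1)] by simp
  next
    case False
    thus ?thesis using l Cons.prems(1) by (auto simp: D_mat_entry split: if_splits)
  qed
  ultimately show ?case by simp
qed (auto split: if_splits)

text \<open>The \<open>p\<close>-th row is the last row of its block, the block \<open>{Suc p..q + n}\<close> comes next, and column
  \<open>q + n + 1\<close> is the first one of the block after that: this is condition (ii) of the normalization.\<close>

lemma normalized_edge:
  assumes norm: "normalized ds S" and pq: "p < q" "q + n + 1 < d" and W: "W p" "W (q + n)"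
    and gap: "\<And>t. p < t \<Longrightarrow> t < q + n \<Longrightarrow> \<not> W t"
  shows "E $$ (p, p + n + 1) = E $$ (q, q + n + 1)"
proof -
  define b where "b = blk ds p"
  have p1: "Suc p = block_start ds (Suc b)" "blk ds (Suc p) = Suc b"
    using blk_Suc_cases[of p] W(1) pq unfolding W_def b_def by auto
  have const: "blk ds (Suc p + t) = Suc b" if "Suc p + t \<le> q + n" for t
    using that
  proof (induction t)
    case (Suc t)
    thus ?case using blk_Suc[of "Suc p + t"] gap[of "Suc p + t"] pq by simp
  qed (use p1 in simp)
  have bq: "blk ds q = Suc b" using const[of "q - Suc p"] pq by simp
  have bqn: "blk ds (q + n) = Suc b" using const[of "q + n - Suc p"] pq by simp
  have q1: "Suc (q + n) = block_start ds (Suc (Suc b))" "blk ds (Suc (q + n)) = Suc (Suc b)"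
    using blk_Suc_cases[of "q + n"] W(2) pq bqn unfolding W_def by auto
  have bk: "Suc (Suc b) < k" using q1(2) blk_bounds[of "Suc (q + n)" ds] pq by simp
  have size: "ds ! Suc b = q + n - p"
    using block_start_Suc[of "Suc b" ds] bk p1(1) q1(1) by simp
  have size0: "p - block_start ds b = ds ! b - 1"
    using block_start_Suc[of b ds] bk p1(1) by simp
  have "blk ds (p + n + 1) = Suc b" using const[of n] pq by simp
  hence "E $$ (p, p + n + 1) = S ! b $$ (ds ! b - 1, n)"
    using E_entry[of p "p + n + 1"] pq size0 p1(1)[symmetric] by (simp add: b_def)
  also have "\<dots> = S ! Suc b $$ (ds ! Suc b - 1 - n, 0)"
    using norm bk pq size unfolding normalized_def Let_def by simp
  also have "\<dots> = E $$ (q, q + n + 1)"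
    using E_entry[of q "q + n + 1"] pq bq q1 size p1(1)[symmetric] by simp
  finally show ?thesis .
qed

lemma normalized_superdiagonal:
  assumes "normalized ds S" "Suc r < d"
  shows "E $$ (r, Suc r) = of_bool (W r)"
proof (cases "W r")
  case True
  have "blk ds r + 1 < k" using blk_Suc[OF assms(2)] True blk_bounds[OF assms(2)] by simp
  thus ?thesis using E_superdiagonal_corner[OF assms(2) True] True assms(1)
    unfolding normalized_def Let_def by simp
next
  case False
  thus ?thesis using E_superdiagonal_nonzero[OF assms(2)] by simp
qed

text \<open>The function \<open>f\<close> of the proof compares the corner entries of the words in \<open>E\<close> with those of the
  words in \<open>\<phi> E\<close>; \<open>n + 1\<close> is the least distance from the diagonal at which \<open>E\<close> and \<open>\<phi> E\<close> differ.
  If all brackets vanished in the corner, so would \<open>f\<close> by \<open>shortened_palindrome_zero\<close>. But \<open>f\<close> is a positive multiple of a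
  non-zero entry of \<open>E - \<phi> E\<close> at one word, as by normalization all entries that contribute there agree.\<close>

lemma palindrome_bracket_nonzero:
  assumes norm: "normalized ds S" and pal: "rev (map W [0..<d - 1]) = map W [0..<d - 1]"
    and d: "odd d" and k: "odd k" and not_inv: "\<not> phi_invariant ds S"
  shows "\<exists>z. count (mset z) True = k - 1 \<and> word_bracket d D E z \<noteq> 0\<^sub>m d d"
proof (rule ccontr)
  assume no: "\<not> ?thesis"
  have sd: "symmetric_dims ds" by (rule palindrome_symmetric[OF pal])
  note sblk = symmetric_blk[OF sd]
  have Wsym: "W (d - 2 - r) = W r" if r: "r < d - 1" for r
  proof -
    let ?w = "map W [0..<d - 1]"
    have "W r = ?w ! r" using r by simp
    also have "\<dots> = rev ?w ! r" unfolding pal ..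
    also have "\<dots> = ?w ! (length ?w - Suc r)" by (rule rev_nth) (use r in simp)
    also have "\<dots> = W (d - 2 - r)"
    proof -
      have "length ?w - Suc r = d - 2 - r" "d - 2 - r < d - 1" using r by auto
      thus ?thesis by simp
    qed
    finally show ?thesis by simp
  qed
  define E' where "E' = phi d E"
  have E': "E' \<in> carrier_mat d d" by (simp add: E'_def)
  have E'_entry: "E' $$ (i, j) = - ((-1) ^ (i + j)) * E $$ (d - 1 - j, d - 1 - i)" if "i < d" "j < d" for i j
    unfolding E'_def by (rule phi_entry[OF that])
  have E'_shift: "E' $$ (i, i + n + 1) = (-1) ^ n * E $$ (d - 2 - n - i, d - 2 - n - i + n + 1)"
    if "i + n + 1 < d" for i n
  proof -
    have "d - 1 - (i + n + 1) = d - 2 - n - i" "d - 1 - i = d - 2 - n - i + n + 1" using that by auto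
    moreover have "(-1 :: 'a) ^ (i + (i + n + 1)) = - ((-1) ^ n)"
      by (cases "even n") auto
    ultimately show ?thesis using E'_entry[of i "i + n + 1"] that by simp
  qed
  have E'_nonzero: "blk ds j = Suc (blk ds i)" if ij: "i < d" "j < d" and nz: "E' $$ (i, j) \<noteq> 0" for i j
  proof -
    have "E $$ (d - 1 - j, d - 1 - i) \<noteq> 0" using nz E'_entry[OF ij] by auto
    hence "blk ds (d - 1 - i) = Suc (blk ds (d - 1 - j))" using ij by (intro E_nonzero) auto
    hence "k - 1 - blk ds i = Suc (k - 1 - blk ds j)" unfolding sblk[OF ij(1)] sblk[OF ij(2)] .
    thus ?thesis using blk_bounds[OF ij(1)] blk_bounds[OF ij(2)] by arith
  qed
  have E'_upper: "i < j" if "i < d" "j < d" "E' $$ (i, j) \<noteq> 0" for i j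
    using E'_nonzero[OF that] that blk_less[of i j] by simp
  have sup: "E $$ (r, Suc r) = of_bool (W r)" if "Suc r < d" for r
    by (rule normalized_superdiagonal[OF norm that])
  have sup': "E' $$ (r, Suc r) = of_bool (W r)" if r: "Suc r < d" for r
  proof -
    have "E' $$ (r, Suc r) = E $$ (d - 2 - r, Suc (d - 2 - r))" using E'_shift[of r 0] r by simp
    also have "\<dots> = of_bool (W (d - 2 - r))" by (rule sup) (use r in simp)
    also have "W (d - 2 - r) = W r" by (rule Wsym) (use r in simp)
    finally show ?thesis .
  qed
  define X where "X i j = E $$ (i, j) - E' $$ (i, j)" for i j
  have X_nonzero: "blk ds j = Suc (blk ds i)" if "i < d" "j < d" "X i j \<noteq> 0" for i j
    using that E_nonzero[of i j] E'_nonzero[of i j] unfolding X_def by (cases "E $$ (i, j) = 0") auto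
  \<comment> \<open>Normalization makes the first superdiagonal of \<open>E\<close> the indicator of
    \<open>W\<close>, and the symmetry of \<open>W\<close> does the same for phi(E); so the two
    differ further out.\<close>
  have X_gap: "i + 1 < j" if ij: "i < d" "j < d" and nz: "X i j \<noteq> 0" for i j
  proof (rule ccontr)
    assume n: "\<not> i + 1 < j"
    have "i < j" using X_nonzero[OF ij nz] blk_less[of i j] ij by simp
    hence "j = Suc i" using n by simp
    thus False using nz sup[of i] sup'[of i] ij unfolding X_def by simp
  qed
  let ?ex = "\<lambda>n. \<exists>r. r + n + 1 < d \<and> X r (r + n + 1) \<noteq> 0"
  have "\<exists>n. ?ex n"
  proof (rule ccontr)
    assume none: "\<not> ?thesis"
    have "X i j = 0" if ij: "i < d" "j < d" for i j
    proof (rule ccontr)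
      assume nz: "X i j \<noteq> 0"
      have "j = i + (j - i - 1) + 1" using X_gap[OF ij nz] by simp
      thus False using none nz ij by metis
    qed
    hence "E' = E" using E' by (intro eq_matI) (auto simp: X_def carrier_matD[OF E_mat_carrier[of ds S]])
    thus False using not_inv unfolding phi_invariant_def E'_def by simp
  qed
  define n where "n = (LEAST n. ?ex n)"
  have ex_n: "?ex n" unfolding n_def by (rule LeastI_ex) fact
  have n0: "n > 0"
  proof -
    obtain r where "r + n + 1 < d" "X r (r + n + 1) \<noteq> 0" using ex_n by blast
    thus ?thesis using X_gap[of r "r + n + 1"] by simp
  qed
  have eq: "E $$ (i, j) = E' $$ (i, j)" if ij: "i < d" "j < d" "j \<le> i + n" for i j
  proof (rule ccontr)
    assume "\<not> ?thesis"
    hence nz: "X i j \<noteq> 0" by (simp add: X_def)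
    have g: "i + 1 < j" by (rule X_gap[OF ij(1,2) nz])
    hence j: "j = i + (j - i - 1) + 1" by simp
    hence "?ex (j - i - 1)" using nz ij(2) by metis
    hence "n \<le> j - i - 1" unfolding n_def by (rule Least_le)
    thus False using g ij(3) by simp
  qed
  let ?w = "map W [0..<d - 1]"
  \<comment> \<open>The superdiagonal word with the \<open>n + 1\<close> letters from position
    \<open>m\<close> on contracted to one True.\<close>
  let ?u = "\<lambda>m. map W [0..<m] @ True # map W [m + n + 1..<d - 1]"
  define lam where "lam u = word_mat d D E u $$ (0, d - 1)" for u
  \<comment> \<open>By \<open>lam'\<close> below, the subtracted term is the corner entry for
    phi(E); the corner sign is +1 since \<open>d\<close> is odd. Only at length
    \<open>d - 1 - n\<close> is the difference of the two corner entries of first order in E -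
    phi(E).\<close>
  define f where "f u = (if length u = d - 1 - n then lam u - (-1) ^ length u * lam (rev u) else 0)" for u
  have d0: "0 < d" "d - 1 < d" using d_gt by auto
  have lam': "word_mat d D E' u $$ (0, d - 1) = (-1) ^ length u * lam (rev u)" for u
  proof -
    have "word_mat d (phi d D) (phi d E) u $$ (0, d - 1) =
        (-1) ^ length u * (-1) ^ (0 + (d - 1)) * word_mat d D E (rev u) $$ (d - 1 - (d - 1), d - 1 - 0)"
      by (rule word_mat_phi_entry) (use d0 in auto)
    thus ?thesis using d unfolding phi_D[OF sd] E'_def lam_def by simp
  qed
  have f_rev: "f (rev u) = - ((-1) ^ length u) * f u" for u
  proof -
    have "(-1 :: 'a) ^ length u * (-1) ^ length u = 1" by (simp add: power_mult_distrib[symmetric])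
    hence "(-1) ^ length u * ((-1) ^ length u * lam (rev u)) = lam (rev u)"
      by (simp add: mult.assoc[symmetric])
    thus ?thesis by (simp add: f_def algebra_simps)
  qed
  have lam_zero: "bracket_eval z lam = 0" for z
  proof (cases "count (mset z) True = k - 1")
    case True
    hence "word_bracket d D E z = 0\<^sub>m d d" using no by blast
    moreover have "word_bracket d D E z $$ (0, d - 1) = bracket_eval z lam"
      unfolding lam_def by (rule word_bracket_entry) (use d0 in auto)
    ultimately show ?thesis using d0 by simp
  next
    case False
    \<comment> \<open>The grading by blocks kills the corner entry of words with any other number of
      letters E, so \<open>lam\<close> vanishes on all brackets.\<close>
    have "bracket_eval z lam = bracket_eval z (\<lambda>u. 0)"
    proof (rule bracket_eval_cong)
      fix u assume m: "mset u = mset z"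
      show "lam u = 0"
      proof (rule ccontr)
        assume "lam u \<noteq> 0"
        hence "blk ds (d - 1) = blk ds 0 + count (mset u) True"
          unfolding lam_def using d0 by (intro word_mat_grading) auto
        thus False using False m blk_last by simp
      qed
    qed
    thus ?thesis by simp
  qed
  have f_zero: "bracket_eval z f = 0" for z
  proof (cases "length z = d - 1 - n")
    case True
    have "bracket_eval z f = bracket_eval z (\<lambda>u. lam u - (-1) ^ length z * lam (rev u))"
    proof (rule bracket_eval_cong)
      fix u assume "mset u = mset z"
      hence "length u = length z" by (rule mset_eq_length)
      thus "f u = lam u - (-1) ^ length z * lam (rev u)" using True by (simp add: f_def)
    qed
    also have "\<dots> = bracket_eval z lam - (-1) ^ length z * bracket_eval z (\<lambda>u. lam (rev u))"
      by (simp only: bracket_eval_diff bracket_eval_scale)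
    also have "\<dots> = 0" unfolding bracket_eval_rev lam_zero by simp
    finally show ?thesis .
  next
    case False
    have "bracket_eval z f = bracket_eval z (\<lambda>u. 0)"
    proof (rule bracket_eval_cong)
      fix u assume "mset u = mset z"
      hence "length u = length z" by (rule mset_eq_length)
      thus "f u = 0" using False by (simp add: f_def)
    qed
    thus ?thesis by simp
  qed
  have nd: "n + 1 < d" using ex_n by auto
  have f_sum: "f u = (\<Sum>m<length u. if u ! m \<and> take m u = map W [0..<m] \<and>
        drop (Suc m) u = map W [m + n + 1..<d - 1] then X m (m + n + 1) else 0)"
    if lu: "length u = d - 1 - n" for u
  proof -
    have l: "0 + length u + n = d - 1" using lu nd by simp
    have "word_mat d D E u $$ (0, 0 + length u + n) - word_mat d D E' u $$ (0, 0 + length u + n) =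
      (\<Sum>m<length u. if u ! m \<and> take m u = map W [0..<0 + m] \<and>
        drop (Suc m) u = map W [0 + m + n + 1..<0 + length u + n]
      then E $$ (0 + m, 0 + m + n + 1) - E' $$ (0 + m, 0 + m + n + 1) else 0)"
      by (rule word_mat_first_difference[OF E_mat_carrier E_strict_upper E' E'_upper sup sup' eq])
        (use l d0 in auto)
    hence "lam u - word_mat d D E' u $$ (0, d - 1) = (\<Sum>m<length u. if u ! m \<and> take m u = map W [0..<m] \<and>
        drop (Suc m) u = map W [m + n + 1..<d - 1] then X m (m + n + 1) else 0)"
      unfolding l X_def[symmetric] lam_def[symmetric] by (simp only: add_0)
    moreover have "f u = lam u - word_mat d D E' u $$ (0, d - 1)" unfolding lam' using lu by (simp add: f_def)
    ultimately show ?thesis by (simp only:)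
  qed
  have u_eq: "u = ?u m" if "u ! m" "take m u = map W [0..<m]"
      "drop (Suc m) u = map W [m + n + 1..<d - 1]" "m < length u" for u m
    using id_take_nth_drop[OF that(4)] that(1) unfolding that(2,3) by simp
  \<comment> \<open>A non-zero difference lies in a block above the diagonal blocks, so the
    contracted stretch crosses exactly one boundary.\<close>
  have one: "count (mset (map W [m..<m + n + 1])) True = 1" if m: "m + n + 1 < d" "X m (m + n + 1) \<noteq> 0" for m
  proof -
    have "blk ds (m + n + 1) = Suc (blk ds m)" using X_nonzero[of m "m + n + 1"] m by simp
    moreover have "blk ds (m + n + 1) = blk ds m + count (mset (map W [m..<m + n + 1])) True"
      using blk_add[of m "n + 1"] m(1) by (simp only: add.assoc)
    ultimately show ?thesis by linarith
  qed
  have f_supp: "u \<in> shortened ?w n" if fu: "f u \<noteq> 0" for u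
  proof -
    have lu: "length u = d - 1 - n" using fu unfolding f_def by (auto split: if_splits)
    let ?t = "\<lambda>m. if u ! m \<and> take m u = map W [0..<m] \<and>
        drop (Suc m) u = map W [m + n + 1..<d - 1] then X m (m + n + 1) else 0"
    have "(\<Sum>m<length u. ?t m) \<noteq> 0" using fu unfolding f_sum[OF lu] .
    then obtain m where "m \<in> {..<length u}" and t: "?t m \<noteq> 0"
      by (rule sum.not_neutral_contains_not_neutral)
    hence m: "m < length u" by simp
    have c: "u ! m \<and> take m u = map W [0..<m] \<and> drop (Suc m) u = map W [m + n + 1..<d - 1]"
    proof (rule ccontr)
      assume "\<not> ?thesis"
      hence "?t m = 0" by (rule if_not_P)
      with t show False ..
    qed
    have nz: "X m (m + n + 1) \<noteq> 0" using t unfolding if_P[OF c] .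
    have md: "m + n + 1 < d" using m lu by simp
    obtain p q where pq: "map W [m..<m + n + 1] = replicate p False @ True # replicate q False"
      using count_True_one_split[OF one[OF md nz]] .
    have "n + 1 = length (map W [m..<m + n + 1])" by (simp del: upt_Suc)
    also have "\<dots> = p + q + 1" unfolding pq by simp
    finally have "p + q = n" by simp
    moreover have "?w = map W [0..<m] @ map W [m..<m + n + 1] @ map W [m + n + 1..<d - 1]"
      using md upt_split[of 0 m "d - 1"] upt_split[of m "m + n + 1" "d - 1"]
      by (simp only: map_append[symmetric])
    hence "?w = map W [0..<m] @ replicate p False @ True # replicate q False @ map W [m + n + 1..<d - 1]"
      unfolding pq by (simp only: append_assoc append_Cons)
    moreover have "u = ?u m" by (rule u_eq) (use c m in blast)+
    ultimately show ?thesis unfolding shortened_def by blast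
  qed
  have even_w: "even (count (mset ?w) True)"
    using blk_add[of 0 "d - 1"] blk_last d_gt k by simp
  have f0: "f u = 0" for u
    by (rule shortened_palindrome_zero[OF pal even_w n0 f_rev f_supp f_zero])
  obtain r where r: "r + n + 1 < d" "X r (r + n + 1) \<noteq> 0" using ex_n by blast
  \<comment> \<open>The hypotheses are what equality of the contracted words at \<open>p\<close> and
    \<open>q\<close> amounts to. A non-zero difference at \<open>p\<close> makes the
    \<open>n\<close> letters after \<open>p\<close> False, and the periodicity \<open>mid\<close>
    carries this on up to \<open>q + n\<close>. So the rows from \<open>p + 1\<close> to
    \<open>q + n\<close> form one block, and \<open>normalized_edge\<close> compares the entries on
    its two sides.\<close>
  have same: "X p (p + n + 1) = X q (q + n + 1)"
    if pq: "p < q" "q + n + 1 < d" and Wp: "W p" and Wq: "W (q + n)"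
      and mid: "\<And>t. p < t \<Longrightarrow> t < q \<Longrightarrow> W (t + n) = W t"
      and nz: "X p (p + n + 1) \<noteq> 0" for p q
  proof -
    have first: "\<not> W t" if t: "p < t" "t < p + n + 1" for t
    proof
      assume Wt: "W t"
      have "[p..<p + n + 1] = [p..<t] @ [t..<p + n + 1]" by (rule upt_split) (use t in auto)
      moreover have "[p..<t] = p # [Suc p..<t]" "[t..<p + n + 1] = t # [Suc t..<p + n + 1]"
        using t by (simp_all add: upt_conv_Cons)
      ultimately have "count (mset (map W [p..<p + n + 1])) True \<ge> 2"
        using Wp Wt by (simp del: upt_Suc)
      thus False using one[OF _ nz] pq by simp
    qed
    have gap: "\<not> W t" if "p < t" "t < q + n" for t
      using that
    proof (induction t rule: less_induct)
      case (less t)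
      show ?case
      proof (cases "t < p + n + 1")
        case True
        thus ?thesis using first less.prems by blast
      next
        case False
        have "\<not> W (t - n)" by (rule less.IH) (use False less.prems n0 in auto)
        moreover have "W (t - n + n) = W (t - n)" by (rule mid) (use False less.prems in auto)
        ultimately show ?thesis using False by simp
      qed
    qed
    have a: "E $$ (p, p + n + 1) = E $$ (q, q + n + 1)"
      by (rule normalized_edge[OF norm pq Wp Wq gap])
    \<comment> \<open>Reflection exchanges the two positions: \<open>p'\<close> comes from
      \<open>q\<close> and \<open>q'\<close> from \<open>p\<close>. The same argument there compares
      the entries of phi(E).\<close>
    define p' where "p' = d - 2 - n - q"
    define q' where "q' = d - 2 - n - p"
    have pq': "p' < q'" "q' + n + 1 < d" using pq by (auto simp: p'_def q'_def)
    have "W (d - 2 - (q + n)) = W (q + n)" by (rule Wsym) (use pq in simp)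
    moreover have "d - 2 - (q + n) = p'" by (simp add: p'_def)
    ultimately have Wp': "W p'" using Wq by simp
    have "W (d - 2 - p) = W p" by (rule Wsym) (use pq in simp)
    moreover have "d - 2 - p = q' + n" using pq by (simp add: q'_def)
    ultimately have Wq': "W (q' + n)" using Wp by simp
    have gap': "\<not> W t" if t: "p' < t" "t < q' + n" for t
    proof -
      have "W (d - 2 - t) = W t" by (rule Wsym) (use t pq' in simp)
      moreover have "\<not> W (d - 2 - t)" by (rule gap) (use t pq in \<open>auto simp: p'_def q'_def\<close>)
      ultimately show ?thesis by simp
    qed
    have b: "E $$ (p', p' + n + 1) = E $$ (q', q' + n + 1)"
      by (rule normalized_edge[OF norm pq' Wp' Wq' gap'])
    have "E' $$ (p, p + n + 1) = (-1) ^ n * E $$ (q', q' + n + 1)"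
      using E'_shift[of p n] pq by (simp add: q'_def)
    moreover have "E' $$ (q, q + n + 1) = (-1) ^ n * E $$ (p', p' + n + 1)"
      using E'_shift[of q n] pq by (simp add: p'_def)
    ultimately show ?thesis using a b by (simp add: X_def)
  qed
  have same': "X p (p + n + 1) = X q (q + n + 1)"
    if pq: "p < q" "q + n + 1 < d" and e: "?u p = ?u q" and nz: "X p (p + n + 1) \<noteq> 0" for p q
  proof -
    have lo: "?u m ! t = W t" if "t < m" for m t using that by (simp add: nth_append)
    have at: "?u m ! m" for m by (simp add: nth_append)
    have hi: "?u m ! t = W (t + n)" if t: "m < t" "t + n + 1 < d" for m t
    proof -
      have i: "t - Suc m < length [m + n + 1..<d - 1]" using t by simp
      have "?u m ! t = (True # map W [m + n + 1..<d - 1]) ! (t - m)" using t by (simp add: nth_append)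
      also have "t - m = Suc (t - Suc m)" using t by simp
      also have "(True # map W [m + n + 1..<d - 1]) ! Suc (t - Suc m) = W ([m + n + 1..<d - 1] ! (t - Suc m))"
        using i by (simp only: nth_Cons_Suc nth_map)
      also have "[m + n + 1..<d - 1] ! (t - Suc m) = m + n + 1 + (t - Suc m)"
        by (rule nth_upt) (use t in simp)
      also have "\<dots> = t + n" using t by simp
      finally show ?thesis .
    qed
    have e': "?u p ! t = ?u q ! t" for t by (rule arg_cong[OF e])
    have Wp: "W p" using e'[of p] lo[OF pq(1)] at[of p] by blast
    have Wq: "W (q + n)" using e'[of q] hi[OF pq] at[of q] by blast
    have mid: "W (t + n) = W t" if "p < t" "t < q" for t
      using e'[of t] hi[of p t] lo[of t q] that pq by simp
    show ?thesis by (rule same[OF pq Wp Wq mid nz])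
  qed
  have same'': "X m (m + n + 1) = X r (r + n + 1)"
    if m: "m + n + 1 < d" "?u m = ?u r" "X m (m + n + 1) \<noteq> 0" for m
    using same'[of m r] same'[of r m] m r by (cases m r rule: linorder_cases) auto
  \<comment> \<open>All positions that contract to the same word as \<open>r\<close>; their equal
    contributions cannot cancel in characteristic 0.\<close>
  let ?K = "{m. m < length (?u r) \<and> ?u m = ?u r \<and> X m (m + n + 1) \<noteq> 0}"
  have lu: "length (?u r) = d - 1 - n" using r(1) by simp
  have "f (?u r) = (\<Sum>m<length (?u r). if m \<in> ?K then X r (r + n + 1) else 0)"
    unfolding f_sum[OF lu]
  proof (rule sum.cong)
    fix m assume "m \<in> {..<length (?u r)}"
    hence m: "m < length (?u r)" by simp
    hence md: "m + n + 1 < d" unfolding lu by simp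
    have "(?u r ! m \<and> take m (?u r) = map W [0..<m] \<and>
        drop (Suc m) (?u r) = map W [m + n + 1..<d - 1]) \<longleftrightarrow> ?u m = ?u r" (is "?c \<longleftrightarrow> _")
    proof
      assume c: ?c
      have "?u r = ?u m"
        by (rule u_eq[OF c[THEN conjunct1] c[THEN conjunct2, THEN conjunct1]
              c[THEN conjunct2, THEN conjunct2] m])
      thus "?u m = ?u r" by (rule sym)
    next
      assume e: "?u m = ?u r"
      have "?u m ! m \<and> take m (?u m) = map W [0..<m] \<and>
        drop (Suc m) (?u m) = map W [m + n + 1..<d - 1]" by (simp add: nth_append)
      thus ?c unfolding e .
    qed
    hence c: "?c = (?u m = ?u r)" .
    show "(if ?c then X m (m + n + 1) else 0) = (if m \<in> ?K then X r (r + n + 1) else 0)"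
      unfolding c using same''[OF md] m by auto
  qed simp
  also have "\<dots> = (\<Sum>m\<in>?K. X r (r + n + 1))"
    by (rule sum.mono_neutral_cong_right) auto
  also have "\<dots> = of_nat (card ?K) * X r (r + n + 1)" by simp
  also have "\<dots> \<noteq> 0"
  proof -
    have "r \<in> ?K" using r lu by simp
    hence ne: "?K \<noteq> {}" by (rule ex_in_conv[THEN iffD1, OF exI])
    have fin: "finite ?K" by simp
    have "card ?K \<noteq> 0" unfolding card_0_eq[OF fin] by (rule ne)
    thus ?thesis using r by simp
  qed
  finally show False using f0 by blast
qed

lemma word_bracket_nonzero_lower_central:
  assumes "count (mset z) True = Suc n" "word_bracket d D E z \<noteq> 0\<^sub>m d d"
  shows "lower_central d L n \<noteq> {0\<^sub>m d d}"
  using word_bracket_lower_central[OF L_subalgebra _ E_in_L D_derivation assms(1)] assms(2) by auto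

end

section \<open>The nilpotency degree in each case\<close>

theorem theorem3p17:
  fixes ds :: "nat list" and S T :: "'a :: field_char_0 mat list"
  assumes "length ds \<ge> 2" and "\<forall>i<length ds. ds ! i > 0"
    and "block_seq ds S"
    and "block_seq ds T" and "normalized ds T"
    and "G_conjugate ds (E_mat ds T) (E_mat ds S)"
  shows "(all_ones_dims ds \<longrightarrow>
            lie_dim (sum_list ds) (n_alg ds S) = 1 \<and> lie_abelian (sum_list ds) (n_alg ds S)) \<and>
         (phi_exception ds T \<and> \<not> all_ones_dims ds \<longrightarrow>
            has_nilpotency_degree (sum_list ds) (n_alg ds S) (length ds - 2)) \<and>
         (\<not> all_ones_dims ds \<and> \<not> phi_exception ds T \<longrightarrow>
            has_nilpotency_degree (sum_list ds) (n_alg ds S) (length ds - 1))"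
proof -
  interpret S: block_matrices ds S using assms by unfold_locales auto
  interpret T: block_matrices ds T using assms by unfold_locales auto
  let ?d = "sum_list ds" and ?k = "length ds" and ?D = "D_mat ds :: 'a mat"
  let ?L = "lower_central ?d (n_alg ds S)"
  obtain P Q where PG: "P \<in> G_group ds" and wit: "similar_mat_wit (E_mat ds T) (E_mat ds S) P Q"
    using assms(6) unfolding G_conjugate_def by blast
  note wit = similar_mat_witD2[OF E_mat_carrier wit]
  have PQ: "P \<in> carrier_mat ?d ?d" "Q \<in> carrier_mat ?d ?d" "Q * P = 1\<^sub>m ?d" "P * Q = 1\<^sub>m ?d"
    using wit by auto
  have conj: "P * E_mat ds S * Q = E_mat ds T" by (rule wit(3)[symmetric])
  have "P * ?D * Q = ?D * (P * Q)"
    unfolding G_group_commute[OF PG] by (rule assoc_mult_mat[OF D_mat_carrier PQ(1,2)])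
  hence PDQ: "P * ?D * Q = ?D" unfolding PQ(4) right_mult_one_mat[OF D_mat_carrier] .
  \<comment> \<open>Once a term of the series is zero all later ones are, so two neighbouring terms
    decide the degree.\<close>
  have degreeI: "has_nilpotency_degree ?d (n_alg ds S) (Suc m)"
    if "?L (Suc m) = {0\<^sub>m ?d ?d}" "?L m \<noteq> {0\<^sub>m ?d ?d}" for m
    unfolding has_nilpotency_degree_def
  proof (intro conjI allI impI)
    fix i assume i: "i < Suc m"
    show "?L i \<noteq> {0\<^sub>m ?d ?d}"
    proof
      assume "?L i = {0\<^sub>m ?d ?d}"
      hence "?L m = {0\<^sub>m ?d ?d}"
        by (rule lower_central_zero_mono[OF S.L_subalgebra]) (use i in simp)
      with that(2) show False ..
    qed
  qed fact
  show ?thesis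
  proof (intro conjI impI)
    assume ones: "all_ones_dims ds"
    show "lie_dim ?d (n_alg ds S) = 1" "lie_abelian ?d (n_alg ds S)"
      using S.all_ones_case[OF ones] by auto
  next
    assume a: "phi_exception ds T \<and> \<not> all_ones_dims ds"
    hence k: "odd ?k" "symmetric_dims ds" "odd (ds ! ((?k - 1) div 2))"
      and ends: "ds ! 0 = 1" "ds ! (?k - 1) = 1" and inv: "phi ?d (E_mat ds T) = E_mat ds T"
      unfolding phi_exception_def odd_symmetric_dims_def phi_invariant_def by auto
    have k2: "?k > 2" using assms(1) k(1) by (metis even_numeral le_neq_implies_less)
    have d: "odd ?d" using S.symmetric_odd_sum[OF k(2,1)] k(3) by simp
    have "?L (?k - 2) = {0\<^sub>m ?d ?d}"
      by (rule S.lower_central_phi_invariant[OF PQ(1-3) PDQ _ _ k(2) d ends k2])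
        (use T.E_filtered inv conj in auto)
    moreover have "?L (?k - 3) \<noteq> {0\<^sub>m ?d ?d}"
      using a by (intro S.lower_central_nonzero_inner[OF ends _ k(1) k2]) simp
    moreover have "?k - 2 = Suc (?k - 3)" using k2 by simp
    ultimately show "has_nilpotency_degree ?d (n_alg ds S) (?k - 2)" using degreeI by metis
  next
    assume a: "\<not> all_ones_dims ds \<and> \<not> phi_exception ds T"
    have k1: "?k - 1 = Suc (?k - 2)" using assms(1) by linarith
    have "?L (?k - 2) \<noteq> {0\<^sub>m ?d ?d}"
    proof (cases "ds ! 0 > 1 \<or> ds ! (?k - 1) > 1")
      case True
      thus ?thesis using S.lower_central_nonzero_first S.lower_central_nonzero_last by blast
    next
      case False
      have "ds ! 0 > 0" "ds ! (?k - 1) > 0" using assms(1,2) by auto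
      hence ends: "ds ! 0 = 1" "ds ! (?k - 1) = 1" using False by auto
      let ?w = "map S.W [0..<0 + (?d - 1)]"
      have d1: "0 + (?d - 1) < ?d" using S.d_gt by simp
      have b: "blk ds (0 + (?d - 1)) = blk ds 0 + Suc (?k - 2)" using S.blk_last k1 by simp
      show ?thesis
      proof (cases "excluded ?w")
        case False
        from S.lower_central_nonzero_interval[OF d1 False b] show ?thesis .
      next
        case True
        then consider m x where "?w = replicate m x" | "rev ?w = ?w" "even (length ?w)"
          unfolding excluded_def by blast
        thus ?thesis
        proof cases
          case 1
          have Wx: "S.W r = x" if "r < ?d - 1" for r
          proof -
            have "S.W r \<in> set ?w" unfolding set_map by (rule imageI) (use that in auto)
            thus ?thesis unfolding 1 by simp
          qed
          \<comment> \<open>As the first block has size 1, the first letter is True. A power is then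
            a power of True, and every block has size 1, contrary to the assumption.\<close>
          have "blk ds 1 = 1" using S.blk_block_start[of 1] block_start_Suc[of 0 ds] ends assms(1) by simp
          hence "S.W 0" by (simp add: S.W_def)
          hence W: "S.W r" if "r < ?d - 1" for r using Wx[of 0] Wx[OF that] S.d_gt by simp
          have "ds ! i = 1" if i: "i < ?k" for i
          proof (rule ccontr)
            assume "ds ! i \<noteq> 1"
            moreover have "ds ! i > 0" using assms(2) i by blast
            ultimately have i2: "Suc (block_start ds i) < block_start ds (Suc i)"
              using block_start_Suc[OF i] by simp
            hence "blk ds (block_start ds i) = i" "blk ds (Suc (block_start ds i)) = i"
              by (auto intro!: blk_eqI)
            hence "\<not> S.W (block_start ds i)" by (simp add: S.W_def)
            moreover have "block_start ds i < ?d - 1" using i2 block_start_le[of ds "Suc i"] by simp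
            ultimately show False using W by blast
          qed
          thus ?thesis using a unfolding all_ones_dims_def by blast
        next
          case 2
          have pal: "rev (map S.W [0..<?d - 1]) = map S.W [0..<?d - 1]" using 2(1) by simp
          have "length ?w = ?d - 1" by (simp only: length_map length_upt add_0 diff_zero)
          hence "even (?d - 1)" using 2(2) by (simp only:)
          hence d: "odd ?d" using S.d_gt by presburger
          have sym: "symmetric_dims ds" by (rule S.palindrome_symmetric[OF pal])
          \<comment> \<open>The number of letters True is \<open>k - 1\<close>; its being even gives
            the odd \<open>k\<close> that odd-symmetry asks for.\<close>
          have "even (count (mset ?w) True)" by (rule even_count_palindrome[OF 2])
          hence "even (?k - 1)" using S.blk_add[OF d1] b k1 by simp
          hence k: "odd ?k" using assms(1) by simp
          have "odd_symmetric_dims ds"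
            unfolding odd_symmetric_dims_def using sym k d S.symmetric_odd_sum[OF sym k] by blast
          hence ninv: "\<not> phi_invariant ds T" using a k ends unfolding phi_exception_def by blast
          obtain z where z: "count (mset z) True = ?k - 1" "word_bracket ?d ?D (E_mat ds T) z \<noteq> 0\<^sub>m ?d ?d"
            using T.palindrome_bracket_nonzero[OF assms(5) pal d k ninv] by blast
          \<comment> \<open>The normal form is only used to find the bracket \<open>z\<close>;
            conjugation brings its non-vanishing back from \<open>T\<close> to
            \<open>S\<close>.\<close>
          have "P * word_bracket ?d ?D (E_mat ds S) z * Q = word_bracket ?d ?D (E_mat ds T) z"
            by (rule conj_word_bracket[OF PQ(1-3) D_mat_carrier PDQ E_mat_carrier conj])
          hence "word_bracket ?d ?D (E_mat ds S) z \<noteq> 0\<^sub>m ?d ?d" using z(2) PQ(1,2) by auto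
          thus ?thesis using z(1) k1 by (intro S.word_bracket_nonzero_lower_central) auto
        qed
      qed
    qed
    moreover have "?L (Suc (?k - 2)) = {0\<^sub>m ?d ?d}" using S.lower_central_k k1 by simp
    ultimately show "has_nilpotency_degree ?d (n_alg ds S) (?k - 1)" using degreeI k1 by metis
  qed
qed

end
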